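(* Let $B=\{x\in\mathbb R^N: |x|<1\}$ and let $f:\mathbb R\to\mathbb R$ be locally Lipschitz. Assume: (i) $f$ is positive for large values: there exists $a>0$ with $f(a)>0$ and $f(t)\ge 0$ for all $t>a$; (ii) the Keller–Osserman condition holds: $\int_{t_0}^\infty \frac{ds}{\sqrt{F(s)}}<+\infty$ for some (large) $t_0$, where $F(t)=\int_0^t f(s)\,ds$; (iii) there exist $p>1$ and $K>0$ such that $t\mapsto f(t)+Kt^p$ is nondecreasing for all sufficiently large $t$; (iv) $\displaystyle\lim_{t\to+\infty}\frac{t^{\frac{p-1}{2}}\phi(t)}{\sqrt{F(t)}}=0$, with the same $p$ as in (iii), where $\phi(t)=\int_t^\infty \frac{ds}{F(s)}$. Then every solution $u\in C^2(B)$ of $\Delta u=f(u)$ in $B$ with $u(x)\to+\infty$ as $x\to\partial B$ is radially symmetric and radially increasing (i.e. $u(x)=v(|x|)$ and $\partial_r u>0$ in $B\setminus\{0\}$).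
   Context: A solution of the boundary blow-up problem means $u\in C^2(B)$ with $\Delta u=f(u)$ in $B$ and $u(x)\to+\infty$ whenever $x\to\partial B$. Under (i) and (ii), $F(t)>0$ for large $t$, so $\phi(t)=\int_t^\infty ds/F(s)$ is well defined for large $t$. *)

theory Defs
  imports "HOL-Analysis.Analysis"
begin

definition partial_dir :: "('a::euclidean_space \<Rightarrow> real) \<Rightarrow> 'a \<Rightarrow> 'a \<Rightarrow> real" where
  "partial_dir u i x = deriv (\<lambda>t. u (x + t *\<^sub>R i)) 0"

definition C2_on :: "'a::euclidean_space set \<Rightarrow> ('a \<Rightarrow> real) \<Rightarrow> bool" where
  "C2_on S u \<longleftrightarrow> continuous_on S u \<and>
     (\<forall>i\<in>Basis. (\<forall>x\<in>S. (\<lambda>t. u (x + t *\<^sub>R i)) differentiable (at 0)) \<and>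
        continuous_on S (partial_dir u i) \<and>
        (\<forall>j\<in>Basis. (\<forall>x\<in>S. (\<lambda>t. partial_dir u i (x + t *\<^sub>R j)) differentiable (at 0)) \<and>
           continuous_on S (partial_dir (partial_dir u i) j)))"

definition laplacian :: "('a::euclidean_space \<Rightarrow> real) \<Rightarrow> 'a \<Rightarrow> real" where
  "laplacian u x = (\<Sum>i\<in>Basis. partial_dir (partial_dir u i) i x)"

definition locally_lipschitz :: "(real \<Rightarrow> real) \<Rightarrow> bool" where
  "locally_lipschitz f \<longleftrightarrow> (\<forall>x. \<exists>e>0. \<exists>L. L-lipschitz_on (cball x e) f)"

definition prim :: "(real \<Rightarrow> real) \<Rightarrow> real \<Rightarrow> real" where
  "prim f t = integral {0..t} f"

definition phi :: "(real \<Rightarrow> real) \<Rightarrow> real \<Rightarrow> real" where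
  "phi f t = integral {t..} (\<lambda>s. 1 / prim f s)"

end

theory Submission
  imports Defs
begin

text \<open>
  Write \<open>n\<close> for the dimension minus one and \<open>F = prim f\<close>. Radial solutions near the boundary are
  described by their energy \<open>G(V) = (v')^2 / 2\<close> as a function of the value \<open>V\<close>; it solves
  \<open>G' = f - n * sqrt (2 G) / r\<close> with \<open>1 - r = D(V)\<close>, where \<open>D(V)\<close> is the integral of
  \<open>1 / sqrt (2 G)\<close> over \<open>{V..}\<close>, and is found by a contraction argument.
  Since \<open>f\<close> need not be monotone, a solution \<open>u\<close> is compared with such profiles through
  \<open>D (u x) - (1 - |x|)\<close>: shifting a profile in \<open>r\<close> keeps the value of \<open>u\<close> at a contact point, so
  values of \<open>f\<close> at different arguments are never compared, and the effect of the shift on the curvature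
  term is absorbed by a quadratic weight. A profile of small initial energy bounds every solution from above,
  one of large initial energy bounds it from below, and two profiles differ by a bounded
  amount of energy. Hence \<open>D (u x) \<le> 1 - |x| \<le> D (u x) + C * phi (u x) / sqrt (F (u x))\<close> near the boundary.

  If \<open>u\<close> takes a larger value at the mirror image of \<open>x\<close> than at \<open>x\<close>, this estimate forces the distance
  of \<open>x\<close> to the mirror plane to be at most a multiple of \<open>phi t / sqrt (F t)\<close> with \<open>t\<close> the reflected
  value. By (iii) and (iv) that distance is small compared with the inverse square root of the zero-order coefficient
  in the equation of the difference, so the maximum principle for narrow domains applies up to the corners
  where the plane meets the sphere, and the moving plane method goes through.
\<close>

section \<open>Second-order jets\<close>

text \<open>Near the sphere only the values of \<open>u\<close> are under control, not its gradient,
  and the zero-order coefficient in the equation of the difference of \<open>u\<close> and its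
  reflection is unbounded there. This dictates the shape of the boundary estimate: its two sides use
  one and the same function \<open>D\<close>, so they can be subtracted at two different points, and
  the error is evaluated at the larger value alone. A reflection shortens the radius by at least a
  fixed multiple of the distance \<open>s\<close> to the plane; this turns the radial estimate into
  a bound for \<open>s\<close>. By (iii) the coefficient near a reflected value \<open>t\<close> is
  at least \<open>- K p (2 t)^(p-1)\<close>, and its product with \<open>s^2\<close> is at most a
  constant times the square of the quotient in (iv): hence the exponent \<open>(p - 1) / 2\<close>
  there. The error has the form \<open>phi / sqrt F\<close> because a bounded energy difference
  changes the integrand of \<open>D\<close> by a multiple of \<open>F^(-3/2)\<close>. The numbers 16
  that recur are chosen so that the curvature term is a small perturbation in a shell of width
  \<open>1 / (16 N)\<close>, with \<open>N\<close> the dimension.\<close>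

text \<open>The first derivative exists near 0, the second only at 0: this is enough for the second
  derivative test and is stable under sums and compositions.\<close>

definition has_jet :: "(real \<Rightarrow> real) \<Rightarrow> real \<Rightarrow> real \<Rightarrow> bool" where
  "has_jet g p q \<longleftrightarrow> (\<exists>g'. (\<forall>\<^sub>F t in nhds 0. (g has_real_derivative g' t) (at t)) \<and>
     g' 0 = p \<and> (g' has_real_derivative q) (at 0))"

lemma has_jetI:
  assumes "\<And>t. (g has_real_derivative g' t) (at t)" "g' 0 = p" "(g' has_real_derivative q) (at 0)"
  shows "has_jet g p q"
  using assms unfolding has_jet_def by (intro exI[of _ g']) auto

lemma has_jet_add:
  assumes "has_jet g p q" "has_jet h p' q'"
  shows "has_jet (\<lambda>t. g t + h t) (p + p') (q + q')"
proof -
  obtain g' h' where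
    g: "\<forall>\<^sub>F t in nhds 0. (g has_real_derivative g' t) (at t)" "g' 0 = p" "(g' has_real_derivative q) (at 0)" and
    h: "\<forall>\<^sub>F t in nhds 0. (h has_real_derivative h' t) (at t)" "h' 0 = p'" "(h' has_real_derivative q') (at 0)"
    using assms unfolding has_jet_def by blast
  have "\<forall>\<^sub>F t in nhds 0. ((\<lambda>t. g t + h t) has_real_derivative (g' t + h' t)) (at t)"
    using g(1) h(1) by eventually_elim (rule DERIV_add)
  moreover have "((\<lambda>t. g' t + h' t) has_real_derivative q + q') (at 0)"
    by (rule DERIV_add[OF g(3) h(3)])
  ultimately show ?thesis using g(2) h(2) unfolding has_jet_def
    by (intro exI[of _ "\<lambda>t. g' t + h' t"]) auto
qed

lemma has_jet_compose:
  assumes g: "has_jet g p q"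
    and h: "\<forall>\<^sub>F z in nhds (g 0). (h has_real_derivative h' z) (at z)"
    and h2: "(h' has_real_derivative h'') (at (g 0))"
  shows "has_jet (\<lambda>t. h (g t)) (h' (g 0) * p) (h' (g 0) * q + h'' * p\<^sup>2)"
proof -
  obtain g' where
    g: "\<forall>\<^sub>F t in nhds 0. (g has_real_derivative g' t) (at t)" "g' 0 = p" "(g' has_real_derivative q) (at 0)"
    using g unfolding has_jet_def by blast
  have g0: "(g has_real_derivative p) (at 0)" using g(1,2) eventually_nhds_x_imp_x by blast
  hence "isCont g 0" by (rule DERIV_isCont)
  hence "(g \<longlongrightarrow> g 0) (nhds 0)" by (simp add: continuous_at tendsto_at_iff_tendsto_nhds)
  hence "\<forall>\<^sub>F t in nhds 0. (h has_real_derivative h' (g t)) (at (g t))"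
    using h unfolding filterlim_iff by blast
  hence "\<forall>\<^sub>F t in nhds 0. ((\<lambda>t. h (g t)) has_real_derivative (h' (g t) * g' t)) (at t)"
    using g(1) by eventually_elim (rule DERIV_chain2)
  moreover have "((\<lambda>t. h' (g t) * g' t) has_real_derivative (h' (g 0) * q + h'' * p\<^sup>2)) (at 0)"
    using DERIV_mult[OF DERIV_chain2[OF h2 g0] g(3)] g(2)
    by (simp add: algebra_simps power2_eq_square)
  ultimately show ?thesis using g(2) unfolding has_jet_def
    by (intro exI[of _ "\<lambda>t. h' (g t) * g' t"]) auto
qed

lemma has_jet_cmult: "has_jet g p q \<Longrightarrow> has_jet (\<lambda>t. c * g t) (c * p) (c * q)"
  using has_jet_compose[of g p q "\<lambda>z. c * z" "\<lambda>_. c" 0] DERIV_cmult_Id[of c] by simp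

lemma has_jet_diff:
  assumes "has_jet g p q" "has_jet h p' q'"
  shows "has_jet (\<lambda>t. g t - h t) (p - p') (q - q')"
  using has_jet_add[OF assms(1) has_jet_cmult[OF assms(2), of "-1"]] by simp

text \<open>A positive \<open>q\<close> would make the derivative positive just to the right of 0,
  and the mean value theorem would push \<open>g\<close> above \<open>g 0\<close>.\<close>

lemma has_jet_local_max:
  assumes j: "has_jet g p q" and m: "\<forall>\<^sub>F t in nhds 0. g t \<le> g 0"
  shows "p = 0" "q \<le> 0"
proof -
  obtain g' where
    g: "\<forall>\<^sub>F t in nhds 0. (g has_real_derivative g' t) (at t)" "g' 0 = p" "(g' has_real_derivative q) (at 0)"
    using j unfolding has_jet_def by blast
  obtain d where d: "d > 0" "\<And>t. \<bar>t\<bar> < d \<Longrightarrow> (g has_real_derivative g' t) (at t) \<and> g t \<le> g 0"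
    using eventually_conj[OF g(1) m] unfolding eventually_nhds_metric
    by (auto simp: dist_real_def)
  show p: "p = 0"
    using DERIV_local_max[of g p 0 d] d g(2) by (auto simp: abs_minus_commute)
  show "q \<le> 0"
  proof (rule ccontr)
    assume "\<not> q \<le> 0"
    then obtain d' where d': "d' > 0" "\<And>h. 0 < h \<Longrightarrow> h < d' \<Longrightarrow> g' 0 < g' h"
      using DERIV_pos_inc_right[OF g(3)] by auto
    define t where "t = min d d' / 2"
    have t: "0 < t" "t < d" "t < d'" using d(1) d'(1) by (auto simp: t_def)
    have "\<exists>l z. 0 < z \<and> z < t \<and> (g has_real_derivative l) (at z) \<and> g t - g 0 = (t - 0) * l"
    proof (rule MVT)
      have dd: "(g has_real_derivative g' z) (at z)" if "0 \<le> z" "z \<le> t" for z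
        using d(2)[of z] that t by auto
      show "continuous_on {0..t} g"
        using dd by (intro continuous_at_imp_continuous_on ballI) (auto intro: DERIV_isCont)
      show "g differentiable (at z)" if "0 < z" "z < t" for z
        using dd[of z] that by (auto simp: real_differentiable_def)
    qed (use t in auto)
    then obtain l z where lz: "0 < z" "z < t" "(g has_real_derivative l) (at z)" "g t - g 0 = t * l"
      by auto
    have "l = g' z" using lz d(2)[of z] t DERIV_unique by fastforce
    hence "l > 0" using d'(2)[of z] lz t p g(2) by auto
    hence "g t > g 0" using lz t by (smt (verit) mult_pos_pos)
    thus False using d(2)[of t] t by auto
  qed
qed

text \<open>Only derivatives along coordinate axes are recorded: the maximum principle uses the
  gradient and the sum of the pure second derivatives, never a mixed one.\<close>

definition jet_at :: "('a::euclidean_space \<Rightarrow> real) \<Rightarrow> 'a \<Rightarrow> ('a \<Rightarrow> real) \<Rightarrow> ('a \<Rightarrow> real) \<Rightarrow> bool" where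
  "jet_at \<phi> x p q \<longleftrightarrow> (\<forall>i\<in>Basis. has_jet (\<lambda>t. \<phi> (x + t *\<^sub>R i)) (p i) (q i))"

lemma jet_at_add:
  "jet_at \<phi> x p q \<Longrightarrow> jet_at \<psi> x p' q' \<Longrightarrow> jet_at (\<lambda>y. \<phi> y + \<psi> y) x (\<lambda>i. p i + p' i) (\<lambda>i. q i + q' i)"
  unfolding jet_at_def by (auto intro: has_jet_add)

lemma jet_at_diff:
  "jet_at \<phi> x p q \<Longrightarrow> jet_at \<psi> x p' q' \<Longrightarrow> jet_at (\<lambda>y. \<phi> y - \<psi> y) x (\<lambda>i. p i - p' i) (\<lambda>i. q i - q' i)"
  unfolding jet_at_def by (auto intro: has_jet_diff)

lemma jet_at_cmult:
  "jet_at \<phi> x p q \<Longrightarrow> jet_at (\<lambda>y. c * \<phi> y) x (\<lambda>i. c * p i) (\<lambda>i. c * q i)"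
  unfolding jet_at_def by (auto intro: has_jet_cmult)

lemma jet_at_compose:
  assumes "jet_at \<phi> x p q"
    and "\<forall>\<^sub>F z in nhds (\<phi> x). (h has_real_derivative h' z) (at z)"
    and "(h' has_real_derivative h'') (at (\<phi> x))"
  shows "jet_at (\<lambda>y. h (\<phi> y)) x (\<lambda>i. h' (\<phi> x) * p i) (\<lambda>i. h' (\<phi> x) * q i + h'' * (p i)\<^sup>2)"
  using assms has_jet_compose unfolding jet_at_def by fastforce

lemma jet_at_local_max:
  assumes j: "jet_at \<phi> x p q" and m: "\<forall>\<^sub>F y in nhds x. \<phi> y \<le> \<phi> x"
  shows "i \<in> Basis \<Longrightarrow> p i = 0" "sum q Basis \<le> 0"
proof -
  have e: "\<forall>\<^sub>F t in nhds (0::real). \<phi> (x + t *\<^sub>R i) \<le> \<phi> (x + 0 *\<^sub>R i)" for i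
  proof -
    have "((\<lambda>t::real. x + t *\<^sub>R i) \<longlongrightarrow> x) (nhds 0)"
      by (intro tendsto_eq_intros) (auto intro: filterlim_ident)
    thus ?thesis using m unfolding filterlim_iff by auto
  qed
  show "i \<in> Basis \<Longrightarrow> p i = 0"
    using j e has_jet_local_max(1) unfolding jet_at_def by blast
  show "sum q Basis \<le> 0"
    using j e has_jet_local_max(2) unfolding jet_at_def by (intro sum_nonpos) blast
qed

lemma jet_at_local_min:
  assumes j: "jet_at \<phi> x p q" and m: "\<forall>\<^sub>F y in nhds x. \<phi> x \<le> \<phi> y"
  shows "i \<in> Basis \<Longrightarrow> p i = 0" "sum q Basis \<ge> 0"
  using jet_at_local_max[OF jet_at_cmult[OF j, of "-1"]] m by (auto simp: sum_negf)

lemma jet_at_inner: "jet_at (\<lambda>y. y \<bullet> e) x (\<lambda>i. i \<bullet> e) (\<lambda>i. 0)"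
  unfolding jet_at_def
  by (intro ballI has_jetI) (auto intro!: derivative_eq_intros simp: inner_add_left)

lemma jet_at_norm_sq: "jet_at (\<lambda>y. (norm (y - a))\<^sup>2) x (\<lambda>i. 2 * ((x - a) \<bullet> i)) (\<lambda>i. 2)"
proof -
  have "(norm (x + t *\<^sub>R i - a))\<^sup>2 = (norm (x - a))\<^sup>2 + 2 * t * ((x - a) \<bullet> i) + t\<^sup>2"
    if "i \<in> Basis" for t and i :: 'a
    using that unfolding power2_norm_eq_inner
    by (simp add: inner_simps inner_commute power2_eq_square algebra_simps)
  thus ?thesis unfolding jet_at_def
    by (intro ballI has_jetI[where g'="\<lambda>t. 2 * ((x - a) \<bullet> _) + 2 * t"])
       (auto intro!: derivative_eq_intros)
qed

lemma sum_Basis_inner_sq: "(\<Sum>i\<in>Basis. (x \<bullet> i)\<^sup>2) = (norm x)\<^sup>2"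
  by (simp add: euclidean_inner[of x x] power2_norm_eq_inner power2_eq_square[of "_ \<bullet> _"])

lemma jet_at_norm:
  assumes "x \<noteq> 0"
  shows "jet_at norm x (\<lambda>i. (x \<bullet> i) / norm x) (\<lambda>i. 1 / norm x - (x \<bullet> i)\<^sup>2 / norm x ^ 3)"
proof -
  have pos: "norm x > 0" using assms by simp
  have "\<forall>\<^sub>F z in nhds ((norm x)\<^sup>2). (sqrt has_real_derivative inverse (sqrt z) / 2) (at z)"
    using eventually_nhds_in_open[of "{0<..}" "(norm x)\<^sup>2"] pos
    by (auto elim!: eventually_mono intro!: DERIV_real_sqrt)
  moreover have "((\<lambda>z. inverse (sqrt z) / 2) has_real_derivative - 1 / (4 * norm x ^ 3)) (at ((norm x)\<^sup>2))"
    using pos by (auto intro!: derivative_eq_intros simp: field_simps power2_eq_square power3_eq_cube)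
  ultimately have "jet_at (\<lambda>y. sqrt ((norm (y - 0))\<^sup>2)) x
     (\<lambda>i. inverse (sqrt ((norm (x - 0))\<^sup>2)) / 2 * (2 * ((x - 0) \<bullet> i)))
     (\<lambda>i. inverse (sqrt ((norm (x - 0))\<^sup>2)) / 2 * 2 + - 1 / (4 * norm x ^ 3) * (2 * ((x - 0) \<bullet> i))\<^sup>2)"
    by (intro jet_at_compose jet_at_norm_sq) auto
  thus ?thesis using pos by (simp add: field_simps)
qed

lemma sum_norm_jet:
  assumes "(x::'a::euclidean_space) \<noteq> 0"
  shows "(\<Sum>i\<in>Basis. 1 / norm x - (x \<bullet> i)\<^sup>2 / norm x ^ 3) = (real DIM('a) - 1) / norm x"
    "(\<Sum>i\<in>Basis. ((x \<bullet> i) / norm x)\<^sup>2) = 1"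
proof -
  have n: "norm x > 0" using assms by simp
  have "(\<Sum>i\<in>Basis. 1 / norm x - (x \<bullet> i)\<^sup>2 / norm x ^ 3)
      = real DIM('a) * (1 / norm x) - (\<Sum>i\<in>Basis. (x \<bullet> i)\<^sup>2) / norm x ^ 3"
    by (simp add: sum_subtractf sum_divide_distrib)
  also have "\<dots> = (real DIM('a) - 1) / norm x"
    using n unfolding sum_Basis_inner_sq by (simp add: field_simps power2_eq_square power3_eq_cube)
  finally show "(\<Sum>i\<in>Basis. 1 / norm x - (x \<bullet> i)\<^sup>2 / norm x ^ 3) = (real DIM('a) - 1) / norm x" .
  have "(\<Sum>i\<in>Basis. ((x \<bullet> i) / norm x)\<^sup>2) = (\<Sum>i\<in>Basis. (x \<bullet> i)\<^sup>2) / (norm x)\<^sup>2"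
    by (simp add: power_divide sum_divide_distrib)
  thus "(\<Sum>i\<in>Basis. ((x \<bullet> i) / norm x)\<^sup>2) = 1" using n by (simp add: sum_Basis_inner_sq)
qed

section \<open>Derivatives along arbitrary lines\<close>

text \<open>Coordinates are changed one at a time. On each edge of the path the partial derivative
  stays within \<open>\<epsilon>\<close> of its value at \<open>x\<close>, so the mean value bound
  costs \<open>\<epsilon> * norm h\<close>; with \<open>\<epsilon> = e / DIM('a)\<close> the total
  is \<open>e * norm h\<close>.\<close>

lemma continuous_partials_imp_has_derivative:
  fixes g :: "'a::euclidean_space \<Rightarrow> real"
  assumes S: "open S" "x \<in> S"
    and D: "\<And>i y. i \<in> Basis \<Longrightarrow> y \<in> S \<Longrightarrow> (\<lambda>t. g (y + t *\<^sub>R i)) differentiable (at 0)"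
    and C: "\<And>i. i \<in> Basis \<Longrightarrow> continuous_on S (partial_dir g i)"
  shows "(g has_derivative (\<lambda>h. \<Sum>i\<in>Basis. (h \<bullet> i) * partial_dir g i x)) (at x)"
proof -
  have der: "((\<lambda>t. g (y + t *\<^sub>R i)) has_real_derivative partial_dir g i (y + t *\<^sub>R i)) (at t)"
    if "i \<in> Basis" "y + t *\<^sub>R i \<in> S" for i y t
  proof -
    have "((\<lambda>s. g (y + t *\<^sub>R i + s *\<^sub>R i)) has_real_derivative partial_dir g i (y + t *\<^sub>R i)) (at 0)"
      using D[OF that] unfolding partial_dir_def by (simp add: DERIV_deriv_iff_real_differentiable)
    thus ?thesis
      using DERIV_shift[of "\<lambda>s. g (y + s *\<^sub>R i)" _ 0 t] by (simp add: algebra_simps)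
  qed
  have key: "\<exists>d>0. \<forall>y. norm (y - x) < d \<longrightarrow>
      norm (g y - g x - (\<Sum>i\<in>Basis. ((y - x) \<bullet> i) * partial_dir g i x)) \<le> e * norm (y - x)"
    if e: "e > 0" for e :: real
  proof -
    define \<epsilon> where "\<epsilon> = e / real DIM('a)"
    have eps: "\<epsilon> > 0" using e by (simp add: \<epsilon>_def)
    have "\<forall>\<^sub>F y in nhds x. y \<in> S \<and> (\<forall>i\<in>Basis. \<bar>partial_dir g i y - partial_dir g i x\<bar> < \<epsilon>)"
    proof (intro eventually_conj eventually_ball_finite ballI)
      show "\<forall>\<^sub>F y in nhds x. y \<in> S" using S by (rule eventually_nhds_in_open)
      fix i :: 'a assume i: "i \<in> Basis"
      have "isCont (partial_dir g i) x"
        using C[OF i] S continuous_on_eq_continuous_at by blast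
      thus "\<forall>\<^sub>F y in nhds x. \<bar>partial_dir g i y - partial_dir g i x\<bar> < \<epsilon>"
        using eps by (auto simp: continuous_at tendsto_at_iff_tendsto_nhds dist_real_def dest: tendstoD)
    qed auto
    then obtain d where d: "d > 0"
      and dS: "\<And>y. norm (y - x) < d \<Longrightarrow> y \<in> S"
      and dP: "\<And>y i. norm (y - x) < d \<Longrightarrow> i \<in> Basis \<Longrightarrow> \<bar>partial_dir g i y - partial_dir g i x\<bar> < \<epsilon>"
      unfolding eventually_nhds_metric by (auto simp: dist_norm)
    have "norm (g y - g x - (\<Sum>i\<in>Basis. ((y - x) \<bullet> i) * partial_dir g i x)) \<le> e * norm (y - x)"
      if y: "norm (y - x) < d" for y
    proof -
      define h where "h = y - x"
      define z where "z = (\<lambda>A. x + (\<Sum>i\<in>A. (h \<bullet> i) *\<^sub>R i))"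
      \<comment> \<open>Keeping some coordinates of \<open>h\<close>, shrinking one and dropping the
        rest does not increase the norm, so every edge of the path stays in the ball around
        \<open>x\<close>.\<close>
      have zn: "norm ((\<Sum>i\<in>A. (h \<bullet> i) *\<^sub>R i) + t *\<^sub>R j) \<le> norm h"
        if A: "A \<subseteq> Basis" "j \<in> Basis" "j \<notin> A" "\<bar>t\<bar> \<le> \<bar>h \<bullet> j\<bar>" for A t j
      proof (rule norm_le_componentwise)
        fix b :: 'a assume b: "b \<in> Basis"
        have fin: "finite A" using A(1) finite_subset[of A Basis] by auto
        have "(\<Sum>i\<in>A. (h \<bullet> i) * (i \<bullet> b)) = (\<Sum>i\<in>A. if i = b then h \<bullet> b else 0)"
          using A b by (intro sum.cong) (auto simp: inner_Basis subset_iff)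
        also have "\<dots> = (if b \<in> A then h \<bullet> b else 0)" using fin by simp
        finally have "((\<Sum>i\<in>A. (h \<bullet> i) *\<^sub>R i) + t *\<^sub>R j) \<bullet> b
            = (if b \<in> A then h \<bullet> b else 0) + t * (if j = b then 1 else 0)"
          using A b by (simp add: inner_add_left inner_sum_left inner_Basis)
        thus "\<bar>((\<Sum>i\<in>A. (h \<bullet> i) *\<^sub>R i) + t *\<^sub>R j) \<bullet> b\<bar> \<le> \<bar>h \<bullet> b\<bar>"
          using A by auto
      qed
      have "finite A \<Longrightarrow> A \<subseteq> Basis \<Longrightarrow>
        \<bar>g (z A) - g x - (\<Sum>i\<in>A. (h \<bullet> i) * partial_dir g i x)\<bar> \<le> real (card A) * (\<epsilon> * norm h)" for A
      proof (induction A rule: finite_induct)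
        case empty
        then show ?case by (simp add: z_def)
      next
        case (insert j A)
        hence jB: "j \<in> Basis" and AB: "A \<subseteq> Basis" and jA: "j \<notin> A" by auto
        have near: "norm (z A + t *\<^sub>R j - x) < d" if "\<bar>t\<bar> \<le> \<bar>h \<bullet> j\<bar>" for t
          using zn[OF AB jB jA that] y unfolding z_def h_def by (simp add: algebra_simps)
        define \<gamma> where "\<gamma> = (\<lambda>t. g (z A + t *\<^sub>R j) - t * partial_dir g j x)"
        have "norm (\<gamma> (h \<bullet> j) - \<gamma> 0) \<le> \<epsilon> * norm (h \<bullet> j - 0)"
        proof (rule field_differentiable_bound[where S = "cball (0::real) \<bar>h \<bullet> j\<bar>"
              and f' = "\<lambda>t. partial_dir g j (z A + t *\<^sub>R j) - partial_dir g j x"])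
          show "convex (cball (0::real) \<bar>h \<bullet> j\<bar>)" by simp
          fix t assume "t \<in> cball (0::real) \<bar>h \<bullet> j\<bar>"
          hence t: "\<bar>t\<bar> \<le> \<bar>h \<bullet> j\<bar>" by simp
          show "(\<gamma> has_field_derivative partial_dir g j (z A + t *\<^sub>R j) - partial_dir g j x)
              (at t within cball (0::real) \<bar>h \<bullet> j\<bar>)"
            unfolding \<gamma>_def
            by (rule has_field_derivative_at_within)
              (auto intro!: derivative_eq_intros der[OF jB dS[OF near[OF t]]])
          show "norm (partial_dir g j (z A + t *\<^sub>R j) - partial_dir g j x) \<le> \<epsilon>"
            using dP[OF near[OF t] jB] by simp
        qed auto
        hence "\<bar>g (z (insert j A)) - g (z A) - (h \<bullet> j) * partial_dir g j x\<bar> \<le> \<epsilon> * \<bar>h \<bullet> j\<bar>"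
          using insert.hyps by (simp add: \<gamma>_def z_def algebra_simps)
        also have "\<dots> \<le> \<epsilon> * norm h"
          using Basis_le_norm[OF jB] eps by (intro mult_left_mono) auto
        finally show ?case using insert.IH[OF AB] insert.hyps
          by (simp add: algebra_simps)
      qed
      from this[of Basis] show ?thesis
        by (simp add: z_def h_def euclidean_representation \<epsilon>_def)
    qed
    thus ?thesis using d by blast
  qed
  show ?thesis
    unfolding has_derivative_within_alt
  proof (intro conjI allI impI)
    show "bounded_linear (\<lambda>h. \<Sum>i\<in>Basis. (h \<bullet> i) * partial_dir g i x)"
      by (intro bounded_linear_sum bounded_linear_mult_const bounded_linear_inner_left)
  qed (use key in auto)
qed

lemma C2_on_has_derivative:
  assumes "C2_on S u" "open S" "x \<in> S"
  shows "(u has_derivative (\<lambda>h. \<Sum>i\<in>Basis. (h \<bullet> i) * partial_dir u i x)) (at x)"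
    and "i \<in> Basis \<Longrightarrow> (partial_dir u i has_derivative
      (\<lambda>h. \<Sum>j\<in>Basis. (h \<bullet> j) * partial_dir (partial_dir u i) j x)) (at x)"
  using assms unfolding C2_on_def
  by (auto intro!: continuous_partials_imp_has_derivative[of S])

lemma has_derivative_line:
  fixes g :: "'a::euclidean_space \<Rightarrow> real"
  assumes "(g has_derivative (\<lambda>h. \<Sum>i\<in>Basis. (h \<bullet> i) * c i)) (at (x + t *\<^sub>R b))"
  shows "((\<lambda>t. g (x + t *\<^sub>R b)) has_real_derivative (\<Sum>i\<in>Basis. (b \<bullet> i) * c i)) (at t)"
proof -
  have "((\<lambda>t. x + t *\<^sub>R b) has_derivative (\<lambda>s. s *\<^sub>R b)) (at t)"
    by (auto intro!: derivative_eq_intros)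
  from has_derivative_compose[OF this assms]
  show ?thesis
    by (rule has_derivative_imp_has_field_derivative)
      (simp add: sum_distrib_left sum_distrib_right mult_ac)
qed

text \<open>A reflection turns coordinate axes into oblique lines, so the second derivative is
  needed along an arbitrary \<open>b\<close>. Both \<open>u\<close> and each
  \<open>partial_dir u i\<close> are Frechet differentiable, which allows differentiating along the
  line twice.\<close>

lemma C2_on_has_jet:
  assumes u: "C2_on S u" "open S" "x \<in> S"
  shows "has_jet (\<lambda>t. u (x + t *\<^sub>R b)) (\<Sum>i\<in>Basis. (b \<bullet> i) * partial_dir u i x)
    (\<Sum>i\<in>Basis. (b \<bullet> i) * (\<Sum>j\<in>Basis. (b \<bullet> j) * partial_dir (partial_dir u i) j x))"
proof -
  have "((\<lambda>t::real. x + t *\<^sub>R b) \<longlongrightarrow> x) (nhds 0)"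
    by (intro tendsto_eq_intros) (auto intro: filterlim_ident)
  hence "\<forall>\<^sub>F t::real in nhds 0. x + t *\<^sub>R b \<in> S"
    using eventually_nhds_in_open[OF u(2,3)] unfolding filterlim_iff by blast
  hence "\<forall>\<^sub>F t in nhds 0. ((\<lambda>t. u (x + t *\<^sub>R b)) has_real_derivative
      (\<Sum>i\<in>Basis. (b \<bullet> i) * partial_dir u i (x + t *\<^sub>R b))) (at t)"
    by eventually_elim (intro has_derivative_line C2_on_has_derivative(1)[OF u(1,2)])
  moreover have "((\<lambda>t. \<Sum>i\<in>Basis. (b \<bullet> i) * partial_dir u i (x + t *\<^sub>R b)) has_real_derivative
      (\<Sum>i\<in>Basis. (b \<bullet> i) * (\<Sum>j\<in>Basis. (b \<bullet> j) * partial_dir (partial_dir u i) j x))) (at 0)"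
    by (intro DERIV_sum DERIV_cmult has_derivative_line)
      (use C2_on_has_derivative(2)[OF u] in simp)
  ultimately show ?thesis unfolding has_jet_def by (intro exI conjI) auto
qed

lemma C2_on_jet_at:
  assumes u: "C2_on S u" "open S" "x \<in> S"
  obtains p q where "jet_at u x p q" "sum q Basis = laplacian u x"
proof -
  have [simp]: "(\<Sum>j\<in>Basis. (i \<bullet> j) * c j) = c i" if "i \<in> Basis" for i :: 'a and c :: "'a \<Rightarrow> real"
  proof -
    have "(\<Sum>j\<in>Basis. (i \<bullet> j) * c j) = (\<Sum>j\<in>Basis. if i = j then c j else 0)"
      using that by (intro sum.cong) (auto simp: inner_Basis)
    thus ?thesis using that by simp
  qed
  have "jet_at u x (\<lambda>i. partial_dir u i x) (\<lambda>i. partial_dir (partial_dir u i) i x)"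
    unfolding jet_at_def
  proof
    fix i :: 'a assume i: "i \<in> Basis"
    show "has_jet (\<lambda>t. u (x + t *\<^sub>R i)) (partial_dir u i x) (partial_dir (partial_dir u i) i x)"
      using C2_on_has_jet[OF u, of i] i by simp
  qed
  thus ?thesis by (rule that) (simp add: laplacian_def)
qed

definition mirror :: "'a::euclidean_space \<Rightarrow> real \<Rightarrow> 'a \<Rightarrow> 'a" where
  "mirror e l x = x - (2 * (x \<bullet> e - l)) *\<^sub>R e"

text \<open>The Laplacian is the trace of the Hessian, and the trace is invariant under the linear
  part \<open>R\<close> of the reflection, which is symmetric and orthogonal. Summing over the basis
  vector \<open>k\<close> first leaves \<open>R i \<bullet> R j\<close>, which is
  \<open>i \<bullet> j\<close>.\<close>

lemma C2_on_mirror_jet_at: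
  assumes u: "C2_on S u" "open S" "mirror e l x \<in> S" and e: "norm e = 1"
  obtains p q where "jet_at (\<lambda>y. u (mirror e l y)) x p q" "sum q Basis = laplacian u (mirror e l x)"
proof -
  define R where "R = (\<lambda>b::'a. b - (2 * (b \<bullet> e)) *\<^sub>R e)"
  have Rm: "mirror e l (x + t *\<^sub>R b) = mirror e l x + t *\<^sub>R R b" for t b
    by (simp add: mirror_def R_def algebra_simps inner_simps)
  have ee: "e \<bullet> e = 1" using e by (simp add: norm_eq_1)
  have sym: "R a \<bullet> b = a \<bullet> R b" for a b
    by (simp add: R_def inner_simps inner_commute)
  have RR: "R a \<bullet> R b = a \<bullet> b" for a b
    using ee by (simp add: R_def inner_simps inner_commute algebra_simps)
  define P where "P = (\<lambda>i j. partial_dir (partial_dir u i) j (mirror e l x))"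
  define p where "p = (\<lambda>k. \<Sum>i\<in>Basis. (R k \<bullet> i) * partial_dir u i (mirror e l x))"
  define q where "q = (\<lambda>k. \<Sum>i\<in>Basis. (R k \<bullet> i) * (\<Sum>j\<in>Basis. (R k \<bullet> j) * P i j))"
  have "jet_at (\<lambda>y. u (mirror e l y)) x p q"
    unfolding jet_at_def Rm p_def q_def P_def using C2_on_has_jet[OF u(1,2,3)] by blast
  moreover have "sum q Basis = laplacian u (mirror e l x)"
  proof -
    have "sum q Basis = (\<Sum>k\<in>Basis. \<Sum>i\<in>Basis. \<Sum>j\<in>Basis. (k \<bullet> R i) * (k \<bullet> R j) * P i j)"
      unfolding q_def by (simp add: sum_distrib_left sym mult_ac)
    also have "\<dots> = (\<Sum>i\<in>Basis. \<Sum>k\<in>Basis. \<Sum>j\<in>Basis. (k \<bullet> R i) * (k \<bullet> R j) * P i j)"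
      by (rule sum.swap)
    also have "\<dots> = (\<Sum>i\<in>Basis. \<Sum>j\<in>Basis. \<Sum>k\<in>Basis. (k \<bullet> R i) * (k \<bullet> R j) * P i j)"
      by (intro sum.cong refl sum.swap)
    also have "\<dots> = (\<Sum>i\<in>Basis. \<Sum>j\<in>Basis. (R i \<bullet> R j) * P i j)"
      by (intro sum.cong refl, subst euclidean_inner) (simp add: sum_distrib_right inner_commute)
    also have "\<dots> = (\<Sum>i\<in>Basis. \<Sum>j\<in>Basis. if i = j then P i j else 0)"
      by (intro sum.cong refl) (simp add: RR inner_Basis)
    also have "\<dots> = laplacian u (mirror e l x)" by (simp add: laplacian_def P_def)
    finally show ?thesis .
  qed
  ultimately show ?thesis by (rule that)
qed

lemma jet_at_radial:
  fixes x :: "'a::euclidean_space"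
  assumes x: "x \<noteq> 0"
    and h: "\<forall>\<^sub>F z in nhds (norm x). (h has_real_derivative h' z) (at z)"
    and h2: "(h' has_real_derivative h'') (at (norm x))"
  obtains q where "jet_at (\<lambda>y. h (norm y)) x (\<lambda>i. h' (norm x) * ((x \<bullet> i) / norm x)) q"
    "sum q Basis = h'' + (real DIM('a) - 1) / norm x * h' (norm x)"
proof -
  have "jet_at (\<lambda>y. h (norm y)) x (\<lambda>i. h' (norm x) * ((x \<bullet> i) / norm x))
     (\<lambda>i. h' (norm x) * (1 / norm x - (x \<bullet> i)\<^sup>2 / norm x ^ 3) + h'' * ((x \<bullet> i) / norm x)\<^sup>2)"
    by (rule jet_at_compose[OF jet_at_norm[OF x] h h2])
  moreover have "(\<Sum>i\<in>Basis. h' (norm x) * (1 / norm x - (x \<bullet> i)\<^sup>2 / norm x ^ 3) + h'' * ((x \<bullet> i) / norm x)\<^sup>2)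
     = h' (norm x) * ((real DIM('a) - 1) / norm x) + h'' * 1"
    unfolding sum.distrib sum_distrib_left[symmetric] sum_norm_jet[OF x] ..
  ultimately show ?thesis by (intro that) auto
qed


section \<open>Reflections and maximum principles\<close>

lemma locally_lipschitz_compact:
  assumes "locally_lipschitz f"
  obtains L where "L \<ge> 0" "\<And>a b. a \<in> {-M..M} \<Longrightarrow> b \<in> {-M..M} \<Longrightarrow> \<bar>f a - f b\<bar> \<le> L * \<bar>a - b\<bar>"
proof -
  \<comment> \<open>The time set \<open>{0}\<close> is a dummy: \<open>f\<close> is read as a
    time-independent field, and compactness turns the local Lipschitz property into a uniform
    one.\<close>
  have "local_lipschitz {0::real} {-M..M} (\<lambda>_. f)"
    unfolding local_lipschitz_def
  proof (intro ballI)
    fix x t :: real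
    obtain e L where eL: "e > 0" "L-lipschitz_on (cball x e) f"
      using assms unfolding locally_lipschitz_def by blast
    hence "L-lipschitz_on (cball x e \<inter> {-M..M}) f"
      by (auto intro: lipschitz_on_subset)
    thus "\<exists>u>0. \<exists>L. \<forall>t\<in>cball t u \<inter> {0}. L-lipschitz_on (cball x u \<inter> {-M..M}) f"
      using eL(1) by blast
  qed
  from local_lipschitz_compact_implies_lipschitz[OF this]
  obtain L where L: "L-lipschitz_on {-M..M} f" by auto
  show ?thesis
    using lipschitz_onD[OF L] lipschitz_on_nonneg[OF L] by (intro that[of L]) (auto simp: dist_real_def)
qed

section \<open>Reflections in hyperplanes\<close>

lemma mirror_mirror [simp]: "norm e = 1 \<Longrightarrow> mirror e l (mirror e l x) = x"
  by (simp add: mirror_def inner_diff_left norm_eq_1) (simp add: algebra_simps flip: scaleR_add_left)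

lemma mirror_fix [simp]: "x \<bullet> e = l \<Longrightarrow> mirror e l x = x"
  by (simp add: mirror_def)

lemma norm_mirror_sq: "norm e = 1 \<Longrightarrow> (norm (mirror e l x))\<^sup>2 = (norm x)\<^sup>2 - 4 * l * (x \<bullet> e - l)"
proof -
  assume "norm e = 1"
  hence ee: "e \<bullet> e = 1" by (simp add: norm_eq_1)
  show ?thesis
    unfolding power2_norm_eq_inner mirror_def
    using ee by (simp add: inner_diff_left inner_diff_right inner_commute[of e x])
      (simp add: algebra_simps)
qed

lemma dist_mirror: "norm e = 1 \<Longrightarrow> norm (mirror e l x - mirror e l y) = norm (x - y)"
proof -
  assume e: "norm e = 1"
  have m: "mirror e l x - mirror e l y = mirror e 0 (x - y)"
    by (simp add: mirror_def inner_diff_left algebra_simps)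
  have "(norm (mirror e 0 (x - y)))\<^sup>2 = (norm (x - y))\<^sup>2" using norm_mirror_sq[OF e, of 0] by simp
  thus ?thesis unfolding m by (simp add: power2_eq_iff_nonneg)
qed

lemma norm_mirror_le:
  assumes "norm e = 1" "l > 0" "x \<bullet> e \<ge> l"
  shows "norm (mirror e l x) \<le> norm x"
proof -
  have "(norm (mirror e l x))\<^sup>2 \<le> (norm x)\<^sup>2"
    using norm_mirror_sq[OF assms(1), of l x] assms(2,3) by simp
  thus ?thesis by (rule power2_le_imp_le) simp
qed

lemma norm_mirror_less:
  assumes "norm e = 1" "l > 0" "x \<bullet> e > l"
  shows "norm (mirror e l x) < norm x"
proof -
  have "(norm (mirror e l x))\<^sup>2 < (norm x)\<^sup>2"
    using norm_mirror_sq[OF assms(1), of l x] assms(2,3) by simp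
  thus ?thesis by (rule power_less_imp_less_base) simp
qed

text \<open>The squared norms differ by \<open>4 * l * (x \<bullet> e - l)\<close> and the norms add
  up to at most 2. This converts radial estimates into estimates for the distance to the
  plane.\<close>

lemma norm_diff_mirror_ge:
  assumes "norm e = 1" "l > 0" "x \<bullet> e \<ge> l" "norm x \<le> 1"
  shows "2 * l * (x \<bullet> e - l) \<le> norm x - norm (mirror e l x)"
proof -
  let ?m = "norm (mirror e l x)"
  have le: "?m \<le> norm x" by (rule norm_mirror_le[OF assms(1-3)])
  have "4 * l * (x \<bullet> e - l) = (norm x - ?m) * (norm x + ?m)"
    using norm_mirror_sq[OF assms(1), of l x] by (simp add: algebra_simps power2_eq_square)
  also have "\<dots> \<le> (norm x - ?m) * 2" using le assms(4) by (intro mult_left_mono) auto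
  finally show ?thesis by simp
qed

lemma continuous_on_mirror [continuous_intros]:
  "continuous_on S g \<Longrightarrow> continuous_on S h \<Longrightarrow> continuous_on S (\<lambda>x. mirror e (g x) (h x))"
  unfolding mirror_def by (intro continuous_intros)

lemma tendsto_mirror:
  "(g \<longlongrightarrow> l) F \<Longrightarrow> (h \<longlongrightarrow> x) F \<Longrightarrow> ((\<lambda>n. mirror e (g n) (h n)) \<longlongrightarrow> mirror e l x) F"
  unfolding mirror_def by (intro tendsto_intros)

section \<open>Hopf's lemma and the strong maximum principle\<close>

text \<open>Hopf's boundary lemma, with an exponential barrier on the shell between the radii
  \<open>R/2\<close> and \<open>R\<close>. The conclusion is linear growth along the inner normal
  instead of a sign of a derivative, as \<open>w\<close> is only assumed continuous on the closed
  ball.\<close>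

lemma hopf_boundary_growth:
  fixes w :: "'a::euclidean_space \<Rightarrow> real"
  assumes R: "R > 0" and L: "L \<ge> 0" and cont: "continuous_on (cball y R) w"
    and pos: "\<And>x. x \<in> ball y R \<Longrightarrow> w x > 0"
    and jet: "\<And>x. x \<in> ball y R \<Longrightarrow> \<exists>p q. jet_at w x p q \<and> sum q Basis \<le> L * w x"
    and x1: "norm (x1 - y) = R"
  shows "\<exists>c>0. \<forall>t\<in>{0..1/2}. w (x1 + t *\<^sub>R (y - x1)) \<ge> c * t"
proof -
  define N where "N = real DIM('a)"
  have N: "N \<ge> 1" using DIM_ge_Suc0[where 'a='a] unfolding N_def by linarith
  \<comment> \<open>The Laplacian of the barrier is its exponential times
    \<open>\<alpha> * (4 * \<alpha> * (norm (x - y))\<^sup>2 - 2 * N)\<close>; this size of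
    \<open>\<alpha>\<close> makes the second factor exceed \<open>L\<close> as soon as
    \<open>norm (x - y) \<ge> R/2\<close>.\<close>
  define \<alpha> where "\<alpha> = (2 * N + L + 1) / R\<^sup>2 + 1"
  have \<alpha>: "\<alpha> \<ge> 1" using N L R by (simp add: \<alpha>_def)
  have \<alpha>R: "\<alpha> * R\<^sup>2 \<ge> 2 * N + L + 1" using R by (simp add: \<alpha>_def field_simps)
  define g where "g = (\<lambda>x. exp (- \<alpha> * (norm (x - y))\<^sup>2) - exp (- \<alpha> * R\<^sup>2))"
  have gjet: "\<exists>p q. jet_at g x p q \<and> sum q Basis > L * g x" if "R/2 \<le> norm (x - y)" for x
  proof -
    let ?E = "exp (- \<alpha> * (norm (x - y))\<^sup>2)"
    have "jet_at (\<lambda>z. (\<lambda>v. exp (- \<alpha> * v) - exp (- \<alpha> * R\<^sup>2)) ((norm (z - y))\<^sup>2)) x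
       (\<lambda>i. - \<alpha> * ?E * (2 * ((x - y) \<bullet> i)))
       (\<lambda>i. - \<alpha> * ?E * 2 + (\<alpha> * \<alpha> * ?E) * (2 * ((x - y) \<bullet> i))\<^sup>2)"
      by (rule jet_at_compose[OF jet_at_norm_sq]) (auto intro!: derivative_eq_intros always_eventually)
    moreover have "(\<Sum>i\<in>Basis. - \<alpha> * ?E * 2 + (\<alpha> * \<alpha> * ?E) * (2 * ((x - y) \<bullet> i))\<^sup>2)
        = ?E * (\<alpha> * (4 * (\<alpha> * (norm (x - y))\<^sup>2) - 2 * N))"
    proof -
      have "(\<Sum>i\<in>Basis. - \<alpha> * ?E * 2 + (\<alpha> * \<alpha> * ?E) * (2 * ((x - y) \<bullet> i))\<^sup>2)
        = (\<Sum>i\<in>(Basis::'a set). - \<alpha> * ?E * 2) + (4 * \<alpha> * \<alpha> * ?E) * (\<Sum>i\<in>Basis. ((x - y) \<bullet> i)\<^sup>2)"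
        unfolding sum.distrib sum_distrib_left power_mult_distrib
        by (intro arg_cong2[where f="(+)"] sum.cong refl) simp
      also have "\<dots> = ?E * (\<alpha> * (4 * (\<alpha> * (norm (x - y))\<^sup>2) - 2 * N))"
        unfolding sum_Basis_inner_sq N_def by (simp add: right_diff_distrib)
      finally show ?thesis .
    qed
    moreover have "L * g x < ?E * (\<alpha> * (4 * (\<alpha> * (norm (x - y))\<^sup>2) - 2 * N))"
    proof -
      have "(R/2)\<^sup>2 \<le> (norm (x - y))\<^sup>2" using that R by (intro power_mono) auto
      hence "\<alpha> * (R\<^sup>2/4) \<le> \<alpha> * (norm (x - y))\<^sup>2"
        using \<alpha> by (intro mult_left_mono) (auto simp: power_divide)
      hence "L + 1 \<le> 4 * (\<alpha> * (norm (x - y))\<^sup>2) - 2 * N" using \<alpha>R by simp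
      hence "1 * (L + 1) \<le> \<alpha> * (4 * (\<alpha> * (norm (x - y))\<^sup>2) - 2 * N)"
        using \<alpha> L by (intro mult_mono) auto
      hence "?E * L < ?E * (\<alpha> * (4 * (\<alpha> * (norm (x - y))\<^sup>2) - 2 * N))"
        by (intro mult_strict_left_mono) auto
      moreover have "L * g x \<le> ?E * L" using L by (simp add: g_def algebra_simps)
      ultimately show ?thesis by linarith
    qed
    ultimately show ?thesis unfolding g_def by (intro exI conjI) auto
  qed
  define A where "A = cball y R - ball y (R/2)"
  have Ac: "compact A" unfolding A_def by (intro compact_diff) auto
  have cs: "continuous_on (sphere y (R/2)) w"
    by (rule continuous_on_subset[OF cont]) (use R in auto)
  have xh: "y + (1/2) *\<^sub>R (x1 - y) \<in> sphere y (R/2)" using x1 by (simp add: dist_norm)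
  \<comment> \<open>\<open>g\<close> vanishes on the outer sphere and is at most 1 on the inner one,
    so \<open>m * g\<close> lies below \<open>w\<close> on both boundary spheres of the
    shell.\<close>
  obtain m where m: "m > 0" "\<And>x. x \<in> sphere y (R/2) \<Longrightarrow> w x \<ge> m"
  proof -
    obtain a where "a \<in> sphere y (R/2)" "\<And>x. x \<in> sphere y (R/2) \<Longrightarrow> w a \<le> w x"
      using continuous_attains_inf[OF compact_sphere _ cs] xh by blast
    moreover from this have "w a > 0" using R by (intro pos) auto
    ultimately show ?thesis using that[of "w a"] by blast
  qed
  have nonneg: "w x \<ge> 0" if "x \<in> cball y R" for x
  proof -
    have "x \<in> closure (ball y R)" using that R by simp
    thus ?thesis
      using continuous_ge_on_closure[of "ball y R" w x 0] cont pos R by (auto simp: less_imp_le)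
  qed
  have main: "w x \<ge> m * g x" if xA: "x \<in> A" for x
  proof (rule ccontr)
    assume asm: "\<not> ?thesis"
    have "continuous_on A (\<lambda>x. w x - m * g x)"
      unfolding g_def by (intro continuous_intros continuous_on_subset[OF cont]) (auto simp: A_def)
    then obtain a where a: "a \<in> A" "\<And>z. z \<in> A \<Longrightarrow> w a - m * g a \<le> w z - m * g z"
      using continuous_attains_inf[OF Ac] xA by blast
    have neg: "w a - m * g a < 0" using a(2)[OF xA] asm by linarith
    have "norm (a - y) \<noteq> R"
    proof
      assume "norm (a - y) = R"
      hence "g a = 0" by (simp add: g_def)
      thus False using neg nonneg[of a] a(1) by (auto simp: A_def)
    qed
    moreover have "norm (a - y) \<noteq> R/2"
    proof
      assume *: "norm (a - y) = R/2"
      have "exp (- \<alpha> * (norm (a - y))\<^sup>2) \<le> 1" using \<alpha> by simp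
      hence "g a \<le> 1" unfolding g_def by (smt (verit) exp_gt_zero)
      hence "m * g a \<le> m" using m(1) by (simp add: mult_left_le)
      moreover have "w a \<ge> m" using * by (intro m(2)) (simp add: dist_norm norm_minus_commute)
      ultimately show False using neg by linarith
    qed
    ultimately have ab: "R/2 < norm (a - y)" "norm (a - y) < R"
      using a(1) by (auto simp: A_def dist_norm norm_minus_commute)
    hence "a \<in> ball y R - cball y (R/2)" by (simp add: dist_norm norm_minus_commute)
    hence "\<forall>\<^sub>F z in nhds a. z \<in> ball y R - cball y (R/2)"
      by (intro eventually_nhds_in_open) auto
    hence ev: "\<forall>\<^sub>F z in nhds a. w a - m * g a \<le> w z - m * g z"
      by eventually_elim (auto intro!: a(2) simp: A_def)
    obtain p q where pq: "jet_at w a p q" "sum q Basis \<le> L * w a"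
      using jet[of a] ab by (auto simp: dist_norm norm_minus_commute)
    obtain p' q' where pq': "jet_at g a p' q'" "sum q' Basis > L * g a"
      using gjet[of a] ab by auto
    have "sum (\<lambda>i. q i - m * q' i) Basis \<ge> 0"
      by (rule jet_at_local_min(2)[OF jet_at_diff[OF pq(1) jet_at_cmult[OF pq'(1)]] ev])
    hence "sum q Basis \<ge> m * sum q' Basis" by (simp add: sum_subtractf sum_distrib_left)
    hence "L * w a \<ge> m * (L * g a)"
      using pq(2) mult_left_mono[OF less_imp_le[OF pq'(2)], of m] m(1) by linarith
    moreover have "m * sum q' Basis > m * (L * g a)" using pq'(2) m(1) by simp
    moreover have "L * w a \<le> L * (m * g a)" using neg L by (intro mult_left_mono) auto
    ultimately show False using \<open>sum q Basis \<ge> _\<close> pq(2) by (simp add: mult_ac)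
  qed
  define c where "c = m * (exp (- \<alpha> * R\<^sup>2) * (\<alpha> * R\<^sup>2))"
  have "c > 0" using m(1) \<alpha> R by (simp add: c_def)
  moreover have "w (x1 + t *\<^sub>R (y - x1)) \<ge> c * t" if t: "t \<in> {0..1/2}" for t
  proof -
    let ?x = "x1 + t *\<^sub>R (y - x1)"
    have "?x - y = (1 - t) *\<^sub>R (x1 - y)" by (simp add: algebra_simps)
    hence n: "norm (?x - y) = (1 - t) * R" using x1 t by simp
    have "(1/2) * R \<le> (1 - t) * R" "(1 - t) * R \<le> 1 * R" using t R by (intro mult_right_mono; simp)+
    hence "?x \<in> A" using n unfolding A_def by (simp add: dist_norm norm_minus_commute[of y ?x])
    hence w1: "w ?x \<ge> m * g ?x" by (rule main)
    have "- \<alpha> * ((1 - t) * R)\<^sup>2 = - \<alpha> * R\<^sup>2 + \<alpha> * R\<^sup>2 * (2 * t - t\<^sup>2)"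
      by (simp add: power2_eq_square algebra_simps)
    hence "g ?x = exp (- \<alpha> * R\<^sup>2) * (exp (\<alpha> * R\<^sup>2 * (2 * t - t\<^sup>2)) - 1)"
      unfolding g_def n by (simp only: exp_add right_diff_distrib mult_1_right)
    also have "\<dots> \<ge> exp (- \<alpha> * R\<^sup>2) * (\<alpha> * R\<^sup>2 * t)"
    proof (rule mult_left_mono)
      have "t * t \<le> t * 1" using t by (intro mult_left_mono) auto
      hence "\<alpha> * R\<^sup>2 * t \<le> \<alpha> * R\<^sup>2 * (2 * t - t\<^sup>2)"
        using \<alpha> by (intro mult_left_mono) (auto simp: power2_eq_square)
      thus "\<alpha> * R\<^sup>2 * t \<le> exp (\<alpha> * R\<^sup>2 * (2 * t - t\<^sup>2)) - 1"
        using exp_ge_add_one_self[of "\<alpha> * R\<^sup>2 * (2 * t - t\<^sup>2)"] by linarith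
    qed simp
    finally have "m * g ?x \<ge> c * t"
      using m(1) unfolding c_def by (simp add: mult.assoc)
    thus ?thesis using w1 by linarith
  qed
  ultimately show ?thesis by blast
qed

text \<open>If the zero set were not open, a ball free of zeros would touch it at a point
  \<open>x1\<close> of \<open>S\<close>. Hopf's lemma gives linear growth of \<open>w\<close> from
  \<open>x1\<close> into that ball, whereas the differential vanishes at an interior minimum.
  \<open>L\<close> may depend on the compact set, since it will come from a local Lipschitz
  bound.\<close>

lemma strong_maximum_principle:
  fixes w :: "'a::euclidean_space \<Rightarrow> real"
  assumes S: "open S" "connected S"
    and diff: "\<And>x. x \<in> S \<Longrightarrow> w differentiable (at x)"
    and nonneg: "\<And>x. x \<in> S \<Longrightarrow> w x \<ge> 0"
    and jet: "\<And>K. compact K \<Longrightarrow> K \<subseteq> S \<Longrightarrow>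
      \<exists>L\<ge>0. \<forall>x\<in>K. \<exists>p q. jet_at w x p q \<and> sum q Basis \<le> L * w x"
    and a: "a \<in> S" "w a > 0" and x: "x \<in> S"
  shows "w x > 0"
proof -
  have cont: "continuous_on S w"
    using diff by (intro continuous_at_imp_continuous_on ballI differentiable_imp_continuous_within)
  define Z where "Z = {x\<in>S. w x = 0}"
  define P where "P = {x\<in>S. w x > 0}"
  have "open P"
  proof -
    have "P = S \<inter> w -` {0<..}" by (auto simp: P_def)
    thus ?thesis using continuous_open_preimage[OF cont S(1)] by simp
  qed
  moreover have "open Z"
    unfolding open_contains_ball
  proof
    fix z assume z: "z \<in> Z"
    then obtain d where d: "d > 0" "cball z (2 * d) \<subseteq> S"
    proof -
      obtain d where "d > 0" "cball z d \<subseteq> S"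
        using S(1) z open_contains_cball[of S] unfolding Z_def by blast
      thus ?thesis using that[of "d/2"] by simp
    qed
    have "ball z d \<subseteq> Z"
    proof (rule ccontr)
      assume "\<not> ball z d \<subseteq> Z"
      then obtain y where y: "y \<in> ball z d" "y \<notin> Z" by blast
      have "closedin (top_of_set S) Z"
        unfolding Z_def by (rule continuous_closedin_preimage_constant[OF cont])
      then obtain C where C: "closed C" "Z = S \<inter> C" unfolding closedin_closed by blast
      \<comment> \<open>The compact ball secures a nearest zero \<open>x1\<close>; as
        \<open>z\<close> itself lies in \<open>K\<close>, the touching ball has radius below
        \<open>d\<close> and stays inside \<open>S\<close>.\<close>
      define K where "K = C \<inter> cball z (2*d)"
      have KZ: "K \<subseteq> Z" using C d by (auto simp: K_def)
      have "compact K" "z \<in> K" using C z d(1) by (auto simp: K_def intro!: closed_Int_compact)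
      then obtain x1 where x1: "x1 \<in> K" "\<And>v. v \<in> K \<Longrightarrow> dist y x1 \<le> dist y v"
        using distance_attains_inf[of K y] compact_imp_closed by blast
      define R where "R = dist y x1"
      have R: "R > 0" using x1(1) KZ y(2) by (auto simp: R_def)
      have Rd: "R < d" using x1(2)[OF \<open>z \<in> K\<close>] y(1) by (simp add: R_def dist_commute)
      have sub: "cball y R \<subseteq> cball z (2*d)"
      proof
        fix v assume "v \<in> cball y R"
        hence "dist z v \<le> dist z y + R" using dist_triangle[of z v y] by simp
        thus "v \<in> cball z (2*d)" using Rd y(1) by simp
      qed
      have pos: "w v > 0" if v: "v \<in> ball y R" for v
      proof -
        have vS: "v \<in> cball z (2*d)" "v \<in> S" using v sub d(2) by (auto simp: less_imp_le subset_iff)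
        have "v \<notin> K" using x1(2)[of v] v by (auto simp: R_def)
        hence "v \<notin> Z" using vS C by (auto simp: K_def)
        thus ?thesis using vS nonneg[of v] by (auto simp: Z_def)
      qed
      have cS: "cball y R \<subseteq> S" using sub d(2) by blast
      obtain L where L: "L \<ge> 0" "\<forall>x\<in>cball y R. \<exists>p q. jet_at w x p q \<and> sum q Basis \<le> L * w x"
        using jet[OF compact_cball cS] by blast
      have "\<exists>c>0. \<forall>t\<in>{0..1/2}. w (x1 + t *\<^sub>R (y - x1)) \<ge> c * t"
      proof (rule hopf_boundary_growth[OF R L(1) continuous_on_subset[OF cont cS] pos])
        show "norm (x1 - y) = R" by (simp add: R_def dist_norm norm_minus_commute)
        show "\<exists>p q. jet_at w x p q \<and> sum q Basis \<le> L * w x" if "x \<in> ball y R" for x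
          using L(2) that by (meson ball_subset_cball subsetD)
      qed
      then obtain c where c: "c > 0" "\<forall>t\<in>{0..1/2}. w (x1 + t *\<^sub>R (y - x1)) \<ge> c * t" by blast
      have x1S: "x1 \<in> S" "w x1 = 0" using x1(1) KZ by (auto simp: Z_def)
      obtain D where D: "(w has_derivative D) (at x1)"
        using diff[OF x1S(1)] unfolding differentiable_def by blast
      have "D = (\<lambda>v. 0)"
      proof (rule differential_zero_maxmin[OF x1S(1) S(1) D])
        show "(\<forall>y\<in>S. w y \<le> w x1) \<or> (\<forall>y\<in>S. w x1 \<le> w y)" using nonneg x1S by auto
      qed
      moreover have "((\<lambda>t. x1 + t *\<^sub>R (y - x1)) has_derivative (\<lambda>s. s *\<^sub>R (y - x1))) (at 0)"
        by (auto intro!: derivative_eq_intros)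
      ultimately have "((\<lambda>t. w (x1 + t *\<^sub>R (y - x1))) has_derivative (\<lambda>s. 0)) (at 0)"
        using has_derivative_compose[of "\<lambda>t. x1 + t *\<^sub>R (y - x1)" "\<lambda>s. s *\<^sub>R (y - x1)" 0 UNIV w D] D by simp
      hence "((\<lambda>t. w (x1 + t *\<^sub>R (y - x1)) - c * t) has_real_derivative - c) (at 0)"
        by (auto intro!: derivative_eq_intros simp: has_field_derivative_def mult_commute_abs)
      from DERIV_neg_dec_right[OF this]
      obtain e where e: "e > 0" "\<And>h. h > 0 \<Longrightarrow> h < e \<Longrightarrow>
          w (x1 + h *\<^sub>R (y - x1)) - c * h < 0"
        using c(1) x1S by auto
      define h where "h = min e 1 / 2"
      have h: "h > 0" "h < e" "h \<in> {0..1/2}" using e(1) by (auto simp: h_def)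
      have "c * h \<le> w (x1 + h *\<^sub>R (y - x1))" using c(2) h(3) by blast
      thus False using e(2)[OF h(1,2)] by linarith
    qed
    thus "\<exists>e>0. ball z e \<subseteq> Z" using d(1) by blast
  qed
  moreover have "S \<subseteq> P \<union> Z" "P \<inter> Z \<inter> S = {}" using nonneg by (fastforce simp: P_def Z_def)+
  moreover have "P \<inter> S \<noteq> {}" using a by (auto simp: P_def)
  ultimately have "Z \<inter> S = {}" using connectedD[OF S(2)] by blast
  thus ?thesis using x nonneg[OF x] by (auto simp: Z_def)
qed

section \<open>Moving planes\<close>

locale large_solution =
  fixes f :: "real \<Rightarrow> real" and u :: "'a::euclidean_space \<Rightarrow> real"
  assumes C2: "C2_on (ball 0 1) u"
    and eq: "x \<in> ball 0 1 \<Longrightarrow> laplacian u x = f (u x)"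
    and large: "\<exists>r<1. \<forall>x\<in>ball 0 1. r < norm x \<longrightarrow> M < u x"
begin

lemma u_isCont: "x \<in> ball 0 1 \<Longrightarrow> isCont u x"
  using C2_on_has_derivative(1)[OF C2] has_derivative_continuous by fastforce

lemma u_cont: "S \<subseteq> ball 0 1 \<Longrightarrow> continuous_on S u"
  using u_isCont by (intro continuous_at_imp_continuous_on) blast

lemma u_jet:
  assumes "x \<in> ball 0 1"
  obtains p q where "jet_at u x p q" "sum q Basis = f (u x)"
  using C2_on_jet_at[OF C2 _ assms] eq[OF assms] by auto

end

text \<open>The analytic inputs of the moving plane method, kept apart from its geometry. A reversal
  is a pair with \<open>norm y \<le> norm x\<close> but \<open>u x < u y\<close>. By
  \<open>small_defect\<close>, reversals at high values are small, so that positive maxima of the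
  difference are attained. \<open>narrow\<close> weighs the zero-order coefficient against the
  squared distance to the plane; the radius \<open>4 * DIM('a) * s\<close> is that of the ball
  carrying the barrier in \<open>no_max_near_plane\<close>.\<close>

locale moving_plane = large_solution f u for f :: "real \<Rightarrow> real" and u :: "'a::euclidean_space \<Rightarrow> real" +
  assumes lip: "locally_lipschitz f"
    and small_defect: "\<epsilon> > 0 \<Longrightarrow> \<exists>t. \<forall>x\<in>ball 0 1. \<forall>y\<in>ball 0 1.
          norm y \<le> norm x \<and> t \<le> u x \<and> u x < u y \<longrightarrow> u y - u x < \<epsilon>"
    and narrow: "c > 0 \<Longrightarrow> \<epsilon> > 0 \<Longrightarrow> \<exists>t. \<forall>x0\<in>ball 0 1. \<forall>y0\<in>ball 0 1. \<forall>s>0.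
          c * s \<le> norm x0 - norm y0 \<and> t \<le> u x0 \<and> u x0 < u y0 \<longrightarrow>
          (\<exists>Q\<ge>0. Q * s\<^sup>2 \<le> \<epsilon> \<and> (\<forall>x\<in>ball 0 1. \<forall>y\<in>ball 0 1.
             norm (x - x0) \<le> 4 * real DIM('a) * s \<and> norm (y - y0) \<le> 4 * real DIM('a) * s \<and> u x < u y \<longrightarrow>
             - Q * (u y - u x) \<le> f (u y) - f (u x)))"
begin

definition cap :: "'a \<Rightarrow> real \<Rightarrow> 'a set" where
  "cap e l = {x \<in> ball 0 1. l < x \<bullet> e}"

text \<open>On a cap with \<open>l > 0\<close> the mirror image is the point closer to the origin,
  so the goal is \<open>W \<le> 0\<close>, and positive values are reversals.\<close>

definition W :: "'a \<Rightarrow> real \<Rightarrow> 'a \<Rightarrow> real" where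
  "W e l x = u (mirror e l x) - u x"

lemma u_diff: "x \<in> ball 0 1 \<Longrightarrow> u differentiable (at x)"
  using C2_on_has_derivative(1)[OF C2] unfolding differentiable_def by auto

lemma u_tendsto: "(g \<longlongrightarrow> x) F \<Longrightarrow> x \<in> ball 0 1 \<Longrightarrow> ((\<lambda>n. u (g n)) \<longlongrightarrow> u x) F"
  using u_isCont isCont_tendsto_compose by blast

lemma open_cap: "open (cap e l)"
proof -
  have "cap e l = ball 0 1 \<inter> {x. l < e \<bullet> x}" by (auto simp: cap_def inner_commute)
  thus ?thesis by (auto intro: open_halfspace_gt)
qed

lemma connected_cap: "connected (cap e l)"
proof -
  have "cap e l = ball 0 1 \<inter> {x. e \<bullet> x > l}" by (auto simp: cap_def inner_commute)
  thus ?thesis by (auto intro!: convex_connected convex_Int convex_halfspace_gt)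
qed

lemma mirror_in_ball:
  assumes "norm e = 1" "l > 0" "x \<in> ball 0 1" "l \<le> x \<bullet> e"
  shows "mirror e l x \<in> ball 0 1"
  using norm_mirror_le[OF assms(1,2,4)] assms(3) by simp

lemma mirror_in_ball':
  assumes "norm e = 1" "l > 0" "norm x \<le> 1" "l < x \<bullet> e"
  shows "mirror e l x \<in> ball 0 1"
  using norm_mirror_less[OF assms(1,2,4)] assms(3) by simp

lemma W_tendsto:
  assumes "(g \<longlongrightarrow> l) F" "(h \<longlongrightarrow> x) F" "x \<in> ball 0 1" "mirror e l x \<in> ball 0 1"
  shows "((\<lambda>n. W e (g n) (h n)) \<longlongrightarrow> W e l x) F"
  unfolding W_def using assms by (intro tendsto_intros u_tendsto tendsto_mirror)

lemma W_jet:
  assumes e: "norm e = 1" and x: "x \<in> ball 0 1" "mirror e l x \<in> ball 0 1"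
  obtains p q where "jet_at (W e l) x p q" "sum q Basis = f (u (mirror e l x)) - f (u x)"
proof -
  obtain p q where 1: "jet_at u x p q" "sum q Basis = f (u x)" using u_jet[OF x(1)] by blast
  obtain p' q' where 2: "jet_at (\<lambda>y. u (mirror e l y)) x p' q'" "sum q' Basis = laplacian u (mirror e l x)"
    using C2_on_mirror_jet_at[OF C2 _ x(2) e] by auto
  have "jet_at (W e l) x (\<lambda>i. p' i - p i) (\<lambda>i. q' i - q i)"
    unfolding W_def by (rule jet_at_diff[OF 2(1) 1(1)])
  thus ?thesis by (rule that) (use 1(2) 2(2) eq x in \<open>simp add: sum_subtractf\<close>)
qed

lemma u_at_boundary:
  assumes "x \<longlonglongrightarrow> a" "norm a = 1" "\<And>n::nat. x n \<in> ball 0 1"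
  shows "\<forall>\<^sub>F n in sequentially. M < u (x n)"
proof -
  obtain r where r: "r < 1" "\<forall>x\<in>ball 0 1. r < norm x \<longrightarrow> M < u x" using large by blast
  have "(\<lambda>n. norm (x n)) \<longlonglongrightarrow> 1" using tendsto_norm[OF assms(1)] assms(2) by simp
  hence "\<forall>\<^sub>F n in sequentially. r < norm (x n)" using r(1) by (rule order_tendstoD)
  thus ?thesis by eventually_elim (use r(2) assms(3) in auto)
qed

section \<open>Attained maxima and the barrier at the plane\<close>

text \<open>No sequence with \<open>W \<ge> \<epsilon>\<close> leaves the cap in the limit: at a
  point of the sphere off the plane \<open>u\<close> blows up while the mirrored value stays
  bounded, at a corner \<open>small_defect\<close> applies, and at an interior point of the plane
  \<open>W\<close> vanishes.\<close>

lemma compact_superlevel: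
  assumes e: "norm e = 1" and l: "l > 0" and eps: "\<epsilon> > 0"
  shows "compact {x \<in> cap e l. \<epsilon> \<le> W e l x}" (is "compact ?K")
proof -
  have "?K \<subseteq> ball 0 1" by (auto simp: cap_def)
  hence "bounded ?K" using bounded_subset bounded_ball by blast
  moreover have "closed ?K"
    unfolding closed_sequential_limits
  proof (intro allI impI, elim conjE)
    fix x a assume xK: "\<forall>n. x n \<in> ?K" and lim: "x \<longlonglongrightarrow> a"
    have xb: "x n \<in> ball 0 1" "l < x n \<bullet> e" "\<epsilon> \<le> W e l (x n)" for n
      using xK by (auto simp: cap_def)
    have "norm a \<le> 1"
      using tendsto_norm[OF lim] by (rule LIMSEQ_le_const2) (use xb(1) in \<open>auto intro!: less_imp_le\<close>)
    have ae: "l \<le> a \<bullet> e"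
      by (rule LIMSEQ_le_const[OF tendsto_inner[OF lim tendsto_const]]) (use xb(2) in \<open>auto intro!: less_imp_le\<close>)
    have "norm a \<noteq> 1"
    proof
      assume a1: "norm a = 1"
      show False
      proof (cases "a \<bullet> e = l")
        case True
        obtain t where t: "\<forall>x\<in>ball 0 1. \<forall>y\<in>ball 0 1.
          norm y \<le> norm x \<and> t \<le> u x \<and> u x < u y \<longrightarrow> u y - u x < \<epsilon>"
          using small_defect[OF eps] by blast
        have "\<forall>\<^sub>F n in sequentially. t < u (x n)" by (rule u_at_boundary[OF lim a1 xb(1)])
        then obtain n where n: "t < u (x n)" using eventually_happens' sequentially_bot by blast
        have "norm (mirror e l (x n)) \<le> norm (x n)"
          using norm_mirror_le[OF e l] xb(2)[of n] by simp
        moreover have "mirror e l (x n) \<in> ball 0 1"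
          using mirror_in_ball[OF e l xb(1)] xb(2)[of n] by simp
        ultimately show False using t xb(1,3)[of n] n eps unfolding W_def by force
      next
        case False
        hence "mirror e l a \<in> ball 0 1" using mirror_in_ball'[OF e l] a1 ae by simp
        hence "(\<lambda>n. u (mirror e l (x n))) \<longlonglongrightarrow> u (mirror e l a)"
          by (intro u_tendsto tendsto_mirror tendsto_const lim)
        hence "\<forall>\<^sub>F n in sequentially. u (mirror e l (x n)) < u (mirror e l a) + 1"
          by (rule order_tendstoD) simp
        moreover have "\<forall>\<^sub>F n in sequentially. u (mirror e l a) + 1 < u (x n)"
          by (rule u_at_boundary[OF lim a1 xb(1)])
        ultimately have "\<forall>\<^sub>F n in sequentially. False"
        proof eventually_elim
          case (elim n)
          thus ?case using xb(3)[of n] eps by (simp add: W_def)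
        qed
        thus False by simp
      qed
    qed
    hence ab: "a \<in> ball 0 1" using \<open>norm a \<le> 1\<close> by simp
    have "(\<lambda>n. W e l (x n)) \<longlonglongrightarrow> W e l a"
      by (intro W_tendsto tendsto_const lim ab mirror_in_ball[OF e l ab ae])
    hence "\<epsilon> \<le> W e l a" by (rule LIMSEQ_le_const) (use xb(3) in auto)
    moreover from this have "a \<bullet> e \<noteq> l" using eps by (auto simp: W_def)
    ultimately show "a \<in> ?K" using ab ae by (auto simp: cap_def)
  qed
  ultimately show ?thesis by (simp add: compact_eq_bounded_closed)
qed

lemma max_point:
  assumes e: "norm e = 1" and l: "l > 0" and x: "x \<in> cap e l" "W e l x > 0"
  obtains x0 where "x0 \<in> cap e l" "W e l x0 > 0" "\<And>y. y \<in> cap e l \<Longrightarrow> W e l y \<le> W e l x0"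
proof -
  define K where "K = {y \<in> cap e l. W e l x \<le> W e l y}"
  have "compact K" unfolding K_def by (rule compact_superlevel[OF e l x(2)])
  moreover have "continuous_on K (W e l)"
  proof (rule continuous_at_imp_continuous_on, rule ballI)
    fix y assume "y \<in> K"
    hence "y \<in> ball 0 1" "l \<le> y \<bullet> e" by (auto simp: K_def cap_def)
    thus "isCont (W e l) y"
      unfolding continuous_at by (intro W_tendsto tendsto_const tendsto_ident_at mirror_in_ball e l) auto
  qed
  moreover have "x \<in> K" using x by (simp add: K_def)
  ultimately obtain x0 where x0: "x0 \<in> K" "\<And>y. y \<in> K \<Longrightarrow> W e l y \<le> W e l x0"
    using continuous_attains_sup[of K "W e l"] by blast
  show ?thesis
  proof (rule that)
    show "x0 \<in> cap e l" "W e l x0 > 0" using x0(1) x(2) by (auto simp: K_def)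
    fix y assume "y \<in> cap e l"
    thus "W e l y \<le> W e l x0" using x0(2)[of y] x0(2)[OF \<open>x \<in> K\<close>] by (cases "y \<in> K") (auto simp: K_def)
  qed
qed

text \<open>The barrier \<open>\<psi>\<close> is nonnegative on the cap, exceeds the maximum on a sphere whose radius is
  proportional to the distance \<open>s0\<close> of \<open>x0\<close> to the plane, and stays below the maximum at \<open>x0\<close> itself.\<close>

lemma no_max_near_plane:
  assumes e: "norm e = 1" and l: "l > 0"
    and x0: "x0 \<in> cap e l" "W e l x0 > 0" "\<And>y. y \<in> cap e l \<Longrightarrow> W e l y \<le> W e l x0"
    and Q: "Q \<ge> 0" "Q * (x0 \<bullet> e - l)\<^sup>2 \<le> 1 / (8 * real DIM('a))"
    and est: "\<And>x. x \<in> cap e l \<Longrightarrow> norm (x - x0) \<le> 4 * real DIM('a) * (x0 \<bullet> e - l) \<Longrightarrow> W e l x > 0 \<Longrightarrow>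
       - Q * W e l x \<le> f (u (mirror e l x)) - f (u x)"
  shows False
proof -
  define N where "N = real DIM('a)"
  have N: "N \<ge> 1" using DIM_ge_Suc0[where 'a='a] unfolding N_def by linarith
  define s where "s = (\<lambda>x::'a. x \<bullet> e - l)"
  define s0 where "s0 = s x0"
  define w0 where "w0 = W e l x0"
  have s0: "s0 > 0" using x0(1) by (simp add: s0_def s_def cap_def)
  have w0: "w0 > 0" using x0(2) by (simp add: w0_def)
  define r where "r = 4 * N * s0"
  have r: "r > 0" using N s0 by (simp add: r_def)
  \<comment> \<open>The Laplacian of \<open>\<psi>\<close> is
    \<open>w0 * (2 * N / r\<^sup>2 - 2 * \<kappa>)\<close>; this \<open>\<kappa>\<close> turns it
    into \<open>- w0 * (N / r\<^sup>2 + Q)\<close>, which beats the admissible zero-order term by a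
    strict margin.\<close>
  define \<kappa> where "\<kappa> = 3 * N / (2 * r\<^sup>2) + Q / 2"
  have \<kappa>: "\<kappa> \<ge> 0" using N Q by (simp add: \<kappa>_def)
  define \<psi> where "\<psi> = (\<lambda>x. w0 * ((1 / r\<^sup>2) * (norm (x - x0))\<^sup>2 + \<kappa> * (s x * (s0 + r - s x))))"
  define Y where "Y = (\<lambda>x. W e l x - \<psi> x)"
  \<comment> \<open>With \<open>r = 4 * N * s0\<close> the two parts of \<open>\<kappa>\<close>
    contribute \<open>3/8\<close> and at most \<open>1/4\<close>. A sum below 1 keeps
    \<open>\<psi> x0\<close> below \<open>w0\<close>; this is what the radius and the threshold
    \<open>1 / (8 * N)\<close> are tuned for.\<close>
  have small: "\<kappa> * (s0 * r) \<le> 5/8"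
  proof -
    have "\<kappa> * (s0 * r) = 3 * N * s0 / (2 * r) + Q / 2 * (s0 * r)"
      using r by (simp add: \<kappa>_def field_simps power2_eq_square)
    also have "3 * N * s0 / (2 * r) = 3/8" using N s0 by (simp add: r_def)
    also have "Q / 2 * (s0 * r) = 2 * N * (Q * s0\<^sup>2)" by (simp add: r_def power2_eq_square)
    also have "2 * N * (Q * s0\<^sup>2) \<le> 2 * N * (1 / (8 * N))"
      using Q(2) N unfolding N_def s0_def s_def by (intro mult_left_mono) auto
    also have "2 * N * (1 / (8 * N)) = 1/4" using N by simp
    finally show ?thesis by simp
  qed
  \<comment> \<open>The value of \<open>W - \<psi>\<close> at \<open>x0\<close>. As
    \<open>\<psi>\<close> is nonnegative on the ball, points with \<open>W < \<gamma>\<close> cannot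
    maximise, so the search is confined to a compact superlevel set.\<close>
  define \<gamma> where "\<gamma> = w0 * (1 - \<kappa> * (s0 * r))"
  have \<gamma>: "\<gamma> > 0" using small w0 by (simp add: \<gamma>_def)
  have Y0: "Y x0 = \<gamma>" by (simp add: Y_def \<psi>_def \<gamma>_def w0_def s0_def algebra_simps)
  have \<psi>pos: "\<psi> x \<ge> w0 * ((1 / r\<^sup>2) * (norm (x - x0))\<^sup>2)" "\<psi> x \<ge> 0"
    if "x \<in> cap e l" "norm (x - x0) \<le> r" for x
  proof -
    have "\<bar>s x - s0\<bar> = \<bar>(x - x0) \<bullet> e\<bar>" by (simp add: s_def s0_def inner_diff_left)
    also have "\<dots> \<le> norm (x - x0) * norm e" by (rule Cauchy_Schwarz_ineq2)
    finally have "s x \<le> s0 + r" using that e by auto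
    hence "0 \<le> s x * (s0 + r - s x)" using that by (auto simp: cap_def s_def)
    hence "w0 * (\<kappa> * (s x * (s0 + r - s x))) \<ge> 0" using \<kappa> w0 by simp
    thus "\<psi> x \<ge> w0 * ((1 / r\<^sup>2) * (norm (x - x0))\<^sup>2)" by (simp add: \<psi>_def algebra_simps)
    moreover have "w0 * ((1 / r\<^sup>2) * (norm (x - x0))\<^sup>2) \<ge> 0" using w0 by simp
    ultimately show "\<psi> x \<ge> 0" by linarith
  qed
  define K where "K = {x \<in> cap e l. \<gamma> \<le> W e l x} \<inter> cball x0 r"
  have "compact K" unfolding K_def by (intro compact_Int compact_superlevel[OF e l \<gamma>] compact_cball)
  moreover have "continuous_on K Y"
  proof (rule continuous_at_imp_continuous_on, rule ballI)
    fix y assume "y \<in> K"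
    hence "y \<in> ball 0 1" "l \<le> y \<bullet> e" by (auto simp: K_def cap_def)
    hence "isCont (W e l) y"
      unfolding continuous_at by (intro W_tendsto tendsto_const tendsto_ident_at mirror_in_ball e l) auto
    thus "isCont Y y" unfolding Y_def \<psi>_def s_def by (intro continuous_intros)
  qed
  moreover have x0K: "x0 \<in> K"
    using x0 r w0 \<kappa> s0 by (auto simp: K_def \<gamma>_def w0_def[symmetric] mult_le_cancel_left1)
  ultimately obtain x1 where x1: "x1 \<in> K" "\<And>y. y \<in> K \<Longrightarrow> Y y \<le> Y x1"
    using continuous_attains_sup[of K Y] by blast
  have Yx1: "Y x1 \<ge> \<gamma>" using x1(2)[OF x0K] Y0 by simp
  have x1c: "x1 \<in> cap e l" "norm (x1 - x0) \<le> r" "x1 \<in> ball 0 1" "l \<le> x1 \<bullet> e"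
    using x1(1) by (auto simp: K_def cap_def dist_norm norm_minus_commute)
  have W1: "W e l x1 > 0" using x1(1) \<gamma> by (auto simp: K_def)
  have "norm (x1 - x0) \<noteq> r"
  proof
    assume "norm (x1 - x0) = r"
    hence "\<psi> x1 \<ge> w0" using \<psi>pos(1)[OF x1c(1,2)] r by simp
    thus False using x0(3)[OF x1c(1)] Yx1 \<gamma> unfolding Y_def w0_def by linarith
  qed
  hence "x1 \<in> cap e l \<inter> ball x0 r" using x1c by (simp add: dist_norm norm_minus_commute)
  hence "\<forall>\<^sub>F z in nhds x1. z \<in> cap e l \<inter> ball x0 r"
    by (intro eventually_nhds_in_open) (auto intro: open_cap)
  hence ev: "\<forall>\<^sub>F z in nhds x1. Y z \<le> Y x1"
  proof eventually_elim
    case (elim z)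
    hence z: "z \<in> cap e l" "norm (z - x0) \<le> r" by (auto simp: dist_norm norm_minus_commute)
    show ?case
    proof (cases "\<gamma> \<le> W e l z")
      case True
      thus ?thesis using z by (intro x1(2)) (auto simp: K_def dist_norm norm_minus_commute)
    next
      case False
      thus ?thesis using \<psi>pos(2)[OF z] Yx1 by (simp add: Y_def)
    qed
  qed
  obtain p q where pq: "jet_at (W e l) x1 p q" "sum q Basis = f (u (mirror e l x1)) - f (u x1)"
    using W_jet[OF e x1c(3) mirror_in_ball[OF e l x1c(3,4)]] by blast
  have jpsi: "jet_at \<psi> x1
     (\<lambda>i. w0 * ((1 / r\<^sup>2) * (2 * ((x1 - x0) \<bullet> i)) + \<kappa> * ((s0 + r - 2 * s x1) * (i \<bullet> e))))
     (\<lambda>i. w0 * ((1 / r\<^sup>2) * 2 + \<kappa> * ((s0 + r - 2 * s x1) * 0 + (-2) * (i \<bullet> e)\<^sup>2)))"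
  proof -
    have "jet_at (\<lambda>x. (\<lambda>z. (z - l) * (s0 + r - (z - l))) (x \<bullet> e)) x1 (\<lambda>i. (s0 + r - 2 * (x1 \<bullet> e - l)) * (i \<bullet> e))
        (\<lambda>i. (s0 + r - 2 * (x1 \<bullet> e - l)) * 0 + (-2) * (i \<bullet> e)\<^sup>2)"
      by (rule jet_at_compose[OF jet_at_inner, where h'="\<lambda>z. s0 + r - 2 * (z - l)"])
        (auto intro!: derivative_eq_intros always_eventually)
    thus ?thesis unfolding \<psi>_def s_def by (intro jet_at_cmult jet_at_add jet_at_norm_sq)
  qed
  have "(\<Sum>i\<in>Basis. q i - w0 * ((1 / r\<^sup>2) * 2 + \<kappa> * ((s0 + r - 2 * s x1) * 0 + (-2) * (i \<bullet> e)\<^sup>2))) \<le> 0"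
    by (rule jet_at_local_max(2)[OF jet_at_diff[OF pq(1) jpsi]]) (use ev in \<open>simp add: Y_def\<close>)
  moreover have "(\<Sum>i\<in>Basis. w0 * ((1 / r\<^sup>2) * 2 + \<kappa> * ((s0 + r - 2 * s x1) * 0 + (-2) * (i \<bullet> e)\<^sup>2)))
      = w0 * (2 * N / r\<^sup>2 - 2 * \<kappa>)"
  proof -
    have "(\<Sum>i\<in>Basis. w0 * ((1 / r\<^sup>2) * 2 + \<kappa> * ((s0 + r - 2 * s x1) * 0 + (-2) * (i \<bullet> e)\<^sup>2)))
      = (\<Sum>i\<in>(Basis::'a set). w0 * ((1 / r\<^sup>2) * 2)) + (- 2 * w0 * \<kappa>) * (\<Sum>i\<in>Basis. (e \<bullet> i)\<^sup>2)"
      unfolding sum_distrib_left sum.distrib[symmetric]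
      by (intro sum.cong) (auto simp: algebra_simps inner_commute)
    thus ?thesis using e by (simp add: sum_Basis_inner_sq N_def algebra_simps)
  qed
  ultimately have "sum q Basis \<le> w0 * (2 * N / r\<^sup>2 - 2 * \<kappa>)" by (simp add: sum_subtractf)
  also have "\<dots> = w0 * (- N / r\<^sup>2) - Q * w0" using r by (simp add: \<kappa>_def field_simps)
  also have "\<dots> < - Q * w0" using w0 N r by simp
  also have "\<dots> \<le> - Q * W e l x1" using x0(3)[OF x1c(1)] Q(1) by (simp add: w0_def mult_left_mono)
  also have "\<dots> \<le> sum q Basis"
    unfolding pq(2) using x1c W1 by (intro est) (auto simp: r_def N_def s0_def s_def)
  finally show False by simp
qed

lemma bounded_on_compact:
  assumes "compact K" "K \<subseteq> ball 0 1"
  obtains M where "\<And>x. x \<in> K \<Longrightarrow> u x \<in> {-M..M}"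
proof -
  have "continuous_on K u" using assms(2) u_isCont by (intro continuous_at_imp_continuous_on) blast
  hence "bounded (u ` K)" using assms(1) compact_continuous_image compact_imp_bounded by blast
  then obtain M where "\<And>x. x \<in> K \<Longrightarrow> \<bar>u x\<bar> \<le> M" unfolding bounded_iff by auto
  thus ?thesis by (intro that[of M]) (fastforce simp: abs_le_iff)
qed

text \<open>Where \<open>W \<le> 0\<close>, the Lipschitz bound on the compact range of
  \<open>u\<close> absorbs the difference of the \<open>f\<close> values into a multiple of
  \<open>- W\<close>, whatever its sign. This is the form that Hopf's lemma and the strong maximum
  principle take as input.\<close>

lemma W_supersolution:
  assumes e: "norm e = 1" and l: "0 < l" and K: "compact K" "\<And>z. z \<in> K \<Longrightarrow> z \<in> ball 0 1 \<and> l \<le> z \<bullet> e"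
  obtains L where "L \<ge> 0" "\<And>z. z \<in> K \<Longrightarrow> W e l z \<le> 0 \<Longrightarrow>
    \<exists>p q. jet_at (\<lambda>z. - W e l z) z p q \<and> sum q Basis \<le> L * (- W e l z)"
proof -
  have mb: "mirror e l z \<in> ball 0 1" if "z \<in> K" for z using mirror_in_ball[OF e l] K(2)[OF that] by blast
  define K' where "K' = K \<union> mirror e l ` K"
  have "compact K'" unfolding K'_def
    using K(1) by (intro compact_Un compact_continuous_image continuous_intros)
  moreover have "K' \<subseteq> ball 0 1" unfolding K'_def using mb K(2) by blast
  ultimately obtain M where M: "\<And>x. x \<in> K' \<Longrightarrow> u x \<in> {-M..M}" using bounded_on_compact by blast
  obtain L where L: "L \<ge> 0" "\<And>a b. a \<in> {-M..M} \<Longrightarrow> b \<in> {-M..M} \<Longrightarrow> \<bar>f a - f b\<bar> \<le> L * \<bar>a - b\<bar>"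
    using locally_lipschitz_compact[OF lip] by blast
  show ?thesis
  proof (rule that[OF L(1)])
    fix z assume z: "z \<in> K" and le: "W e l z \<le> 0"
    obtain p q where pq: "jet_at (W e l) z p q" "sum q Basis = f (u (mirror e l z)) - f (u z)"
      using W_jet[OF e _ mb[OF z]] K(2)[OF z] by blast
    have "jet_at (\<lambda>z. - W e l z) z (\<lambda>i. (-1) * p i) (\<lambda>i. (-1) * q i)"
      using jet_at_cmult[OF pq(1), of "-1"] by simp
    moreover have "sum (\<lambda>i. (-1) * q i) Basis \<le> L * (- W e l z)"
    proof -
      have "\<bar>f (u z) - f (u (mirror e l z))\<bar> \<le> L * \<bar>u z - u (mirror e l z)\<bar>"
        by (intro L(2) M) (use z in \<open>auto simp: K'_def\<close>)
      also have "\<bar>u z - u (mirror e l z)\<bar> = - W e l z" using le by (simp add: W_def)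
      finally show ?thesis using pq(2) by (simp add: sum_negf)
    qed
    ultimately show "\<exists>p q. jet_at (\<lambda>z. - W e l z) z p q \<and> sum q Basis \<le> L * (- W e l z)" by blast
  qed
qed

section \<open>Moving the plane\<close>

text \<open>Close to the pole \<open>e\<close> of the sphere \<open>u\<close> blows up while the
  mirrored values stay bounded, so \<open>W\<close> is negative somewhere; the strong maximum
  principle spreads this over the connected cap.\<close>

lemma W_strict:
  assumes e: "norm e = 1" and l: "0 < l" "l < 1"
    and le: "\<And>x. x \<in> cap e l \<Longrightarrow> W e l x \<le> 0" and x: "x \<in> cap e l"
  shows "W e l x < 0"
proof -
  define w where "w = (\<lambda>x. - W e l x)"
  have mb: "x \<in> ball 0 1" "mirror e l x \<in> ball 0 1" if "x \<in> cap e l" for x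
    using that mirror_in_ball[OF e l(1), of x] by (auto simp: cap_def)
  have "\<exists>a\<in>cap e l. w a > 0"
  proof -
    have ee: "e \<bullet> e = 1" using e by (simp add: norm_eq_1)
    have "mirror e l e \<in> ball 0 1" using e l by (intro mirror_in_ball') (auto simp: ee)
    hence lim: "((\<lambda>t. u (mirror e l (t *\<^sub>R e))) \<longlongrightarrow> u (mirror e l e)) (at_left 1)"
    proof (intro u_tendsto tendsto_mirror tendsto_const)
      have "((\<lambda>t::real. t *\<^sub>R e) \<longlongrightarrow> 1 *\<^sub>R e) (at_left 1)" by (intro tendsto_intros)
      thus "((\<lambda>t::real. t *\<^sub>R e) \<longlongrightarrow> e) (at_left 1)" by simp
    qed
    have "\<forall>\<^sub>F t in at_left 1. u (mirror e l (t *\<^sub>R e)) < u (mirror e l e) + 1"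
      by (rule order_tendstoD(2)[OF lim]) simp
    moreover obtain r where r: "r < 1" "\<forall>x\<in>ball 0 1. r < norm x \<longrightarrow> u (mirror e l e) + 1 < u x"
      using large by blast
    have "\<forall>\<^sub>F t in at_left 1. t \<in> {max r l<..<1}"
      using eventually_at_left_real[of "max r l" 1] r(1) l by simp
    ultimately have "\<forall>\<^sub>F t in at_left (1::real). t *\<^sub>R e \<in> cap e l \<and> w (t *\<^sub>R e) > 0"
    proof eventually_elim
      case (elim t)
      have "t *\<^sub>R e \<in> ball 0 1" "r < norm (t *\<^sub>R e)" using elim e l by auto
      hence "u (mirror e l e) + 1 < u (t *\<^sub>R e)" using r(2) by blast
      thus ?case using elim e ee l by (simp add: cap_def w_def W_def)
    qed
    thus ?thesis using eventually_happens' trivial_limit_at_left_real by blast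
  qed
  then obtain a where a: "a \<in> cap e l" "w a > 0" by blast
  have "w x > 0"
  proof (rule strong_maximum_principle[where S="cap e l" and w=w and a=a])
    show "w z \<ge> 0" if "z \<in> cap e l" for z using le[OF that] by (simp add: w_def)
    show "w differentiable (at z)" if z: "z \<in> cap e l" for z
    proof -
      have "(\<lambda>y. u (mirror e l y)) differentiable (at z)"
        using u_diff[OF mb(2)[OF z]]
        by (rule differentiable_compose) (auto simp: mirror_def intro!: derivative_intros)
      thus ?thesis unfolding w_def W_def using u_diff[OF mb(1)[OF z]]
        by (intro derivative_intros)
    qed
    show "open (cap e l)" by (rule open_cap)
    show "connected (cap e l)" by (rule connected_cap)
    show "a \<in> cap e l" "w a > 0" "x \<in> cap e l" by (fact a x)+
    fix K assume K: "compact K" "K \<subseteq> cap e l"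
    have "z \<in> ball 0 1 \<and> l \<le> z \<bullet> e" if "z \<in> K" for z using K(2) that by (auto simp: cap_def)
    from W_supersolution[OF e l(1) K(1) this]
    show "\<exists>L\<ge>0. \<forall>x\<in>K. \<exists>p q. jet_at w x p q \<and> sum q Basis \<le> L * w x"
      unfolding w_def using le K(2) by (metis subsetD)
  qed
  thus ?thesis by (simp add: w_def)
qed

text \<open>The supremum \<open>l0\<close> of all bad positions is approached by bad positions, and
  a limit point \<open>a\<close> of their maximum points is examined. If \<open>a\<close> is off the
  plane, blow-up or strict negativity at \<open>l0\<close> gives the contradiction. If
  \<open>a\<close> is on the plane, the barrier excludes a maximum so close to it: inside the ball
  through a Lipschitz constant, at a corner through \<open>narrow\<close>. The value
  \<open>l0 = 1\<close> is included; its cap is empty and \<open>a\<close> is then the corner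
  \<open>e\<close>.\<close>

lemma W_nonpos:
  assumes e: "norm e = 1" and l: "0 < l" "l < 1" and x: "x \<in> cap e l"
  shows "W e l x \<le> 0"
proof (rule ccontr)
  assume fail: "\<not> W e l x \<le> 0"
  define S where "S = {l. 0 < l \<and> l < 1 \<and> (\<exists>x\<in>cap e l. W e l x > 0)}"
  define N where "N = real DIM('a)"
  have N: "N \<ge> 1" using DIM_ge_Suc0[where 'a='a] unfolding N_def by linarith
  have lS: "l \<in> S" using l x fail unfolding S_def by (auto intro!: bexI[of _ x])
  have bdd: "bdd_above S" by (rule bdd_aboveI[of _ 1]) (auto simp: S_def)
  define l0 where "l0 = Sup S"
  have l0: "0 < l0" "l0 \<le> 1"
    using cSup_upper[OF lS bdd] l cSup_least[of S 1] lS by (auto simp: l0_def S_def intro: less_imp_le)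
  \<comment> \<open>Positions above \<open>l0\<close> are good and \<open>W e l y\<close> is
    continuous in \<open>l\<close>, so the position \<open>l0\<close> is good as well.\<close>
  have le0: "W e l0 y \<le> 0" if "y \<in> cap e l0" for y
  proof -
    have y: "y \<in> ball 0 1" "l0 < y \<bullet> e" using that by (auto simp: cap_def)
    have "(\<lambda>n. l0 + 1 / real (Suc n)) \<longlonglongrightarrow> l0 + 0"
      by (intro tendsto_intros LIMSEQ_inverse_real_of_nat[unfolded inverse_eq_divide])
    hence lim: "(\<lambda>n. l0 + 1 / real (Suc n)) \<longlonglongrightarrow> l0" by simp
    have "\<forall>\<^sub>F n in sequentially. l0 + 1 / real (Suc n) < y \<bullet> e" by (rule order_tendstoD(2)[OF lim y(2)])
    hence ev: "\<forall>\<^sub>F n in sequentially. W e (l0 + 1 / real (Suc n)) y \<le> 0"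
    proof eventually_elim
      case (elim n)
      have "y \<bullet> e < 1" using norm_cauchy_schwarz[of y e] e y(1) by simp
      moreover have "l0 + 1 / real (Suc n) \<notin> S"
      proof
        assume "l0 + 1 / real (Suc n) \<in> S"
        hence "l0 + 1 / real (Suc n) \<le> l0" unfolding l0_def by (rule cSup_upper[OF _ bdd])
        thus False by (simp add: field_simps)
      qed
      moreover have "l0 + 1 / real (Suc n) > 0" using l0 by (simp add: add_pos_pos)
      ultimately show ?case using elim y unfolding S_def cap_def by force
    qed
    have "(\<lambda>n. W e (l0 + 1 / real (Suc n)) y) \<longlonglongrightarrow> W e l0 y"
      using y l0 by (intro W_tendsto lim tendsto_const mirror_in_ball e) auto
    thus ?thesis by (rule tendsto_upperbound) (use ev in auto)
  qed
  have "\<exists>l' x0. l0 - 1 / real (Suc n) < l' \<and> l' \<le> l0 \<and> 0 < l' \<and> x0 \<in> cap e l' \<and> W e l' x0 > 0 \<and>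
      (\<forall>y\<in>cap e l'. W e l' y \<le> W e l' x0)" for n
  proof -
    have "l0 - 1 / real (Suc n) < Sup S" by (simp add: l0_def)
    then obtain l' where l': "l' \<in> S" "l0 - 1 / real (Suc n) < l'"
      using less_cSup_iff[of S] lS bdd by blast
    have "l' \<le> l0" unfolding l0_def by (rule cSup_upper[OF l'(1) bdd])
    moreover obtain z where "0 < l'" "z \<in> cap e l'" "W e l' z > 0" using l'(1) by (auto simp: S_def)
    ultimately show ?thesis using max_point[OF e, of l' z] l'(2) by metis
  qed
  then obtain L X where LX: "\<And>n::nat. l0 - 1 / real (Suc n) < L n" "\<And>n. L n \<le> l0" "\<And>n. 0 < L n"
    "\<And>n. X n \<in> cap e (L n)" "\<And>n. W e (L n) (X n) > 0"
    "\<And>n y. y \<in> cap e (L n) \<Longrightarrow> W e (L n) y \<le> W e (L n) (X n)" by metis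
  have Xb: "X n \<in> ball 0 1" "L n < X n \<bullet> e" for n using LX(4)[of n] by (auto simp: cap_def)
  have "seq_compact (cball (0::'a) 1)" by (simp add: compact_imp_seq_compact)
  moreover have "\<forall>n. X n \<in> cball 0 1" using Xb(1) by (auto intro: less_imp_le)
  ultimately obtain a \<sigma> where a: "a \<in> cball 0 1" "strict_mono \<sigma>" "(X \<circ> \<sigma>) \<longlonglongrightarrow> a"
    unfolding seq_compact_def by blast
  define l' where "l' = L \<circ> \<sigma>"
  define x' where "x' = X \<circ> \<sigma>"
  have lim: "x' \<longlonglongrightarrow> a" using a by (simp add: x'_def)
  have "L \<longlonglongrightarrow> l0"
  proof (rule tendsto_sandwich[OF _ _ _ tendsto_const])
    have "(\<lambda>n. l0 - 1 / real (Suc n)) \<longlonglongrightarrow> l0 - 0"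
      by (intro tendsto_intros LIMSEQ_inverse_real_of_nat[unfolded inverse_eq_divide])
    thus "(\<lambda>n. l0 - 1 / real (Suc n)) \<longlonglongrightarrow> l0" by simp
  qed (use LX in \<open>auto intro!: always_eventually less_imp_le\<close>)
  hence liml: "l' \<longlonglongrightarrow> l0" unfolding l'_def by (rule LIMSEQ_subseq_LIMSEQ[OF _ a(2)])
  have x'b: "x' n \<in> ball 0 1" "l' n < x' n \<bullet> e" "0 < l' n" for n
    using Xb LX(3) by (auto simp: x'_def l'_def)
  have m': "mirror e (l' n) (x' n) \<in> ball 0 1" for n
    using mirror_in_ball[OF e x'b(3,1)] x'b(2)[of n] by simp
  have W': "W e (l' n) (x' n) > 0" for n using LX(5) by (simp add: x'_def l'_def)
  have nomax: "\<not> (Q \<ge> 0 \<and> Q * (x' n \<bullet> e - l' n)\<^sup>2 \<le> 1 / (8 * real DIM('a)) \<and>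
      (\<forall>x\<in>cap e (l' n). norm (x - x' n) \<le> 4 * real DIM('a) * (x' n \<bullet> e - l' n) \<longrightarrow> W e (l' n) x > 0 \<longrightarrow>
       - Q * W e (l' n) x \<le> f (u (mirror e (l' n) x)) - f (u x)))" for Q n
    using no_max_near_plane[OF e LX(3,4,5,6), of "\<sigma> n" Q] unfolding x'_def l'_def comp_def by blast
  have ae: "l0 \<le> a \<bullet> e"
    by (rule LIMSEQ_le[OF liml tendsto_inner[OF lim tendsto_const]]) (use x'b(2) in \<open>auto intro!: less_imp_le\<close>)
  have limm: "(\<lambda>n. mirror e (l' n) (x' n)) \<longlonglongrightarrow> mirror e l0 a" by (rule tendsto_mirror[OF liml lim])
  show False
  proof (cases "norm a = 1")
    case True
    have big: "\<forall>\<^sub>F n in sequentially. M < u (x' n)" for M by (rule u_at_boundary[OF lim True x'b(1)])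
    show False
    proof (cases "a \<bullet> e = l0")
      case False
      hence "mirror e l0 a \<in> ball 0 1" using mirror_in_ball'[OF e l0(1)] True ae by simp
      hence "(\<lambda>n. u (mirror e (l' n) (x' n))) \<longlonglongrightarrow> u (mirror e l0 a)" by (rule u_tendsto[OF limm])
      hence "\<forall>\<^sub>F n in sequentially. u (mirror e (l' n) (x' n)) < u (mirror e l0 a) + 1"
        by (rule order_tendstoD) simp
      hence "\<forall>\<^sub>F n in sequentially. False"
        using big[of "u (mirror e l0 a) + 1"]
      proof eventually_elim
        case (elim n)
        thus ?case using W'[of n] by (simp add: W_def)
      qed
      thus False by simp
    next
      case True
      \<comment> \<open>The threshold of the barrier lemma. \<open>narrow\<close> is used with
        \<open>c = l0\<close>: for late indices \<open>l' n > l0 / 2\<close>, so the radial gain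
        \<open>2 * l' n * s\<close> is at least \<open>l0 * s\<close>.\<close>
      have "1 / (8 * real DIM('a)) > 0" by simp
      from narrow[OF l0(1) this] obtain t where t: "\<forall>x0\<in>ball 0 1. \<forall>y0\<in>ball 0 1. \<forall>s>0.
          l0 * s \<le> norm x0 - norm y0 \<and> t \<le> u x0 \<and> u x0 < u y0 \<longrightarrow>
          (\<exists>Q\<ge>0. Q * s\<^sup>2 \<le> 1 / (8 * real DIM('a)) \<and> (\<forall>x\<in>ball 0 1. \<forall>y\<in>ball 0 1.
             norm (x - x0) \<le> 4 * real DIM('a) * s \<and> norm (y - y0) \<le> 4 * real DIM('a) * s \<and> u x < u y \<longrightarrow>
             - Q * (u y - u x) \<le> f (u y) - f (u x)))" by blast
      have "\<forall>\<^sub>F n in sequentially. l0 / 2 < l' n" by (rule order_tendstoD(1)[OF liml]) (use l0 in simp)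
      with big[of t] have "\<forall>\<^sub>F n in sequentially. t < u (x' n) \<and> l0 / 2 < l' n" by eventually_elim auto
      then obtain n where n: "t < u (x' n)" "l0 / 2 < l' n"
        using eventually_happens' sequentially_bot by blast
      define s where "s = x' n \<bullet> e - l' n"
      have s: "s > 0" using x'b(2)[of n] by (simp add: s_def)
      have "2 * l' n * s \<le> norm (x' n) - norm (mirror e (l' n) (x' n))"
        unfolding s_def using x'b[of n] by (intro norm_diff_mirror_ge e) auto
      moreover have "l0 * s \<le> 2 * l' n * s" using n(2) s by (intro mult_right_mono) auto
      ultimately have "l0 * s \<le> norm (x' n) - norm (mirror e (l' n) (x' n)) \<and> t \<le> u (x' n)
          \<and> u (x' n) < u (mirror e (l' n) (x' n))" using n(1) W'[of n] by (simp add: W_def)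
      then obtain Q where Q: "Q \<ge> 0" "Q * s\<^sup>2 \<le> 1 / (8 * real DIM('a))"
        "\<forall>x\<in>ball 0 1. \<forall>y\<in>ball 0 1. norm (x - x' n) \<le> 4 * real DIM('a) * s \<and>
          norm (y - mirror e (l' n) (x' n)) \<le> 4 * real DIM('a) * s \<and> u x < u y \<longrightarrow>
             - Q * (u y - u x) \<le> f (u y) - f (u x)"
        using t x'b(1)[of n] m'[of n] s by blast
      have "- Q * W e (l' n) x \<le> f (u (mirror e (l' n) x)) - f (u x)"
        if x: "x \<in> cap e (l' n)" "norm (x - x' n) \<le> 4 * real DIM('a) * s" "W e (l' n) x > 0" for x
        unfolding W_def using x mirror_in_ball[OF e x'b(3)[of n], of x] dist_mirror[OF e, of "l' n" x "x' n"]
        by (intro Q(3)[rule_format]) (auto simp: cap_def W_def)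
      thus False using nomax[of Q n] Q(1,2) unfolding s_def by blast
    qed
  next
    case False
    hence ab: "a \<in> ball 0 1" using a(1) by simp
    have mb: "mirror e l0 a \<in> ball 0 1" by (rule mirror_in_ball[OF e l0(1) ab ae])
    show False
    proof (cases "a \<bullet> e = l0")
      case False
      have ac: "a \<in> cap e l0" using ab ae False by (simp add: cap_def)
      have "a \<bullet> e < 1" using norm_cauchy_schwarz[of a e] e ab by simp
      hence "W e l0 a < 0" using W_strict[OF e l0(1) _ le0 ac] ae by simp
      moreover have "(\<lambda>n. W e (l' n) (x' n)) \<longlonglongrightarrow> W e l0 a" by (rule W_tendsto[OF liml lim ab mb])
      hence "W e l0 a \<ge> 0" by (rule LIMSEQ_le_const) (use W' in \<open>auto intro!: less_imp_le\<close>)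
      ultimately show False by simp
    next
      case True
      hence ma: "mirror e l0 a = a" by simp
      obtain d where d: "d > 0" "cball a d \<subseteq> ball 0 1" using ab open_contains_cball[of "ball 0 1"] by blast
      obtain M where M: "\<And>x. x \<in> cball a d \<Longrightarrow> u x \<in> {-M..M}"
        using bounded_on_compact[OF compact_cball d(2)] by blast
      \<comment> \<open>Near an interior limit point this fixed Lipschitz constant serves as
        \<open>Q\<close>; the smallness of its product with the squared distance to the plane comes
        from that distance tending to 0.\<close>
      obtain K where K: "K \<ge> 0" "\<And>a b. a \<in> {-M..M} \<Longrightarrow> b \<in> {-M..M} \<Longrightarrow> \<bar>f a - f b\<bar> \<le> K * \<bar>a - b\<bar>"
        using locally_lipschitz_compact[OF lip] by blast
      have "(\<lambda>n. x' n \<bullet> e - l' n) \<longlonglongrightarrow> a \<bullet> e - l0" by (intro tendsto_intros lim liml)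
      hence ls: "(\<lambda>n. x' n \<bullet> e - l' n) \<longlonglongrightarrow> 0" using True by simp
      have "(\<lambda>n. K * (x' n \<bullet> e - l' n)\<^sup>2) \<longlonglongrightarrow> K * 0\<^sup>2" by (intro tendsto_intros ls)
      hence "\<forall>\<^sub>F n in sequentially. K * (x' n \<bullet> e - l' n)\<^sup>2 < 1 / (8 * real DIM('a))"
        by (rule order_tendstoD) simp
      moreover have "(\<lambda>n. 4 * real DIM('a) * (x' n \<bullet> e - l' n)) \<longlonglongrightarrow> 4 * real DIM('a) * 0" by (intro tendsto_intros ls)
      hence "\<forall>\<^sub>F n in sequentially. 4 * real DIM('a) * (x' n \<bullet> e - l' n) < d / 2"
        by (rule order_tendstoD) (use d in simp)
      moreover have "\<forall>\<^sub>F n in sequentially. dist (x' n) a < d / 2" by (rule tendstoD[OF lim]) (use d in simp)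
      moreover have "\<forall>\<^sub>F n in sequentially. dist (mirror e (l' n) (x' n)) a < d / 2"
        by (rule tendstoD[OF limm[unfolded ma]]) (use d in simp)
      ultimately have "\<forall>\<^sub>F n in sequentially. K * (x' n \<bullet> e - l' n)\<^sup>2 < 1 / (8 * real DIM('a)) \<and>
          4 * real DIM('a) * (x' n \<bullet> e - l' n) < d / 2 \<and> dist (x' n) a < d / 2 \<and>
          dist (mirror e (l' n) (x' n)) a < d / 2" by eventually_elim auto
      then obtain n where n: "K * (x' n \<bullet> e - l' n)\<^sup>2 < 1 / (8 * real DIM('a))"
          "4 * real DIM('a) * (x' n \<bullet> e - l' n) < d / 2" "dist (x' n) a < d / 2"
          "dist (mirror e (l' n) (x' n)) a < d / 2"
        using eventually_happens' sequentially_bot by blast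
      have "- K * W e (l' n) x \<le> f (u (mirror e (l' n) x)) - f (u x)"
        if x: "x \<in> cap e (l' n)" "norm (x - x' n) \<le> 4 * real DIM('a) * (x' n \<bullet> e - l' n)" "W e (l' n) x > 0" for x
      proof -
        have "dist x a \<le> dist x (x' n) + dist (x' n) a" by (rule dist_triangle)
        hence 1: "x \<in> cball a d" using x(2) n(2,3) by (simp add: dist_norm norm_minus_commute)
        have "dist (mirror e (l' n) x) a \<le> dist (mirror e (l' n) x) (mirror e (l' n) (x' n)) + dist (mirror e (l' n) (x' n)) a"
          by (rule dist_triangle)
        hence 2: "mirror e (l' n) x \<in> cball a d"
          using x(2) n(2,4) dist_mirror[OF e, of "l' n" x "x' n"] by (simp add: dist_norm norm_minus_commute)
        have "\<bar>f (u (mirror e (l' n) x)) - f (u x)\<bar> \<le> K * \<bar>u (mirror e (l' n) x) - u x\<bar>"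
          by (intro K(2) M 1 2)
        thus ?thesis using x(3) by (simp add: W_def abs_le_iff)
      qed
      thus False using nomax[of K n] K(1) n(1) by (auto intro: less_imp_le)
    qed
  qed
qed

section \<open>Symmetry and strict monotonicity\<close>

text \<open>Letting \<open>l\<close> tend to 0 gives \<open>u (mirror e 0 x) \<le> u x\<close> on
  the half ball \<open>x \<bullet> e > 0\<close>; the directions \<open>e\<close> and
  \<open>- e\<close> together give equality.\<close>

lemma reflection_invariant:
  assumes e: "norm e = 1" and x: "x \<in> ball 0 1"
  shows "u (mirror e 0 x) = u x"
proof -
  have *: "u (mirror e 0 x) \<le> u x" if e: "norm e = 1" and x: "x \<in> ball 0 1" "x \<bullet> e > 0" for e x
  proof -
    have "norm (mirror e 0 x) = norm x"
      using norm_mirror_sq[OF e, of 0 x] by (simp add: power2_eq_iff_nonneg)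
    hence mb: "mirror e 0 x \<in> ball 0 1" using x(1) by simp
    have "((\<lambda>l. W e l x) \<longlongrightarrow> W e 0 x) (at_right 0)"
      by (intro W_tendsto tendsto_const tendsto_ident_at x mb)
    moreover have "\<forall>\<^sub>F l in at_right 0. W e l x \<le> 0"
    proof -
      have xe: "x \<bullet> e < 1" using norm_cauchy_schwarz[of x e] e x(1) by simp
      have "\<forall>\<^sub>F l in at_right 0. l \<in> {0<..<x \<bullet> e}" using x(2) by (rule eventually_at_right_real)
      thus ?thesis by eventually_elim (use x xe in \<open>auto intro!: W_nonpos[OF e] simp: cap_def\<close>)
    qed
    ultimately have "W e 0 x \<le> 0" by (rule tendsto_upperbound) simp
    thus ?thesis by (simp add: W_def)
  qed
  have ee: "e \<bullet> e = 1" using e by (simp add: norm_eq_1)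
  have nm: "norm (mirror e 0 x) = norm x"
    using norm_mirror_sq[OF e, of 0 x] by (simp add: power2_eq_iff_nonneg)
  have mm: "mirror (-e) 0 y = mirror e 0 y" for y by (simp add: mirror_def)
  have mi: "mirror e 0 x \<bullet> e = - (x \<bullet> e)" using ee by (simp add: mirror_def inner_diff_left)
  consider "x \<bullet> e > 0" | "x \<bullet> e = 0" | "x \<bullet> e < 0" by linarith
  thus ?thesis
  proof cases
    case 1
    thus ?thesis using *[OF e x] *[of "-e" "mirror e 0 x"] e x nm mi by (simp add: mm)
  next
    case 2
    thus ?thesis by simp
  next
    case 3
    thus ?thesis using *[of "-e" x] *[OF e, of "mirror e 0 x"] e x nm mi by (simp add: mm)
  qed
qed

text \<open>Two points of equal norm are interchanged by the reflection along their
  difference.\<close>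

lemma radially_symmetric:
  assumes "x \<in> ball 0 1" "norm x = norm y"
  shows "u x = u y"
proof (cases "x = y")
  case False
  define e where "e = (x - y) /\<^sub>R norm (x - y)"
  have e: "norm e = 1" using False by (simp add: e_def)
  have "x \<bullet> x = y \<bullet> y" using assms(2) by (simp add: norm_eq)
  hence "(norm (x - y))\<^sup>2 = 2 * (x \<bullet> (x - y))"
    unfolding power2_norm_eq_inner by (simp add: inner_diff_left inner_diff_right inner_commute)
  hence "2 * (x \<bullet> e) = norm (x - y)"
  proof -
    assume h: "(norm (x - y))\<^sup>2 = 2 * (x \<bullet> (x - y))"
    have "2 * (x \<bullet> e) = inverse (norm (x - y)) * (2 * (x \<bullet> (x - y)))"
      unfolding e_def inner_scaleR_right by simp
    thus ?thesis unfolding h[symmetric] using False by (simp add: power2_eq_square)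
  qed
  hence "mirror e 0 x = x - norm (x - y) *\<^sub>R e" by (simp add: mirror_def)
  also have "\<dots> = y" using False by (simp add: e_def)
  finally show ?thesis using reflection_invariant[OF e assms(1)] by simp
qed simp

text \<open>The plane with \<open>l = norm x\<close> passes through \<open>x\<close>. Hopf's lemma
  for \<open>- W\<close>, in a ball of the cap touching the plane at \<open>x\<close>, gives linear
  growth of \<open>u (x + h *\<^sub>R e) - u (x - h *\<^sub>R e)\<close> in \<open>h > 0\<close>;
  this makes the derivative strictly positive.\<close>

lemma radially_increasing:
  assumes x: "x \<in> ball 0 1" "x \<noteq> 0"
  shows "\<exists>d>0. ((\<lambda>t. u (x + t *\<^sub>R (x /\<^sub>R norm x))) has_real_derivative d) (at 0)"
proof -
  define e where "e = x /\<^sub>R norm x"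
  define l where "l = norm x"
  have e: "norm e = 1" using x by (simp add: e_def)
  hence ee: "e \<bullet> e = 1" by (simp add: norm_eq_1)
  have l: "0 < l" "l < 1" using x by (auto simp: l_def)
  have xe: "x = l *\<^sub>R e" using x by (simp add: e_def l_def)
  have xl: "x \<bullet> e = l" using ee by (simp add: xe)
  have strict: "W e l z < 0" if "z \<in> cap e l" for z
    using W_strict[OF e l W_nonpos[OF e l] that] .
  obtain d where d: "((\<lambda>t. u (x + t *\<^sub>R e)) has_real_derivative d) (at 0)"
    using has_derivative_line[of u "\<lambda>i. partial_dir u i x" x 0 e] C2_on_has_derivative(1)[OF C2 _ x(1)] by auto
  \<comment> \<open>The ball around \<open>x + R *\<^sub>R e\<close> reaches the radius
    \<open>l + 2 * R = (1 + l) / 2\<close>, still below 1.\<close>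
  define R where "R = (1 - l) / 4"
  have R: "R > 0" using l by (simp add: R_def)
  define y where "y = x + R *\<^sub>R e"
  define w where "w = (\<lambda>z. - W e l z)"
  have cb: "z \<in> ball 0 1 \<and> l \<le> z \<bullet> e" if "z \<in> cball y R" for z
  proof
    have "norm z \<le> norm (z - y) + norm y" using norm_triangle_sub[of z y] by simp
    also have "\<dots> \<le> R + (l + R)"
    proof (intro add_mono)
      show "norm (z - y) \<le> R" using that by (simp add: dist_norm norm_minus_commute)
      show "norm y \<le> l + R" unfolding y_def using norm_triangle_ineq[of x "R *\<^sub>R e"] e R by (simp add: l_def)
    qed
    also have "\<dots> < 1" using l unfolding R_def by argo
    finally show "z \<in> ball 0 1" by simp
    have "\<bar>(z - y) \<bullet> e\<bar> \<le> norm (z - y) * norm e" by (rule Cauchy_Schwarz_ineq2)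
    hence "\<bar>(z - y) \<bullet> e\<bar> \<le> R" using that e by (simp add: dist_norm norm_minus_commute)
    thus "l \<le> z \<bullet> e" using ee by (simp add: y_def inner_diff_left inner_add_left xl)
  qed
  have cb': "z \<in> cap e l" if z: "z \<in> ball y R" for z
  proof -
    have "\<bar>(z - y) \<bullet> e\<bar> \<le> norm (z - y) * norm e" by (rule Cauchy_Schwarz_ineq2)
    hence "\<bar>(z - y) \<bullet> e\<bar> < R" using z e by (simp add: dist_norm norm_minus_commute)
    hence "l < z \<bullet> e" using ee by (simp add: y_def inner_diff_left inner_add_left xl)
    thus ?thesis using cb[of z] z by (simp add: cap_def)
  qed
  have mb: "mirror e l z \<in> ball 0 1" if "z \<in> cball y R" for z
    using mirror_in_ball[OF e l(1)] cb[OF that] by blast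
  obtain L where L: "L \<ge> 0" "\<And>z. z \<in> cball y R \<Longrightarrow> W e l z \<le> 0 \<Longrightarrow>
    \<exists>p q. jet_at (\<lambda>z. - W e l z) z p q \<and> sum q Basis \<le> L * (- W e l z)"
    using W_supersolution[OF e l(1) compact_cball cb] by blast
  have "\<exists>c>0. \<forall>t\<in>{0..1/2}. w (x + t *\<^sub>R (y - x)) \<ge> c * t"
  proof (rule hopf_boundary_growth[OF R L(1)])
    show "continuous_on (cball y R) w"
    proof (rule continuous_at_imp_continuous_on, rule ballI)
      fix z assume z: "z \<in> cball y R"
      have "isCont (W e l) z"
        unfolding continuous_at using cb[OF z] mb[OF z] by (intro W_tendsto tendsto_const tendsto_ident_at) auto
      thus "isCont w z" unfolding w_def by (intro continuous_intros)
    qed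
    show "w z > 0" if "z \<in> ball y R" for z using strict[OF cb'[OF that]] by (simp add: w_def)
    show "norm (x - y) = R" using e R by (simp add: y_def)
    fix z assume z: "z \<in> ball y R"
    hence "z \<in> cball y R" by simp
    thus "\<exists>p q. jet_at w z p q \<and> sum q Basis \<le> L * w z"
      unfolding w_def using strict[OF cb'[OF z]] by (intro L(2)) auto
  qed
  then obtain c where c: "c > 0" "\<forall>t\<in>{0..1/2}. w (x + t *\<^sub>R (y - x)) \<ge> c * t" by blast
  have wt: "w (x + t *\<^sub>R (y - x)) = u (x + (R * t) *\<^sub>R e) - u (x + (- (R * t)) *\<^sub>R e)" for t
  proof -
    have "x + t *\<^sub>R (y - x) = x + (R * t) *\<^sub>R e" by (simp add: y_def mult.commute)
    moreover have "mirror e l (x + (R * t) *\<^sub>R e) = x + (- (R * t)) *\<^sub>R e"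
      using ee xl by (simp add: mirror_def inner_add_left algebra_simps flip: scaleR_add_left)
    ultimately show ?thesis by (simp add: w_def W_def)
  qed
  have "((\<lambda>t. u (x + (R * t) *\<^sub>R e) - u (x + (- (R * t)) *\<^sub>R e) - c * t) has_real_derivative (d * R - d * (- R) - c)) (at 0)"
  proof (intro DERIV_diff)
    have 1: "((\<lambda>t. R * t) has_real_derivative R) (at 0)" "((\<lambda>t. - (R * t)) has_real_derivative - R) (at 0)"
      "((\<lambda>t. c * t) has_real_derivative c) (at 0)"
      by (auto intro!: derivative_eq_intros)
    show "((\<lambda>t. u (x + (R * t) *\<^sub>R e)) has_real_derivative d * R) (at 0)"
      using DERIV_chain2[OF _ 1(1), of "\<lambda>t. u (x + t *\<^sub>R e)" d] d by simp
    show "((\<lambda>t. u (x + (- (R * t)) *\<^sub>R e)) has_real_derivative d * (- R)) (at 0)"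
      using DERIV_chain2[OF _ 1(2), of "\<lambda>t. u (x + t *\<^sub>R e)" d] d by simp
    show "((\<lambda>t. c * t) has_real_derivative c) (at 0)" by (rule 1(3))
  qed
  note der = this
  have "d * R - d * (- R) - c \<ge> 0"
  proof (rule ccontr)
    assume "\<not> ?thesis"
    hence "d * R - d * (- R) - c < 0" by simp
    from DERIV_neg_dec_right[OF der this] obtain \<delta> where \<delta>: "\<delta> > 0"
      "\<And>h. h > 0 \<Longrightarrow> h < \<delta> \<Longrightarrow> u (x + (R * h) *\<^sub>R e) - u (x + (- (R * h)) *\<^sub>R e) - c * h < 0" by auto
    define h where "h = min \<delta> 1 / 2"
    have h: "h > 0" "h < \<delta>" "h \<in> {0..1/2}" using \<delta>(1) by (auto simp: h_def)
    have "c * h \<le> w (x + h *\<^sub>R (y - x))" using c(2) h(3) by blast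
    thus False using \<delta>(2)[OF h(1,2)] wt[of h] by linarith
  qed
  hence "d * (2 * R) > 0" using c(1) by (simp add: algebra_simps)
  hence "d > 0" using R by (simp add: zero_less_mult_iff)
  thus ?thesis using d unfolding e_def by blast
qed

end

section \<open>Radial profiles as a fixed point\<close>

lemma tail_integrable_bound:
  fixes g h :: "real \<Rightarrow> real"
  assumes "continuous_on {T..} g" "\<And>s. s \<ge> T \<Longrightarrow> \<bar>g s\<bar> \<le> h s" "h integrable_on {T..}"
  shows "g integrable_on {T..}"
proof (rule measurable_bounded_by_integrable_imp_integrable)
  show "g \<in> borel_measurable (lebesgue_on {T..})"
    by (rule continuous_imp_measurable_on_sets_lebesgue[OF assms(1)]) simp
qed (use assms in auto)

text \<open>Nonnegativity upgrades gauge integrability to absolute integrability, which passes to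
  measurable subsets.\<close>

lemma tail_integrable_subset:
  fixes g :: "real \<Rightarrow> real"
  assumes "g integrable_on {T..}" "\<And>s. s \<ge> T \<Longrightarrow> g s \<ge> 0" "T \<le> a"
  shows "g integrable_on {a..}"
proof -
  have "g absolutely_integrable_on {T..}"
    using assms(1,2) by (intro nonnegative_absolutely_integrable_1) auto
  hence "g absolutely_integrable_on {a..}" by (rule set_integrable_subset) (use assms(3) in auto)
  thus ?thesis using absolutely_integrable_on_def by blast
qed

lemma tail_integral_split:
  fixes g :: "real \<Rightarrow> real"
  assumes "g integrable_on {T..}" "\<And>s. s \<ge> T \<Longrightarrow> g s \<ge> 0" "T \<le> a" "a \<le> b"
  shows "integral {a..} g = integral {a..b} g + integral {b..} g"
proof -
  have i: "g integrable_on {a..}" by (rule tail_integrable_subset[OF assms(1-3)])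
  have "{a..} = {a..b} \<union> {b..}" using assms(4) by auto
  moreover have "g integrable_on {a..b}"
  proof (rule integrable_on_subinterval[OF i])
    show "{a..b} \<subseteq> {a..}" by auto
  qed
  moreover have "g integrable_on {b..}" by (rule tail_integrable_subset[OF assms(1,2)]) (use assms in auto)
  moreover have "{a..b} \<inter> {b..} = {b}" using assms(4) by auto
  ultimately show ?thesis using integral_Un[of g "{a..b}" "{b..}"] by simp
qed

lemma tail_integral_nonneg:
  fixes g :: "real \<Rightarrow> real"
  assumes "g integrable_on {T..}" "\<And>s. s \<ge> T \<Longrightarrow> g s \<ge> 0" "T \<le> a"
  shows "integral {a..} g \<ge> 0"
  using assms tail_integrable_subset[OF assms] by (intro integral_nonneg) auto

lemma tail_integral_mono:
  fixes g h :: "real \<Rightarrow> real"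
  assumes "g integrable_on {T..}" "h integrable_on {T..}" "T \<le> a"
    "\<And>s. s \<ge> T \<Longrightarrow> 0 \<le> g s" "\<And>s. s \<ge> T \<Longrightarrow> g s \<le> h s"
  shows "integral {a..} g \<le> integral {a..} h"
proof (rule integral_le)
  show "g integrable_on {a..}" by (rule tail_integrable_subset[OF assms(1,4,3)])
  have "0 \<le> h s" if "s \<ge> T" for s using assms(4,5)[OF that] by linarith
  thus "h integrable_on {a..}" by (rule tail_integrable_subset[OF assms(2) _ assms(3)])
qed (use assms in auto)

lemma tail_integral_antimono:
  fixes g :: "real \<Rightarrow> real"
  assumes "g integrable_on {T..}" "\<And>s. s \<ge> T \<Longrightarrow> g s \<ge> 0" "T \<le> a" "a \<le> b"
  shows "integral {b..} g \<le> integral {a..} g"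
proof -
  have "g integrable_on {a..b}"
    by (rule integrable_on_subinterval[OF tail_integrable_subset[OF assms(1-3)]]) auto
  hence "integral {a..b} g \<ge> 0" using assms by (intro integral_nonneg) auto
  thus ?thesis using tail_integral_split[OF assms] by simp
qed

lemma tail_integral_tendsto_0:
  fixes g :: "real \<Rightarrow> real"
  assumes g: "g integrable_on {T..}" "\<And>s. s \<ge> T \<Longrightarrow> g s \<ge> 0"
  shows "((\<lambda>a. integral {a..} g) \<longlongrightarrow> 0) at_top"
proof -
  have ai: "g absolutely_integrable_on {T..}"
    using g by (intro nonnegative_absolutely_integrable_1) auto
  have "((\<lambda>b. set_lebesgue_integral lebesgue {T..b} g) \<longlongrightarrow> set_lebesgue_integral lebesgue {T..} g) at_top"
    by (rule tendsto_set_lebesgue_integral_at_top[OF _ ai]) auto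
  moreover have "set_lebesgue_integral lebesgue {T..b} g = integral {T..b} g" for b
    by (rule set_lebesgue_integral_eq_integral(2)) (rule set_integrable_subset[OF ai], auto)
  moreover have "set_lebesgue_integral lebesgue {T..} g = integral {T..} g"
    by (rule set_lebesgue_integral_eq_integral(2)[OF ai])
  ultimately have "((\<lambda>b. integral {T..b} g) \<longlongrightarrow> integral {T..} g) at_top" by simp
  hence "((\<lambda>b. integral {T..} g - integral {T..b} g) \<longlongrightarrow> integral {T..} g - integral {T..} g) at_top"
    by (intro tendsto_intros)
  moreover have "\<forall>\<^sub>F b in at_top. integral {T..} g - integral {T..b} g = integral {b..} g"
    using eventually_ge_at_top[of T]
  proof eventually_elim
    case (elim b)
    thus ?case using tail_integral_split[OF g order_refl, of b] by simp
  qed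
  ultimately show ?thesis using tendsto_cong by force
qed

lemma continuous_on_indefinite_integral_ray:
  fixes g :: "real \<Rightarrow> real"
  assumes g: "continuous_on {T..} g"
  shows "continuous_on {T..} (\<lambda>a. integral {T..a} g)"
proof -
  have "continuous (at V within {T..}) (\<lambda>a. integral {T..a} g)" if V: "V \<ge> T" for V
  proof -
    have "continuous_on {T..V+1} g" by (rule continuous_on_subset[OF g]) auto
    hence "continuous_on {T..V+1} (\<lambda>a. integral {T..a} g)"
      by (intro indefinite_integral_continuous_1 integrable_continuous_real)
    hence "continuous (at V within {T..V+1}) (\<lambda>a. integral {T..a} g)"
      using V by (simp add: continuous_on_eq_continuous_within)
    moreover have "at V within {T..} = at V within {T..V+1}"
    proof (rule at_within_nhd[of V "{V-1<..<V+1}"])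
      show "{T..} \<inter> {V - 1<..<V + 1} - {V} = {T..V + 1} \<inter> {V - 1<..<V + 1} - {V}" by auto
    qed auto
    ultimately show ?thesis by simp
  qed
  thus ?thesis by (simp add: continuous_on_eq_continuous_within)
qed

lemma indefinite_integral_deriv_ray:
  fixes g :: "real \<Rightarrow> real"
  assumes g: "continuous_on {T..} g" and V: "V > T"
  shows "((\<lambda>a. integral {T..a} g) has_real_derivative g V) (at V)"
proof -
  have "continuous_on {T..V+1} g" by (rule continuous_on_subset[OF g(1)]) auto
  hence "((\<lambda>a. integral {T..a} g) has_real_derivative g V) (at V within {T..V+1})"
    by (rule integral_has_real_derivative) (use V in auto)
  hence "((\<lambda>a. integral {T..a} g) has_real_derivative g V) (at V within {T<..<V+1})"
    by (rule DERIV_subset) auto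
  thus ?thesis using V at_within_open[of V "{T<..<V+1}"] by simp
qed

lemma tail_integral_deriv:
  fixes g :: "real \<Rightarrow> real"
  assumes g: "continuous_on {T..} g" "g integrable_on {T..}" "\<And>s. s \<ge> T \<Longrightarrow> g s \<ge> 0" and V: "V > T"
  shows "((\<lambda>a. integral {a..} g) has_real_derivative - g V) (at V)"
proof -
  have "((\<lambda>a. integral {T..} g - integral {T..a} g) has_real_derivative 0 - g V) (at V)"
    by (intro DERIV_diff DERIV_const indefinite_integral_deriv_ray g V)
  hence d: "((\<lambda>a. integral {T..} g - integral {T..a} g) has_real_derivative - g V) (at V)" by simp
  have "\<forall>\<^sub>F a in nhds V. a > T" using V eventually_nhds_in_open[of "{T<..}" V] by simp
  hence "\<forall>\<^sub>F a in nhds V. integral {T..} g - integral {T..a} g = integral {a..} g"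
  proof eventually_elim
    case (elim a)
    thus ?case using tail_integral_split[OF g(2,3) order_refl, of a] by simp
  qed
  from DERIV_cong_ev[OF refl this refl] d show ?thesis by simp
qed

lemma tail_integral_continuous:
  fixes g :: "real \<Rightarrow> real"
  assumes g: "continuous_on {T..} g" "g integrable_on {T..}" "\<And>s. s \<ge> T \<Longrightarrow> g s \<ge> 0"
  shows "continuous_on {T..} (\<lambda>a. integral {a..} g)"
proof (rule continuous_on_eq)
  show "continuous_on {T..} (\<lambda>a. integral {T..} g - integral {T..a} g)"
    by (intro continuous_intros continuous_on_indefinite_integral_ray g)
  show "integral {T..} g - integral {T..x} g = integral {x..} g" if "x \<in> {T..}" for x
    using tail_integral_split[OF g(2,3) order_refl, of x] that by simp
qed

lemma sqrt2_bounds: "sqrt 2 \<le> 3/2" "4/3 \<le> sqrt 2"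
  by (rule real_le_lsqrt; simp add: power2_eq_square) (rule real_le_rsqrt; simp add: power2_eq_square)

text \<open>On \<open>{1/2..}\<close> the derivatives of \<open>sqrt\<close> and of
  \<open>1 / sqrt\<close> are at most \<open>1 / sqrt 2\<close> and \<open>sqrt 2\<close> in
  modulus; \<open>3/4\<close> and \<open>3/2\<close> are rational upper bounds.\<close>

lemma sqrt_half_lipschitz:
  assumes "1/2 \<le> h" "1/2 \<le> (k::real)"
  shows "\<bar>sqrt h - sqrt k\<bar> \<le> 3/4 * \<bar>h - k\<bar>"
    and "\<bar>1 / sqrt h - 1 / sqrt k\<bar> \<le> 3/2 * \<bar>h - k\<bar>"
proof -
  have s: "2/3 \<le> sqrt h" "2/3 \<le> sqrt k"
    by (rule real_le_rsqrt, use assms in \<open>simp add: power2_eq_square\<close>)+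
  have "\<bar>h - k\<bar> = \<bar>(sqrt h - sqrt k) * (sqrt h + sqrt k)\<bar>" using assms by (simp add: algebra_simps)
  also have "\<dots> = \<bar>sqrt h - sqrt k\<bar> * (sqrt h + sqrt k)" using s by (simp add: abs_mult)
  also have "\<dots> \<ge> \<bar>sqrt h - sqrt k\<bar> * (4/3)" using s by (intro mult_left_mono) auto
  finally show 1: "\<bar>sqrt h - sqrt k\<bar> \<le> 3/4 * \<bar>h - k\<bar>" by simp
  have p: "1/2 \<le> sqrt h * sqrt k"
  proof -
    have "(1/2)\<^sup>2 \<le> h * k" using mult_mono[OF assms] assms by (simp add: power2_eq_square)
    hence "1/2 \<le> sqrt (h * k)" by (rule real_le_rsqrt)
    thus ?thesis by (simp only: real_sqrt_mult)
  qed
  have "1 / sqrt h - 1 / sqrt k = (sqrt k - sqrt h) / (sqrt h * sqrt k)"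
    using s by (subst diff_frac_eq) auto
  hence "\<bar>1 / sqrt h - 1 / sqrt k\<bar> = \<bar>sqrt h - sqrt k\<bar> / (sqrt h * sqrt k)"
    using p by (simp add: abs_minus_commute)
  also have "\<dots> \<le> \<bar>sqrt h - sqrt k\<bar> / (1/2)" using p by (intro divide_left_mono) auto
  finally show "\<bar>1 / sqrt h - 1 / sqrt k\<bar> \<le> 3/2 * \<bar>h - k\<bar>" using 1 by simp
qed

section \<open>Construction of the energy by contraction\<close>

text \<open>\<open>E\<close> is the energy of the equation without its curvature term. The unknown
  is the ratio \<open>H = G / E\<close>, sought between \<open>1/2\<close> and 1; for a candidate
  ratio, \<open>speed\<close>, \<open>depth\<close> and \<open>drift\<close> are the radial
  derivative, the distance to the sphere and the curvature term divided by \<open>n\<close>.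
  \<open>E_grow\<close> keeps the accumulated curvature loss a small fraction of \<open>E\<close>,
  whatever the size of \<open>E T\<close>.\<close>

locale profile =
  fixes f E :: "real \<Rightarrow> real" and T n :: real
  assumes n: "n \<ge> 0"
    and E_deriv: "V > T \<Longrightarrow> (E has_real_derivative f V) (at V)"
    and E_cont: "continuous_on {T..} E"
    and E_T: "E T > 0"
    and E_mono: "T \<le> V \<Longrightarrow> V \<le> V' \<Longrightarrow> E V \<le> E V'"
    and E_grow: "T \<le> V \<Longrightarrow> 16 * (n + 1) * (V - T) \<le> sqrt (E V)"
    and E_int: "(\<lambda>s. 1 / sqrt (E s)) integrable_on {T..}"
begin

lemma E_pos: "T \<le> V \<Longrightarrow> E V > 0"
  using E_mono[of T V] E_T by simp

context
  fixes H :: "real \<Rightarrow> real"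
  assumes H_cont: "continuous_on UNIV H" and H_range: "\<And>s. 1/2 \<le> H s \<and> H s \<le> 1"
begin

text \<open>Truncating the radius at \<open>1/2\<close> makes the contraction factor independent of the size of \<open>E T\<close>.\<close>

definition speed where "speed s = sqrt (2 * (E s * H s))"
definition depth where "depth s = integral {s..} (\<lambda>s. 1 / speed s)"
definition drift where "drift s = speed s / max (1/2) (1 - depth s)"

lemma speed_bounds:
  assumes "T \<le> s"
  shows "sqrt (E s) \<le> speed s" "speed s \<le> 3/2 * sqrt (E s)" "0 < speed s"
    "1 / speed s \<le> 1 / sqrt (E s)" "2/3 * (1 / sqrt (E s)) \<le> 1 / speed s"
proof -
  have E: "0 < E s" by (rule E_pos[OF assms])
  have "E s * 1 \<le> E s * (2 * H s)" using E H_range[of s] by (intro mult_left_mono) auto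
  thus 1: "sqrt (E s) \<le> speed s" unfolding speed_def by (intro real_sqrt_le_mono) simp
  have "2 * (E s * H s) \<le> 2 * (E s * 1)" using E H_range[of s] by (intro mult_left_mono) auto
  hence "speed s \<le> sqrt (2 * E s)" unfolding speed_def by (intro real_sqrt_le_mono) simp
  also have "\<dots> \<le> 3/2 * sqrt (E s)" unfolding real_sqrt_mult using sqrt2_bounds E by (intro mult_right_mono) auto
  finally show 2: "speed s \<le> 3/2 * sqrt (E s)" .
  show 3: "0 < speed s" using 1 E by (meson less_le_trans real_sqrt_gt_zero)
  show "1 / speed s \<le> 1 / sqrt (E s)" using 1 E by (simp add: frac_le)
  have "1 / (3/2 * sqrt (E s)) \<le> 1 / speed s" using 2 3 by (intro divide_left_mono) (auto intro!: mult_pos_pos simp: E)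
  thus "2/3 * (1 / sqrt (E s)) \<le> 1 / speed s" by simp
qed

lemma speed_cont: "continuous_on {T..} speed"
  unfolding speed_def by (intro continuous_intros E_cont continuous_on_subset[OF H_cont]) auto

lemma inv_speed_cont: "continuous_on {T..} (\<lambda>s. 1 / speed s)"
  using speed_bounds(3) by (intro continuous_intros speed_cont) force

lemma inv_speed_int: "(\<lambda>s. 1 / speed s) integrable_on {T..}"
  by (rule tail_integrable_bound[OF inv_speed_cont _ E_int]) (use speed_bounds in \<open>auto simp: less_imp_le\<close>)

lemma inv_speed_nonneg: "T \<le> s \<Longrightarrow> 0 \<le> 1 / speed s"
  using speed_bounds(3)[of s] by simp

lemma depth_cont: "continuous_on {T..} depth"
  unfolding depth_def by (rule tail_integral_continuous[OF inv_speed_cont inv_speed_int inv_speed_nonneg])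

lemma drift_cont: "continuous_on {T..} drift"
  unfolding drift_def by (intro continuous_intros speed_cont depth_cont) auto

lemma drift_bounds:
  assumes "T \<le> s"
  shows "0 \<le> drift s" "drift s \<le> 3 * sqrt (E s)"
proof -
  have m: "1/2 \<le> max (1/2) (1 - depth s)" by simp
  show "0 \<le> drift s" unfolding drift_def using speed_bounds(3)[OF assms] m
    by (intro divide_nonneg_nonneg) auto
  have "drift s \<le> speed s / (1/2)" unfolding drift_def using speed_bounds(3)[OF assms] m
    by (intro divide_left_mono) auto
  thus "drift s \<le> 3 * sqrt (E s)" using speed_bounds(2)[OF assms] by simp
qed

lemma drift_integral_bounds:
  assumes "T \<le> V"
  shows "0 \<le> integral {T..V} drift" "integral {T..V} drift \<le> 3 * sqrt (E V) * (V - T)"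
proof -
  have i: "drift integrable_on {T..V}"
    by (intro integrable_continuous_real continuous_on_subset[OF drift_cont]) auto
  show "0 \<le> integral {T..V} drift" using i drift_bounds by (intro integral_nonneg) auto
  have le: "integral {T..V} drift \<le> integral {T..V} (\<lambda>_. 3 * sqrt (E V))"
  proof (rule integral_le[OF i])
    fix s assume s: "s \<in> {T..V}"
    have "drift s \<le> 3 * sqrt (E s)" using drift_bounds s by simp
    also have "\<dots> \<le> 3 * sqrt (E V)" using s E_mono[of s V] by simp
    finally show "drift s \<le> 3 * sqrt (E V)" .
  qed (rule integrable_const_ivl)
  have const: "integral {T..V} (\<lambda>_. c) = c * (V - T)" for c :: real using assms by simp
  show "integral {T..V} drift \<le> 3 * sqrt (E V) * (V - T)" using le unfolding const .
qed

text \<open>The integrated equation \<open>G = E - n * integral {T..V} drift\<close>, divided by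
  \<open>E\<close>. Freezing the argument at \<open>T\<close> extends the ratio to the whole line as
  a bounded continuous function, an element of a complete space.\<close>

definition next_ratio where
  "next_ratio V = 1 - n * integral {T..max T V} drift / E (max T V)"

text \<open>The loss is at most \<open>3/16\<close> of \<open>E\<close>: the drift is bounded by
  \<open>3 * sqrt (E v)\<close>, and by \<open>E_grow\<close> the factor
  \<open>(n + 1) * (v - T)\<close> is at most \<open>sqrt (E v) / 16\<close>.\<close>

lemma next_ratio_range: "1/2 \<le> next_ratio V \<and> next_ratio V \<le> 1"
proof -
  define v where "v = max T V"
  have v: "T \<le> v" by (simp add: v_def)
  note E = E_pos[OF v]
  have "n * integral {T..v} drift \<le> n * (3 * sqrt (E v) * (v - T))"
    using drift_integral_bounds[OF v] n by (intro mult_left_mono)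
  also have "\<dots> \<le> (n + 1) * (3 * sqrt (E v) * (v - T))" using E v by (intro mult_right_mono) auto
  also have "\<dots> = 3/16 * sqrt (E v) * (16 * (n + 1) * (v - T))" by simp
  also have "\<dots> \<le> 3/16 * sqrt (E v) * sqrt (E v)" using E_grow[OF v] E by (intro mult_left_mono) auto
  also have "\<dots> = 3/16 * E v" using E by simp
  finally have "n * integral {T..v} drift / E v \<le> 3/16" using E by (simp add: divide_le_eq)
  moreover have "0 \<le> n * integral {T..v} drift / E v" using drift_integral_bounds[OF v] n E by simp
  ultimately show ?thesis unfolding next_ratio_def v_def[symmetric] by linarith
qed

lemma next_ratio_cont: "continuous_on UNIV next_ratio"
proof -
  have c: "continuous_on {T..} (\<lambda>v. 1 - n * integral {T..v} drift / E v)"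
    using E_pos by (intro continuous_intros continuous_on_indefinite_integral_ray drift_cont E_cont) force
  have "continuous_on UNIV (\<lambda>V. (\<lambda>v. 1 - n * integral {T..v} drift / E v) (max T V))"
    by (rule continuous_on_compose2[OF c]) (auto intro!: continuous_intros)
  thus ?thesis unfolding next_ratio_def .
qed

end

text \<open>The drift depends on \<open>H\<close> locally through the speed and through a whole tail
  integral in the depth; both changes are multiples of \<open>\<delta>\<close> with universal
  constants. They sum up to \<open>33/4\<close>, rounded to 9, so that division by the 16 of
  \<open>E_grow\<close> leaves the contraction factor \<open>9/16\<close>.\<close>

lemma drift_diff:
  assumes H: "continuous_on UNIV H" "\<And>s. 1/2 \<le> H s \<and> H s \<le> 1"
    and K: "continuous_on UNIV K" "\<And>s. 1/2 \<le> K s \<and> K s \<le> 1"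
    and d: "\<And>s. \<bar>H s - K s\<bar> \<le> \<delta>" and s: "T \<le> s"
  shows "\<bar>drift H s - drift K s\<bar> \<le> 9 * sqrt (E s) * \<delta>"
proof -
  have E: "E v > 0" if "T \<le> v" for v by (rule E_pos[OF that])
  have \<delta>: "\<delta> \<ge> 0" using d[of 0] by linarith
  have sp: "speed H v = sqrt 2 * sqrt (E v) * sqrt (H v)" "speed K v = sqrt 2 * sqrt (E v) * sqrt (K v)" for v
    by (simp_all add: speed_def[OF H] speed_def[OF K] real_sqrt_mult)
  have dsp: "\<bar>speed H v - speed K v\<bar> \<le> 9/8 * sqrt (E v) * \<delta>" if "T \<le> v" for v
  proof -
    have "\<bar>speed H v - speed K v\<bar> = sqrt 2 * sqrt (E v) * \<bar>sqrt (H v) - sqrt (K v)\<bar>"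
      unfolding sp right_diff_distrib[symmetric] using E[OF that] by (simp add: abs_mult)
    also have "\<dots> \<le> 3/2 * sqrt (E v) * (3/4 * \<delta>)"
      using sqrt_half_lipschitz(1)[of "H v" "K v"] H(2)[of v] K(2)[of v] d[of v] E[OF that] sqrt2_bounds
      by (intro mult_mono) auto
    finally show ?thesis by simp
  qed
  have dis: "\<bar>1 / speed H v - 1 / speed K v\<bar> \<le> 9/8 * \<delta> * (1 / sqrt (E v))" if "T \<le> v" for v
  proof -
    have "1 / speed H v - 1 / speed K v = 1 / sqrt 2 * (1 / sqrt (E v)) * (1 / sqrt (H v) - 1 / sqrt (K v))"
      unfolding sp by (simp add: right_diff_distrib)
    hence "\<bar>1 / speed H v - 1 / speed K v\<bar> = 1 / sqrt 2 * (1 / sqrt (E v)) * \<bar>1 / sqrt (H v) - 1 / sqrt (K v)\<bar>"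
      using E[OF that] by (simp add: abs_mult)
    also have "\<dots> \<le> 3/4 * (1 / sqrt (E v)) * (3/2 * \<delta>)"
    proof (intro mult_mono)
      have "1 / sqrt 2 \<le> 1 / (4/3)" using sqrt2_bounds by (intro divide_left_mono) auto
      thus "1 / sqrt 2 \<le> 3/4" by simp
      show "\<bar>1 / sqrt (H v) - 1 / sqrt (K v)\<bar> \<le> 3/2 * \<delta>"
        using sqrt_half_lipschitz(2)[of "H v" "K v"] H(2)[of v] K(2)[of v] d[of v] by auto
    qed (use E[OF that] in auto)
    finally show ?thesis by (simp add: mult_ac)
  qed
  define e where "e = integral {s..} (\<lambda>v. 1 / sqrt (E v))"
  have En: "0 \<le> 1 / sqrt (E v)" if "T \<le> v" for v using E[OF that] by simp
  have Ei: "(\<lambda>v. 1 / sqrt (E v)) integrable_on {s..}"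
    by (rule tail_integrable_subset[OF E_int En s])
  have iH: "(\<lambda>v. 1 / speed H v) integrable_on {s..}"
    by (rule tail_integrable_subset[OF inv_speed_int[OF H] inv_speed_nonneg[OF H] s])
  have iK: "(\<lambda>v. 1 / speed K v) integrable_on {s..}"
    by (rule tail_integrable_subset[OF inv_speed_int[OF K] inv_speed_nonneg[OF K] s])
  have dd: "\<bar>depth H s - depth K s\<bar> \<le> 9/8 * \<delta> * e"
  proof -
    have "depth H s - depth K s = integral {s..} (\<lambda>v. 1 / speed H v - 1 / speed K v)"
      unfolding depth_def[OF H] depth_def[OF K] by (rule integral_diff[OF iH iK, symmetric])
    also have "norm \<dots> \<le> integral {s..} (\<lambda>v. 9/8 * \<delta> * (1 / sqrt (E v)))"
    proof (rule integral_norm_bound_integral)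
      show "(\<lambda>v. 1 / speed H v - 1 / speed K v) integrable_on {s..}" by (rule integrable_diff[OF iH iK])
      show "(\<lambda>v. 9/8 * \<delta> * (1 / sqrt (E v))) integrable_on {s..}" using Ei by (intro integrable_on_mult_right)
    qed (use dis s in auto)
    also have "\<dots> = 9/8 * \<delta> * e" unfolding e_def by (rule integral_mult_right)
    finally show ?thesis by simp
  qed
  have e_le: "2/3 * e \<le> depth L s"
    if L: "continuous_on UNIV L" "\<And>s. 1/2 \<le> L s \<and> L s \<le> 1" for L
  proof -
    have "2/3 * e = integral {s..} (\<lambda>v. 2/3 * (1 / sqrt (E v)))" unfolding e_def by (rule integral_mult_right[symmetric])
    also have "\<dots> \<le> depth L s" unfolding depth_def[OF L]
    proof (rule integral_le)
      show "(\<lambda>v. 1 / speed L v) integrable_on {s..}"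
        by (rule tail_integrable_subset[OF inv_speed_int[OF L] inv_speed_nonneg[OF L] s])
      show "(\<lambda>v. 2/3 * (1 / sqrt (E v))) integrable_on {s..}" using Ei by (intro integrable_on_mult_right)
    qed (use speed_bounds(5)[OF L] s in auto)
    finally show ?thesis .
  qed
  define r where "r = max (1/2) (1 - depth H s)"
  define r' where "r' = max (1/2) (1 - depth K s)"
  \<comment> \<open>\<open>e\<close> itself has no a priori bound. If both depths are at least
    \<open>1/2\<close>, truncation makes the two radii equal; otherwise \<open>e \<le> 3/4\<close>,
    and \<open>9/8 * 3/4 < 1\<close>.\<close>
  have dr: "\<bar>r - r'\<bar> \<le> \<delta>"
  proof (cases "depth H s \<ge> 1/2 \<and> depth K s \<ge> 1/2")
    case True
    thus ?thesis using \<delta> by (simp add: r_def r'_def)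
  next
    case False
    hence "e \<le> 3/4" using e_le[OF H] e_le[OF K] by auto
    hence "9/8 * \<delta> * e \<le> 9/8 * \<delta> * (3/4)" using \<delta> by (intro mult_left_mono) auto
    hence "\<bar>depth H s - depth K s\<bar> \<le> \<delta>" using dd \<delta> by linarith
    thus ?thesis by (auto simp: r_def r'_def max_def)
  qed
  have rr: "1/2 \<le> r" "1/2 \<le> r'" by (auto simp: r_def r'_def)
  have "drift H s - drift K s = (speed H s - speed K s) / r + speed K s * (r' - r) / (r * r')"
    unfolding drift_def[OF H] drift_def[OF K] r_def[symmetric] r'_def[symmetric] using rr
    by (simp add: field_simps)
  hence "\<bar>drift H s - drift K s\<bar> \<le> \<bar>speed H s - speed K s\<bar> / r + speed K s * \<bar>r' - r\<bar> / (r * r')"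
    using rr speed_bounds(3)[OF K s] abs_triangle_ineq[of "(speed H s - speed K s) / r" "speed K s * (r' - r) / (r * r')"]
    by (simp add: abs_mult)
  also have "\<dots> \<le> (9/8 * sqrt (E s) * \<delta>) / (1/2) + (3/2 * sqrt (E s)) * \<delta> / ((1/2) * (1/2))"
  proof (intro add_mono frac_le mult_mono)
    show "\<bar>r' - r\<bar> \<le> \<delta>" using dr by (simp add: abs_minus_commute)
  qed (use rr dsp[OF s] speed_bounds(2,3)[OF K s] E[OF s] \<delta> in \<open>auto intro!: mult_nonneg_nonneg\<close>)
  also have "\<dots> = 33/4 * (sqrt (E s) * \<delta>)" by simp
  also have "\<dots> \<le> 9 * (sqrt (E s) * \<delta>)" using \<delta> E[OF s] by (intro mult_right_mono) auto
  finally show ?thesis by simp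
qed

text \<open>Banach's fixed point theorem on the bounded continuous functions with values in
  \<open>{1/2..1}\<close>. The bounds \<open>E / 2 \<le> G \<le> E\<close> transfer estimates for
  \<open>E\<close> to the solution up to constants.\<close>

theorem profile_exists:
  obtains G where "continuous_on {T..} G" "\<And>V. T \<le> V \<Longrightarrow> E V / 2 \<le> G V" "\<And>V. T \<le> V \<Longrightarrow> G V \<le> E V"
    "G T = E T" "\<And>V. T < V \<Longrightarrow> (G has_real_derivative
       f V - n * sqrt (2 * G V) / max (1/2) (1 - integral {V..} (\<lambda>s. 1 / sqrt (2 * G s)))) (at V)"
proof -
  define S where "S = {H :: real \<Rightarrow>\<^sub>C real. \<forall>s. 1/2 \<le> H s \<and> H s \<le> 1}"
  define \<Phi> where "\<Phi> = (\<lambda>H :: real \<Rightarrow>\<^sub>C real. Bcontfun (next_ratio (apply_bcontfun H)))"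
  have SD: "continuous_on UNIV (apply_bcontfun H)" "\<And>s. 1/2 \<le> H s \<and> H s \<le> 1" if "H \<in> S" for H
    using that by (auto simp: S_def)
  have app: "apply_bcontfun (\<Phi> H) = next_ratio (apply_bcontfun H)" if "H \<in> S" for H
  proof -
    have "bounded (range (next_ratio (apply_bcontfun H)))"
      unfolding bounded_iff
    proof (intro exI[of _ 1] ballI)
      fix y assume "y \<in> range (next_ratio (apply_bcontfun H))"
      then obtain x where "y = next_ratio (apply_bcontfun H) x" by blast
      thus "norm y \<le> 1" using next_ratio_range[OF SD[OF that], of x] by simp
    qed
    hence "next_ratio (apply_bcontfun H) \<in> bcontfun"
      using next_ratio_cont[OF SD[OF that]] by (simp add: bcontfun_def)
    thus ?thesis unfolding \<Phi>_def by (rule Bcontfun_inverse)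
  qed
  have "closed S"
  proof -
    have "closed {H :: real \<Rightarrow>\<^sub>C real. H s \<in> {1/2..1}}" for s
    proof -
      have "continuous_on UNIV (\<lambda>H :: real \<Rightarrow>\<^sub>C real. H s)"
        by (rule continuous_onI) (meson dist_fun_lt_imp_dist_val_lt order.strict_implies_order)
      hence "closed ((\<lambda>H :: real \<Rightarrow>\<^sub>C real. H s) -` {1/2..1})"
        by (intro continuous_closed_vimage closed_atLeastAtMost) (simp add: continuous_on_eq_continuous_at)
      thus ?thesis by (simp add: vimage_def)
    qed
    moreover have "S = (\<Inter>s. {H :: real \<Rightarrow>\<^sub>C real. H s \<in> {1/2..1}})" by (auto simp: S_def)
    ultimately show ?thesis by auto
  qed
  hence cS: "complete S" by (simp add: complete_eq_closed)
  have "const_bcontfun 1 \<in> S" by (simp add: S_def const_bcontfun.rep_eq)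
  hence ne: "S \<noteq> {}" by blast
  have "\<exists>!H\<in>S. \<Phi> H = H"
  proof (rule Banach_fix[OF cS ne, of "9/16"])
    show "\<Phi> ` S \<subseteq> S" using app next_ratio_range[OF SD] by (auto simp: S_def)
    fix H K assume HK: "H \<in> S" "K \<in> S"
    define \<delta> where "\<delta> = dist H K"
    have d: "\<bar>H s - K s\<bar> \<le> \<delta>" for s using dist_bounded[of H s K] by (simp add: \<delta>_def dist_real_def)
    show "dist (\<Phi> H) (\<Phi> K) \<le> 9/16 * dist H K"
    proof (rule dist_bound)
      fix V :: real
      define v where "v = max T V"
      have v: "T \<le> v" by (simp add: v_def)
      note E = E_pos[OF v]
      have i: "drift (apply_bcontfun H) integrable_on {T..v}" "drift (apply_bcontfun K) integrable_on {T..v}"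
        by (intro integrable_continuous_real continuous_on_subset[OF drift_cont[OF SD[OF HK(1)]]]
          continuous_on_subset[OF drift_cont[OF SD[OF HK(2)]]]; auto)+
      have "norm (integral {T..v} (\<lambda>s. drift (apply_bcontfun H) s - drift (apply_bcontfun K) s)) \<le> integral {T..v} (\<lambda>_. 9 * sqrt (E v) * \<delta>)"
      proof (rule integral_norm_bound_integral)
        show "(\<lambda>s. drift (apply_bcontfun H) s - drift (apply_bcontfun K) s) integrable_on {T..v}" by (rule integrable_diff[OF i])
        fix s assume s: "s \<in> {T..v}"
        have "norm (drift (apply_bcontfun H) s - drift (apply_bcontfun K) s) \<le> 9 * sqrt (E s) * \<delta>"
          using drift_diff[OF SD[OF HK(1)] SD[OF HK(2)] d, of s] s by simp
        also have "\<dots> \<le> 9 * sqrt (E v) * \<delta>" using s E_mono[of s v] by (intro mult_right_mono) (auto simp: \<delta>_def)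
        finally show "norm (drift (apply_bcontfun H) s - drift (apply_bcontfun K) s) \<le> 9 * sqrt (E v) * \<delta>" .
      qed (rule integrable_const_ivl)
      also have "\<dots> = 9 * sqrt (E v) * \<delta> * (v - T)" using v by simp
      finally have I: "\<bar>integral {T..v} (drift (apply_bcontfun H)) - integral {T..v} (drift (apply_bcontfun K))\<bar> \<le> 9 * sqrt (E v) * \<delta> * (v - T)"
        using integral_diff[OF i] by simp
      have "dist (\<Phi> H V) (\<Phi> K V) = \<bar>n * (integral {T..v} (drift (apply_bcontfun H)) - integral {T..v} (drift (apply_bcontfun K))) / E v\<bar>"
        unfolding app[OF HK(1)] app[OF HK(2)] next_ratio_def[OF SD[OF HK(1)]] next_ratio_def[OF SD[OF HK(2)]] v_def dist_real_def
        by (simp add: right_diff_distrib diff_divide_distrib abs_minus_commute)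
      also have "\<dots> = n * \<bar>integral {T..v} (drift (apply_bcontfun H)) - integral {T..v} (drift (apply_bcontfun K))\<bar> / E v"
        using n E by (simp add: abs_mult)
      also have "\<dots> \<le> (n + 1) * (9 * sqrt (E v) * \<delta> * (v - T)) / E v"
        using I n E by (intro divide_right_mono mult_mono) auto
      also have "\<dots> = 9/16 * \<delta> * sqrt (E v) * (16 * (n + 1) * (v - T)) / E v"
        by (rule arg_cong[where f="\<lambda>z. z / E v"]) algebra
      also have "\<dots> \<le> 9/16 * \<delta> * sqrt (E v) * sqrt (E v) / E v"
        using E_grow[OF v] E by (intro divide_right_mono mult_left_mono) (auto simp: \<delta>_def)
      also have "\<dots> = 9/16 * dist H K" using E by (simp add: \<delta>_def)
      finally show "dist (\<Phi> H V) (\<Phi> K V) \<le> 9/16 * dist H K" .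
    qed
  qed auto
  then obtain H where H: "H \<in> S" "\<Phi> H = H" by blast
  note HD = SD[OF H(1)]
  define G where "G = (\<lambda>V. E V * H V)"
  have eqH: "H V = next_ratio (apply_bcontfun H) V" for V using app[OF H(1)] H(2) by metis
  have G: "G V = E V - n * integral {T..V} (drift (apply_bcontfun H))" if "T \<le> V" for V
  proof -
    have "G V = E V * next_ratio (apply_bcontfun H) V" unfolding G_def using eqH[of V] by simp
    thus ?thesis unfolding next_ratio_def[OF HD] using that E_pos[OF that] by (simp add: max_def right_diff_distrib)
  qed
  show ?thesis
  proof (rule that)
    show "continuous_on {T..} G" unfolding G_def by (intro continuous_intros E_cont continuous_on_apply_bcontfun)
    show "E V / 2 \<le> G V" "G V \<le> E V" if "T \<le> V" for V
      unfolding G_def using HD(2)[of V] E_pos[OF that] mult_left_mono[of "1/2" "H V" "E V"] mult_left_mono[of "H V" 1 "E V"] by auto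
    show "G T = E T" using G[of T] by simp
    fix V assume V: "T < V"
    have "((\<lambda>V. E V - n * integral {T..V} (drift (apply_bcontfun H))) has_real_derivative f V - n * drift (apply_bcontfun H) V) (at V)"
      by (intro DERIV_diff E_deriv[OF V] DERIV_cmult indefinite_integral_deriv_ray[OF drift_cont[OF HD] V])
    note der = this
    have "\<forall>\<^sub>F v in nhds V. E v - n * integral {T..v} (drift (apply_bcontfun H)) = G v"
      using eventually_nhds_in_open[of "{T<..}" V] V by (auto elim!: eventually_mono simp: G)
    from DERIV_cong_ev[OF refl this refl] der
    have "(G has_real_derivative f V - n * drift (apply_bcontfun H) V) (at V)" by blast
    moreover have "n * drift (apply_bcontfun H) V = n * sqrt (2 * G V) / max (1/2) (1 - integral {V..} (\<lambda>s. 1 / sqrt (2 * G s)))"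
      unfolding drift_def[OF HD] depth_def[OF HD] speed_def[OF HD] G_def by simp
    ultimately show "(G has_real_derivative f V - n * sqrt (2 * G V) / max (1/2) (1 - integral {V..} (\<lambda>s. 1 / sqrt (2 * G s)))) (at V)"
      by simp
  qed
qed

end

section \<open>Comparison with radial profiles\<close>

locale radial_profile =
  fixes f G :: "real \<Rightarrow> real" and T n :: real
  assumes G_cont: "continuous_on {T..} G"
    and G_pos: "T \<le> V \<Longrightarrow> 0 < G V"
    and G_int: "(\<lambda>s. 1 / sqrt (2 * G s)) integrable_on {T..}"
    and G_deriv: "T < V \<Longrightarrow> (G has_real_derivative
       f V - n * sqrt (2 * G V) / max (1/2) (1 - integral {V..} (\<lambda>s. 1 / sqrt (2 * G s)))) (at V)"
begin

definition D where "D V = integral {V..} (\<lambda>s. 1 / sqrt (2 * G s))"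

definition slope where "slope V = f V - n * sqrt (2 * G V) / max (1/2) (1 - D V)"

lemma G_slope: "T < V \<Longrightarrow> (G has_real_derivative slope V) (at V)"
  using G_deriv unfolding slope_def D_def .

lemma integrand_cont: "continuous_on {T..} (\<lambda>s. 1 / sqrt (2 * G s))"
  using G_pos by (intro continuous_intros G_cont) force

lemma integrand_pos: "T \<le> s \<Longrightarrow> 0 < 1 / sqrt (2 * G s)"
  using G_pos by simp

lemma integrand_nonneg: "T \<le> s \<Longrightarrow> 0 \<le> 1 / sqrt (2 * G s)"
  using integrand_pos by (simp add: less_imp_le)

lemma D_nonneg: "T \<le> V \<Longrightarrow> 0 \<le> D V"
  unfolding D_def by (rule tail_integral_nonneg[OF G_int integrand_nonneg])

lemma D_antimono: "T \<le> V \<Longrightarrow> V \<le> V' \<Longrightarrow> D V' \<le> D V"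
  unfolding D_def by (rule tail_integral_antimono[OF G_int integrand_nonneg])

lemma D_split: "T \<le> V \<Longrightarrow> V \<le> V' \<Longrightarrow> D V = integral {V..V'} (\<lambda>s. 1 / sqrt (2 * G s)) + D V'"
  unfolding D_def by (rule tail_integral_split[OF G_int integrand_nonneg])

lemma D_tendsto: "(D \<longlongrightarrow> 0) at_top"
  unfolding D_def by (rule tail_integral_tendsto_0[OF G_int integrand_nonneg])

lemma D_cont: "continuous_on {T..} D"
  unfolding D_def by (rule tail_integral_continuous[OF integrand_cont G_int integrand_nonneg])

lemma D_deriv: "T < V \<Longrightarrow> (D has_real_derivative - (1 / sqrt (2 * G V))) (at V)"
  unfolding D_def by (rule tail_integral_deriv[OF integrand_cont G_int integrand_nonneg])

lemma D_deriv2: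
  assumes V: "T < V"
  shows "((\<lambda>V. - (1 / sqrt (2 * G V))) has_real_derivative slope V / (2 * G V * sqrt (2 * G V))) (at V)"
proof -
  have G: "G V > 0" using G_pos V by simp
  have s: "sqrt (2 * G V) > 0" "sqrt (2 * G V) * sqrt (2 * G V) = 2 * G V" using G by auto
  have "((\<lambda>V. sqrt (2 * G V)) has_real_derivative inverse (sqrt (2 * G V)) / 2 * (2 * slope V)) (at V)"
    using G by (intro DERIV_chain2[OF DERIV_real_sqrt] DERIV_cmult G_slope V) simp
  from DERIV_inverse'[OF this] s(1)
  have "((\<lambda>V. inverse (sqrt (2 * G V))) has_real_derivative
     - (inverse (sqrt (2 * G V)) * (inverse (sqrt (2 * G V)) / 2 * (2 * slope V)) * inverse (sqrt (2 * G V)))) (at V)"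
    by simp
  hence "((\<lambda>V. - (1 / sqrt (2 * G V))) has_real_derivative
     - (- (inverse (sqrt (2 * G V)) * (inverse (sqrt (2 * G V)) / 2 * (2 * slope V)) * inverse (sqrt (2 * G V))))) (at V)"
    unfolding inverse_eq_divide[symmetric] by (rule DERIV_minus)
  moreover have "- (- (inverse (sqrt (2 * G V)) * (inverse (sqrt (2 * G V)) / 2 * (2 * slope V)) * inverse (sqrt (2 * G V))))
      = slope V / (2 * G V * sqrt (2 * G V))"
  proof -
    have "- (- (inverse x * (inverse x / 2 * (2 * z)) * inverse x)) = z / (x * x * x)" if "x > 0" for x z :: real
      using that by (simp add: field_simps)
    from this[OF s(1), of "slope V"] show ?thesis by (simp only: s(2))
  qed
  ultimately show ?thesis by (rule DERIV_cong)
qed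

end

context large_solution
begin

text \<open>Strict growth of the spherical maximum of \<open>u\<close> at its first contact with the level \<open>T\<close> leaves room for
  a profile that starts there with positive but small energy.\<close>

lemma boundary_slope:
  assumes a: "\<And>t. a < t \<Longrightarrow> 0 \<le> f t" "a < T"
    and r0: "r0 = 1 - 1 / (16 * real DIM('a))" and U0: "\<And>x. norm x = r0 \<Longrightarrow> u x \<le> U0" "U0 < T"
    and x1: "norm x1 = r1" "u x1 = T" "r0 < r1" "r1 < 1"
  obtains \<sigma> where "\<sigma> > 0" "\<And>r. r1 < r \<Longrightarrow> r < 1 \<Longrightarrow> \<exists>x. norm x = r \<and> T + \<sigma> * (r - r1) \<le> u x"
proof -
  define N where "N = real DIM('a)"
  have N: "N \<ge> 1" using DIM_ge_Suc0[where 'a='a] unfolding N_def by linarith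
  define \<delta> where "\<delta> = 1 / (16 * N)"
  have \<delta>: "0 < \<delta>" "\<delta> \<le> 1/16" "N * \<delta> = 1/16" using N by (auto simp: \<delta>_def field_simps)
  have r0': "r0 = 1 - \<delta>" by (simp add: r0 \<delta>_def N_def)
  \<comment> \<open>A maximum point of \<open>u - \<sigma> * h\<close> has value at least
    \<open>T - \<sigma>\<close>: this lies above \<open>U0\<close>, which excludes the inner sphere,
    and above \<open>a\<close>, so that \<open>f\<close> is nonnegative there.\<close>
  define \<sigma> where "\<sigma> = min (T - U0) (T - a) / 2"
  have \<sigma>: "\<sigma> > 0" "\<sigma> < T - U0" "\<sigma> < T - a" using U0(2) a(2) by (auto simp: \<sigma>_def)
  \<comment> \<open>A radial function with difference quotients at least \<open>7/8\<close> in the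
    shell and with negative Laplacian: \<open>- 2 * N\<close> outweighs the curvature term, which is
    at most \<open>2 * (N - 1)\<close> for radii above \<open>1/2\<close>. Where
    \<open>f \<ge> 0\<close>, \<open>u - \<sigma> * h\<close> therefore has no interior
    maximum.\<close>
  define h where "h = (\<lambda>r. (r - r0) - N * (r - r0)\<^sup>2)"
  have hbound: "0 \<le> h r \<and> h r \<le> 1" if "r0 \<le> r" "r \<le> 1" for r
  proof -
    define e where "e = r - r0"
    have e: "0 \<le> e" "e \<le> \<delta>" using that r0' by (auto simp: e_def)
    have "N * e \<le> N * \<delta>" using e N by (intro mult_left_mono) auto
    hence "e * (N * e) \<le> e * 1" using e \<delta> by (intro mult_left_mono) auto
    moreover have "0 \<le> e * (N * e)" using N e by simp
    ultimately show ?thesis unfolding h_def e_def[symmetric] using e \<delta> by (auto simp: power2_eq_square mult_ac)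
  qed
  have hinc: "h r - h r1 \<ge> 7/8 * (r - r1)" if "r1 < r" "r < 1" for r
  proof -
    have "N * ((r - r0) + (r1 - r0)) \<le> N * (2 * \<delta>)" using that x1 N r0' by (intro mult_left_mono) auto
    hence "(r - r1) * (1 - N * ((r - r0) + (r1 - r0))) \<ge> (r - r1) * (7/8)"
      using that \<delta>(3) by (intro mult_left_mono) auto
    thus ?thesis by (simp add: h_def power2_eq_square algebra_simps)
  qed
  have main: "\<exists>x. norm x = r \<and> T + \<sigma> * (h r - h r1) \<le> u x" if r: "r1 < r" "r < 1" for r
  proof (rule ccontr)
    assume "\<not> ?thesis"
    hence no: "u x < T + \<sigma> * (h r - h r1)" if "norm x = r" for x using that by force
    define K where "K = cball (0::'a) r - ball 0 r0"
    have Kb: "K \<subseteq> ball 0 1" using r by (auto simp: K_def)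
    have "compact K" unfolding K_def by (intro compact_diff) auto
    moreover have "continuous_on K (\<lambda>x. u x - \<sigma> * h (norm x))"
      unfolding h_def by (intro continuous_intros u_cont Kb)
    moreover have x1K: "x1 \<in> K" using x1 r by (auto simp: K_def)
    ultimately obtain y where y: "y \<in> K" "\<And>x. x \<in> K \<Longrightarrow> u x - \<sigma> * h (norm x) \<le> u y - \<sigma> * h (norm y)"
      using continuous_attains_sup[of K "\<lambda>x. u x - \<sigma> * h (norm x)"] by blast
    have val: "T - \<sigma> * h r1 \<le> u y - \<sigma> * h (norm y)" using y(2)[OF x1K] x1 by simp
    have yn: "r0 \<le> norm y" "norm y \<le> r" using y(1) by (auto simp: K_def)
    have h1: "0 \<le> h r1" "\<sigma> * h r1 \<le> \<sigma>" using hbound[of r1] x1 \<sigma> by (auto simp: mult_left_le)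
    have hy: "0 \<le> \<sigma> * h (norm y)" using hbound[of "norm y"] yn r \<sigma> by simp
    have "norm y \<noteq> r" using no[of y] val by (auto simp: algebra_simps)
    moreover have "norm y \<noteq> r0"
    proof
      assume "norm y = r0"
      hence "u y \<le> U0" by (rule U0(1))
      thus False using val h1 hy \<sigma>(2) by linarith
    qed
    ultimately have yn': "r0 < norm y" "norm y < r" using yn by auto
    have y0: "y \<noteq> 0" "1/2 \<le> norm y" "norm y < 1" using yn' r0' \<delta> r by auto
    have "\<forall>\<^sub>F z in nhds y. z \<in> ball 0 r - cball 0 r0"
      using yn' by (intro eventually_nhds_in_open) auto
    hence ev: "\<forall>\<^sub>F z in nhds y. u z - \<sigma> * h (norm z) \<le> u y - \<sigma> * h (norm y)"
      by eventually_elim (auto intro!: y(2) simp: K_def)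
    obtain p q where pq: "jet_at u y p q" "sum q Basis = f (u y)" using u_jet[of y] y0 by auto
    have d2: "((\<lambda>z. 1 - 2 * N * (z - r0)) has_real_derivative - 2 * N) (at (norm y))"
      by (auto intro!: derivative_eq_intros)
    have d1: "\<forall>\<^sub>F z in nhds (norm y). (h has_real_derivative 1 - 2 * N * (z - r0)) (at z)"
      unfolding h_def by (auto intro!: derivative_eq_intros always_eventually)
    obtain q' where q': "jet_at (\<lambda>y. h (norm y)) y (\<lambda>i. (1 - 2 * N * (norm y - r0)) * ((y \<bullet> i) / norm y)) q'"
        "sum q' Basis = - 2 * N + (real DIM('a) - 1) / norm y * (1 - 2 * N * (norm y - r0))"
      by (rule jet_at_radial[OF y0(1) d1 d2])
    have "(\<Sum>i\<in>Basis. q i - \<sigma> * q' i) \<le> 0"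
      by (rule jet_at_local_max(2)[OF jet_at_diff[OF pq(1) jet_at_cmult[OF q'(1)]] ev])
    hence "f (u y) \<le> \<sigma> * sum q' Basis" using pq(2) by (simp add: sum_subtractf sum_distrib_left)
    moreover have "sum q' Basis < 0"
    proof -
      have "(N - 1) / norm y \<le> (N - 1) / (1/2)" using y0 N by (intro divide_left_mono) auto
      hence "(N - 1) / norm y * (1 - 2 * N * (norm y - r0)) \<le> (2 * (N - 1)) * 1"
      proof (intro mult_mono)
        have "N * (norm y - r0) \<le> N * \<delta>" using N y0 r0' by (intro mult_left_mono) auto
        thus "0 \<le> 1 - 2 * N * (norm y - r0)" using \<delta>(3) by simp
        show "1 - 2 * N * (norm y - r0) \<le> 1" using N yn by simp
      qed (use N in auto)
      thus ?thesis unfolding q'(2) N_def[symmetric] by simp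
    qed
    moreover have "f (u y) \<ge> 0" using a(1)[of "u y"] val h1 hy \<sigma>(3) by linarith
    ultimately show False using \<sigma>(1) by (smt (verit) mult_pos_neg)
  qed
  show ?thesis
  proof (rule that[of "\<sigma> * (7/8)"])
    fix r assume r: "r1 < r" "r < 1"
    obtain x where "norm x = r" "T + \<sigma> * (h r - h r1) \<le> u x" using main[OF r] by blast
    moreover have "\<sigma> * (7/8) * (r - r1) \<le> \<sigma> * (h r - h r1)"
      using mult_left_mono[OF hinc[OF r], of \<sigma>] \<sigma>(1) by simp
    ultimately show "\<exists>x. norm x = r \<and> T + \<sigma> * (7/8) * (r - r1) \<le> u x" by (intro exI[of _ x]) auto
  qed (use \<sigma> in auto)
qed

end

locale comparison = large_solution f u + radial_profile f G T "real DIM('a) - 1"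
  for f :: "real \<Rightarrow> real" and u :: "'a::euclidean_space \<Rightarrow> real" and G :: "real \<Rightarrow> real" and T :: real +
  assumes f_nonneg: "T \<le> t \<Longrightarrow> 0 \<le> f t"
begin

section \<open>Contact with a shifted profile\<close>

text \<open>At a critical point of the difference the gradient of \<open>u\<close> is radial and its
  square is \<open>2 * G (u x) * (\<psi>' (norm x))\<^sup>2\<close>. The gradient part of the
  Laplacian of \<open>D (u x)\<close> thus becomes a multiple of \<open>slope (u x)\<close>, and
  \<open>f\<close> enters only at the argument \<open>u x\<close>. The inequalities are scaled by
  \<open>sqrt (2 * G (u x))\<close>.\<close>

lemma touching:
  assumes x: "x \<in> ball 0 1" "x \<noteq> 0" "T < u x"
    and h: "\<forall>\<^sub>F z in nhds (norm x). (\<psi> has_real_derivative \<psi>' z) (at z)"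
    and h2: "(\<psi>' has_real_derivative \<psi>'') (at (norm x))"
  shows "\<forall>\<^sub>F z in nhds x. D (u x) - \<psi> (norm x) \<le> D (u z) - \<psi> (norm z) \<Longrightarrow>
      sqrt (2 * G (u x)) * (\<psi>'' + (real DIM('a) - 1) / norm x * \<psi>' (norm x)) \<le> slope (u x) * (\<psi>' (norm x))\<^sup>2 - f (u x)"
    (is "?min \<Longrightarrow> ?A \<le> ?B")
    and "\<forall>\<^sub>F z in nhds x. D (u z) - \<psi> (norm z) \<le> D (u x) - \<psi> (norm x) \<Longrightarrow>
      slope (u x) * (\<psi>' (norm x))\<^sup>2 - f (u x) \<le> sqrt (2 * G (u x)) * (\<psi>'' + (real DIM('a) - 1) / norm x * \<psi>' (norm x))"
    (is "?max \<Longrightarrow> _")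
proof -
  define g where "g = sqrt (2 * G (u x))"
  have G: "G (u x) > 0" using G_pos x(3) by simp
  have g: "g > 0" "g * g = 2 * G (u x)" using G by (auto simp: g_def)
  obtain p q where pq: "jet_at u x p q" "sum q Basis = f (u x)" using u_jet[OF x(1)] by blast
  obtain q' where q': "jet_at (\<lambda>y. \<psi> (norm y)) x (\<lambda>i. \<psi>' (norm x) * ((x \<bullet> i) / norm x)) q'"
    "sum q' Basis = \<psi>'' + (real DIM('a) - 1) / norm x * \<psi>' (norm x)"
    using jet_at_radial[OF x(2) h h2] by blast
  have "\<forall>\<^sub>F z in nhds (u x). (D has_real_derivative - (1 / sqrt (2 * G z))) (at z)"
    using eventually_nhds_in_open[of "{T<..}" "u x"] x(3) by (auto elim!: eventually_mono intro!: D_deriv)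
  from jet_at_compose[OF pq(1) this D_deriv2[OF x(3)]]
  have jD: "jet_at (\<lambda>y. D (u y)) x (\<lambda>i. - (1 / g) * p i)
     (\<lambda>i. - (1 / g) * q i + slope (u x) / (2 * G (u x) * g) * (p i)\<^sup>2)"
    unfolding g_def .
  note j = jet_at_diff[OF jD q'(1)]
  let ?S = "\<Sum>i\<in>Basis. (- (1 / g) * q i + slope (u x) / (2 * G (u x) * g) * (p i)\<^sup>2) - q' i"
  have S: "g * ?S = slope (u x) * (\<psi>' (norm x))\<^sup>2 - f (u x) - g * sum q' Basis"
    if crit: "\<And>i. i \<in> Basis \<Longrightarrow> - (1 / g) * p i - \<psi>' (norm x) * ((x \<bullet> i) / norm x) = 0"
  proof -
    have "(p i)\<^sup>2 = 2 * G (u x) * (\<psi>' (norm x))\<^sup>2 * ((x \<bullet> i) / norm x)\<^sup>2" if "i \<in> Basis" for i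
    proof -
      have "p i = - (g * (\<psi>' (norm x) * ((x \<bullet> i) / norm x)))" using crit[OF that] g(1) by (simp add: field_simps)
      thus ?thesis unfolding g(2)[symmetric] by (simp add: power2_eq_square)
    qed
    hence "(\<Sum>i\<in>Basis. (p i)\<^sup>2) = (\<Sum>i\<in>Basis. 2 * G (u x) * (\<psi>' (norm x))\<^sup>2 * ((x \<bullet> i) / norm x)\<^sup>2)" by simp
    also have "\<dots> = 2 * G (u x) * (\<psi>' (norm x))\<^sup>2"
      unfolding sum_distrib_left[symmetric] sum_norm_jet(2)[OF x(2)] by simp
    finally have P: "(\<Sum>i\<in>Basis. (p i)\<^sup>2) = 2 * G (u x) * (\<psi>' (norm x))\<^sup>2" .
    have "?S = - (1 / g) * f (u x) + slope (u x) / (2 * G (u x) * g) * (\<Sum>i\<in>Basis. (p i)\<^sup>2) - sum q' Basis"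
      unfolding pq(2)[symmetric] sum_distrib_left sum_subtractf sum.distrib ..
    also have "\<dots> = - (1 / g) * f (u x) + slope (u x) / g * (\<psi>' (norm x))\<^sup>2 - sum q' Basis"
      unfolding P using G by simp
    finally show ?thesis using g(1) by (simp add: field_simps)
  qed
  show "?A \<le> ?B" if ?min
  proof -
    have "?S \<ge> 0" by (rule jet_at_local_min(2)[OF j that])
    hence "g * ?S \<ge> 0" using g(1) by simp
    thus ?thesis using S jet_at_local_min(1)[OF j that] q'(2) unfolding g_def[symmetric] by auto
  qed
  show "?B \<le> ?A" if ?max
  proof -
    have "?S \<le> 0" by (rule jet_at_local_max(2)[OF j that])
    hence "g * ?S \<le> 0" using g(1) by (simp add: mult_nonneg_nonpos)
    thus ?thesis using S jet_at_local_max(1)[OF j that] q'(2) unfolding g_def[symmetric] by auto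
  qed
qed

text \<open>In so thin a shell the weight stays between 1 and 2 although its second derivative
  \<open>- 2 * B = - 32 * N\<close> is large; this is the room used against the curvature
  error.\<close>

lemma quadratic_weight:
  fixes B r1 r :: real
  assumes "B = 16 * real DIM('a)" "1 - 1 / (16 * real DIM('a)) \<le> r1" "r1 \<le> r" "r \<le> 1"
  shows "1 \<le> 2 - B * (r - r1)\<^sup>2" "2 - B * (r - r1)\<^sup>2 \<le> 2" "B * (r - r1) \<le> 1" "0 \<le> B * (r - r1)"
    "15/16 \<le> r" "r - r1 \<le> 1/16"
proof -
  have N: "real DIM('a) \<ge> 1" using DIM_ge_Suc0[where 'a='a] by linarith
  have d: "r - r1 \<le> 1 / (16 * real DIM('a))" using assms by linarith
  have d2: "1 / (16 * real DIM('a)) \<le> 1/16" using N by (simp add: field_simps)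
  have "B * (r - r1) \<le> B * (1 / (16 * real DIM('a)))" using assms(1) d N by (intro mult_left_mono) auto
  thus B1: "B * (r - r1) \<le> 1" using assms(1) N by simp
  show B0: "0 \<le> B * (r - r1)" using assms N by simp
  show d': "r - r1 \<le> 1/16" using d d2 by linarith
  show "15/16 \<le> r" using assms d d2 by linarith
  have "B * (r - r1)\<^sup>2 = (B * (r - r1)) * (r - r1)" by (simp add: power2_eq_square)
  also have "\<dots> \<le> 1 * 1" using B1 B0 d' assms by (intro mult_mono) auto
  finally show "1 \<le> 2 - B * (r - r1)\<^sup>2" by simp
  show "2 - B * (r - r1)\<^sup>2 \<le> 2" using assms N by simp
qed

lemma weighted_deriv:
  fixes B m r1 :: real
  shows "\<forall>\<^sub>F z in nhds r. ((\<lambda>r. 1 - r - m * (2 - B * (r - r1)\<^sup>2)) has_real_derivative - 1 + m * (2 * B * (z - r1))) (at z)"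
    "((\<lambda>z. - 1 + m * (2 * B * (z - r1))) has_real_derivative m * (2 * B)) (at r)"
  by (auto intro!: derivative_eq_intros always_eventually simp: algebra_simps)

text \<open>Positive \<open>m\<close> is a contact from one side, negative \<open>m\<close> from the other. The weight decreases in \<open>r\<close>, so that the
  term containing \<open>f (u y)\<close> always has the favourable sign.\<close>

lemma no_weighted_contact:
  assumes B: "B = 16 * real DIM('a)" and r1: "1 - 1 / (16 * real DIM('a)) \<le> r1"
    and y: "y \<in> ball 0 1" "T < u y" "r1 \<le> norm y"
    and m: "m \<noteq> 0" "\<bar>m\<bar> \<le> 1/16"
    and Dy: "D (u y) = 1 - norm y - m * (2 - B * (norm y - r1)\<^sup>2)"
    and ev: "\<forall>\<^sub>F z in nhds y. 0 \<le> sgn m * (D (u z) - (1 - norm z - m * (2 - B * (norm z - r1)\<^sup>2)))"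
  shows False
proof -
  define N where "N = real DIM('a)"
  have N: "N \<ge> 1" using DIM_ge_Suc0[where 'a='a] unfolding N_def by linarith
  define r where "r = norm y"
  define k where "k = 2 - B * (r - r1)\<^sup>2"
  have rb: "r1 \<le> r" "r \<le> 1" using y by (auto simp: r_def)
  note wt = quadratic_weight[OF B r1 rb, folded k_def]
  have y0: "y \<noteq> 0" using wt(5) by (auto simp: r_def)
  \<comment> \<open>Minus the radial derivative of the test function; a constant weight would give
    1.\<close>
  define \<alpha> where "\<alpha> = 1 - m * (2 * B * (r - r1))"
  define g where "g = sqrt (2 * G (u y))"
  define \<rho> where "\<rho> = max (1/2) (r + m * k)"
  have g: "g > 0" using G_pos[of "u y"] y by (simp add: g_def)
  have q: "(- 1 + m * (2 * B * (r - r1)))\<^sup>2 = \<alpha>\<^sup>2" "- 1 + m * (2 * B * (r - r1)) = - \<alpha>"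
    by (auto simp: \<alpha>_def power2_eq_square algebra_simps)
  have sl: "slope (u y) = f (u y) - (N - 1) * g / \<rho>"
    unfolding slope_def g_def N_def \<rho>_def using Dy by (simp add: r_def k_def)
  have contact: "sgn m * (g * (m * (2 * B) - (N - 1) / r * \<alpha>)) \<le> sgn m * ((f (u y) - (N - 1) * g / \<rho>) * \<alpha>\<^sup>2 - f (u y))"
  proof (cases "m > 0")
    case True
    have "sqrt (2 * G (u y)) * (m * (2 * B) + (real DIM('a) - 1) / norm y * (- 1 + m * (2 * B * (norm y - r1))))
        \<le> slope (u y) * (- 1 + m * (2 * B * (norm y - r1)))\<^sup>2 - f (u y)"
      by (rule touching(1)[OF y(1) y0 y(2) weighted_deriv]) (use ev True Dy in simp)
    thus ?thesis using True unfolding sl unfolding r_def[symmetric] N_def[symmetric] g_def[symmetric] q(1) unfolding q(2) by simp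
  next
    case False
    have "slope (u y) * (- 1 + m * (2 * B * (norm y - r1)))\<^sup>2 - f (u y)
        \<le> sqrt (2 * G (u y)) * (m * (2 * B) + (real DIM('a) - 1) / norm y * (- 1 + m * (2 * B * (norm y - r1))))"
      by (rule touching(2)[OF y(1) y0 y(2) weighted_deriv]) (use ev False m Dy in simp)
    thus ?thesis using False m unfolding sl unfolding r_def[symmetric] N_def[symmetric] g_def[symmetric] q(1) unfolding q(2) by simp
  qed
  have sm: "sgn m * m = \<bar>m\<bar>" by (simp add: abs_sgn mult.commute)
  have P: "0 \<le> 2 * (B * (r - r1))" "2 * (B * (r - r1)) \<le> 2" using wt by auto
  have a1: "\<bar>1 - \<alpha>\<bar> \<le> \<bar>m\<bar> * 2"
  proof -
    have "1 - \<alpha> = m * (2 * (B * (r - r1)))" by (simp add: \<alpha>_def)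
    hence "\<bar>1 - \<alpha>\<bar> = \<bar>m\<bar> * (2 * (B * (r - r1)))" using P(1) abs_mult[of m "2 * (B * (r - r1))"] by simp
    thus ?thesis using mult_left_mono[OF P(2), of "\<bar>m\<bar>"] by simp
  qed
  hence \<alpha>: "0 \<le> \<alpha>" "\<alpha> \<le> 2" using m(2) by (auto simp: abs_le_iff)
  have "sgn m * (1 - \<alpha>) = \<bar>m\<bar> * (2 * (B * (r - r1)))" unfolding \<alpha>_def sm[symmetric] by simp
  hence "0 \<le> (sgn m * (1 - \<alpha>)) * (1 + \<alpha>)" using P \<alpha> by simp
  hence "0 \<le> f (u y) * ((sgn m * (1 - \<alpha>)) * (1 + \<alpha>))"
    using f_nonneg[of "u y"] y by simp
  hence fy: "0 \<le> sgn m * (f (u y) * (1 - \<alpha>\<^sup>2))" by (simp add: power2_eq_square algebra_simps)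
  have \<rho>: "1/2 \<le> \<rho>" by (simp add: \<rho>_def)
  \<comment> \<open>\<open>max (1/2)\<close> is 1-Lipschitz and fixes \<open>r \<ge> 15/16\<close>,
    so truncating the radius does no harm here.\<close>
  have "\<bar>\<rho> - r\<bar> \<le> \<bar>m * k\<bar>" using wt(5) by (auto simp: \<rho>_def max_def)
  also have "\<dots> \<le> \<bar>m\<bar> * 2" using wt(1,2) by (simp add: abs_mult mult_left_mono)
  finally have \<rho>r: "\<bar>\<rho> - r\<bar> \<le> \<bar>m\<bar> * 2" .
  have "\<bar>(1 - \<alpha>) * r\<bar> \<le> \<bar>m\<bar> * 2 * 1"
    using a1 rb wt(5) unfolding abs_mult by (intro mult_mono) auto
  hence "\<bar>(\<rho> - r) + (1 - \<alpha>) * r\<bar> \<le> 4 * \<bar>m\<bar>" using \<rho>r by linarith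
  hence num: "\<bar>\<rho> - \<alpha> * r\<bar> \<le> 4 * \<bar>m\<bar>" by (simp add: algebra_simps)
  have "1 / r - \<alpha> / \<rho> = (\<rho> - \<alpha> * r) / (r * \<rho>)" using \<rho> wt(5) by (subst diff_frac_eq) auto
  hence "\<bar>1 / r - \<alpha> / \<rho>\<bar> = \<bar>\<rho> - \<alpha> * r\<bar> / (r * \<rho>)" using \<rho> wt(5) by (simp add: abs_mult)
  also have "\<dots> \<le> 4 * \<bar>m\<bar> / ((1/2) * (1/2))"
    using num \<rho> wt(5) by (intro frac_le mult_mono) auto
  finally have d: "\<bar>1 / r - \<alpha> / \<rho>\<bar> \<le> 16 * \<bar>m\<bar>" by simp
  \<comment> \<open>The curvature mismatch is at most \<open>32 * (N - 1) * \<bar>m\<bar>\<close>,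
    while the second derivative of the weight supplies
    \<open>2 * B * \<bar>m\<bar> = 32 * N * \<bar>m\<bar>\<close>: the origin of
    \<open>B = 16 * N\<close>.\<close>
  have "\<bar>(N - 1) * \<alpha> * (1 / r - \<alpha> / \<rho>)\<bar> \<le> (N - 1) * 2 * (16 * \<bar>m\<bar>)"
    using d N \<alpha> unfolding abs_mult by (intro mult_mono) auto
  also have "\<dots> < \<bar>m\<bar> * (2 * B)" using m(1) by (simp add: B N_def algebra_simps)
  finally have br: "\<bar>(N - 1) * \<alpha> * (1 / r - \<alpha> / \<rho>)\<bar> < \<bar>m\<bar> * (2 * B)" .
  have "sgn m * ((N - 1) * \<alpha> * (1 / r - \<alpha> / \<rho>)) \<le> \<bar>(N - 1) * \<alpha> * (1 / r - \<alpha> / \<rho>)\<bar>"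
    using m(1) by (cases "m > 0") (auto simp: sgn_real_def)
  hence "sgn m * ((N - 1) * \<alpha> * (1 / r - \<alpha> / \<rho>)) < sgn m * (m * (2 * B))"
    using br unfolding sm[symmetric] by (simp add: mult.assoc)
  hence "0 < g * (sgn m * (m * (2 * B)) - sgn m * ((N - 1) * \<alpha> * (1 / r - \<alpha> / \<rho>)))" using g by simp
  also have "\<dots> = sgn m * (g * (m * (2 * B) - (N - 1) / r * \<alpha>)) + sgn m * ((N - 1) * g / \<rho> * \<alpha>\<^sup>2)"
    by (simp add: algebra_simps power2_eq_square diff_divide_distrib add_divide_distrib)
  also have "\<dots> \<le> sgn m * ((f (u y) - (N - 1) * g / \<rho>) * \<alpha>\<^sup>2 - f (u y)) + sgn m * ((N - 1) * g / \<rho> * \<alpha>\<^sup>2)"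
    using contact by simp
  also have "\<dots> = - (sgn m * (f (u y) * (1 - \<alpha>\<^sup>2)))" by (simp add: algebra_simps)
  finally show False using fy by simp
qed

text \<open>If \<open>\<eta>\<close> is negative somewhere, \<open>h = \<eta> / k\<close> attains a
  negative minimum \<open>- m\<close>, and the profile shifted by \<open>m * k\<close> touches
  there. Above the level \<open>T\<close>, \<open>no_weighted_contact\<close> excludes this. At the
  level \<open>T\<close>, \<open>u\<close> starts faster than the profile, because
  \<open>\<sigma>\<close> exceeds the initial speed, and a smaller value of \<open>h\<close> is
  found slightly outside the radius \<open>r1\<close>.\<close>

lemma upper_bound:
  assumes r1: "1 - 1 / (16 * real DIM('a)) \<le> r1" "r1 < 1"
    and lev: "\<And>x. x \<in> ball 0 1 \<Longrightarrow> T \<le> u x \<Longrightarrow> r1 \<le> norm x" "\<And>x. norm x = r1 \<Longrightarrow> u x \<le> T"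
    and slope0: "\<And>r. r1 < r \<Longrightarrow> r < 1 \<Longrightarrow> \<exists>x. norm x = r \<and> T + \<sigma> * (r - r1) \<le> u x" "sqrt (2 * G T) < \<sigma>"
    and x: "x \<in> ball 0 1" "T \<le> u x"
  shows "1 - norm x \<le> D (u x)"
proof (rule ccontr)
  assume neg: "\<not> ?thesis"
  define N where "N = real DIM('a)"
  have N: "N \<ge> 1" using DIM_ge_Suc0[where 'a='a] unfolding N_def by linarith
  define B where "B = 16 * N"
  define k where "k = (\<lambda>r. 2 - B * (r - r1)\<^sup>2)"
  have wt: "1 \<le> k r" "k r \<le> 2" "B * (r - r1) \<le> 1" "0 \<le> B * (r - r1)" "15/16 \<le> r" "r - r1 \<le> 1/16"
    if "r1 \<le> r" "r \<le> 1" for r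
    unfolding k_def using quadratic_weight[OF B_def[unfolded N_def] r1(1) that] by auto
  define \<eta> where "\<eta> = (\<lambda>x. norm x - 1 + D (u x))"
  define h where "h = (\<lambda>x. \<eta> x / k (norm x))"
  define \<Omega> where "\<Omega> = {x \<in> ball 0 1. T \<le> u x}"
  have \<Omega>: "r1 \<le> norm x" "norm x < 1" "T \<le> u x" "x \<in> ball 0 1" if "x \<in> \<Omega>" for x
    using that lev(1) by (auto simp: \<Omega>_def)
  have k1: "1 \<le> k (norm x)" if "x \<in> \<Omega>" for x using wt(1)[of "norm x"] \<Omega>[OF that] by simp
  have hlow: "norm x - 1 \<le> h x" if "x \<in> \<Omega>" for x
  proof -
    have "norm x - 1 \<le> \<eta> x" using D_nonneg[OF \<Omega>(3)[OF that]] by (simp add: \<eta>_def)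
    moreover have "(norm x - 1) * k (norm x) \<le> (norm x - 1) * 1"
      using k1[OF that] \<Omega>(2)[OF that] by (intro mult_left_mono_neg) auto
    ultimately have "(norm x - 1) * k (norm x) \<le> \<eta> x" by (metis mult.right_neutral order_trans)
    thus ?thesis unfolding h_def using k1[OF that] by (simp add: pos_le_divide_eq)
  qed
  have x\<Omega>: "x \<in> \<Omega>" using x by (simp add: \<Omega>_def)
  have hx: "h x < 0" unfolding h_def using neg k1[OF x\<Omega>] by (simp add: \<eta>_def divide_neg_pos)
  \<comment> \<open>Beyond the radius \<open>\<rho>\<close> the bound \<open>hlow\<close> gives
    \<open>h > h x / 2 > h x\<close>, so the minimum over a compact set is the minimum over all of
    \<open>\<Omega>\<close>.\<close>
  define \<rho> where "\<rho> = max (norm x) (1 + h x / 2)"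
  have \<rho>: "\<rho> < 1" "norm x \<le> \<rho>" "1 + h x / 2 \<le> \<rho>" using x(1) hx by (auto simp: \<rho>_def)
  define K where "K = {y \<in> cball 0 \<rho>. T \<le> u y}"
  have K\<Omega>: "K \<subseteq> \<Omega>" using \<rho> by (auto simp: K_def \<Omega>_def)
  have "compact K"
  proof -
    have "continuous_on (cball 0 \<rho>) u" using \<rho> by (intro u_cont) auto
    hence "closed (cball 0 \<rho> \<inter> u -` {T..})" by (intro continuous_closed_preimage) auto
    moreover have "K = cball 0 \<rho> \<inter> (cball 0 \<rho> \<inter> u -` {T..})" by (auto simp: K_def)
    ultimately show ?thesis by (metis compact_Int_closed compact_cball)
  qed
  moreover have "continuous_on K h"
  proof -
    have "continuous_on K (\<lambda>y. D (u y))"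
      using K\<Omega> by (intro continuous_on_compose2[OF D_cont u_cont]) (auto simp: \<Omega>_def)
    thus ?thesis unfolding h_def \<eta>_def k_def
      using k1 K\<Omega> unfolding k_def by (intro continuous_intros) force+
  qed
  moreover have xK: "x \<in> K" using x \<rho> by (simp add: K_def)
  ultimately obtain y where y: "y \<in> K" "\<And>z. z \<in> K \<Longrightarrow> h y \<le> h z"
    using continuous_attains_inf[of K h] by blast
  have hy: "h y \<le> h x" by (rule y(2)[OF xK])
  have ymin: "h y \<le> h z" if "z \<in> \<Omega>" for z
  proof (cases "norm z \<le> \<rho>")
    case True
    thus ?thesis using that by (intro y(2)) (auto simp: K_def \<Omega>_def)
  next
    case False
    thus ?thesis using hlow[OF that] \<rho>(3) hy hx by simp
  qed
  have y\<Omega>: "y \<in> \<Omega>" using y(1) K\<Omega> by blast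
  note yb = \<Omega>[OF y\<Omega>]
  define m where "m = - h y"
  have m: "m > 0" using hy hx by (simp add: m_def)
  have uy: "T < u y"
  proof (rule ccontr)
    assume "\<not> T < u y"
    hence uyT: "u y = T" using yb(3) by simp
    \<comment> \<open>The value of \<open>\<eta>\<close> at the level \<open>T\<close> and the
      radius \<open>r1\<close>, where the weight is 2. Points of this level have radius at least
      \<open>r1\<close>, and the next estimates show that \<open>h\<close> is at least
      \<open>\<eta>1 / 2\<close> on them.\<close>
    define \<eta>1 where "\<eta>1 = r1 - 1 + D T"
    define s where "s = norm y - r1"
    have s: "0 \<le> s" using yb by (simp add: s_def)
    have ey: "\<eta> y = \<eta>1 + s" by (simp add: \<eta>_def \<eta>1_def s_def uyT)
    have "h y < 0" using hy hx by simp
    hence "\<eta> y < 0" using k1[OF y\<Omega>] by (auto simp: h_def divide_less_0_iff)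
    hence e1: "\<eta>1 < 0" using ey s by simp
    have e1': "- \<eta>1 \<le> 1/16"
      using D_nonneg[of T] wt(6)[of 1] r1 by (simp add: \<eta>1_def)
    have "\<eta>1 / 2 \<le> h y"
    proof -
      have "\<eta>1 * (2 - B * s\<^sup>2) \<le> 2 * (\<eta>1 + s)"
      proof -
        have "(- \<eta>1) * ((B * s) * s) \<le> (1/16) * (1 * s)"
          using e1 e1' s wt(3,4)[of "norm y"] yb by (intro mult_mono) (auto simp: s_def)
        thus ?thesis using s by (simp add: algebra_simps power2_eq_square)
      qed
      hence "\<eta>1 / 2 * k (norm y) \<le> \<eta> y" unfolding ey k_def s_def[symmetric] by simp
      thus ?thesis unfolding h_def using k1[OF y\<Omega>] by (simp add: pos_le_divide_eq)
    qed
    \<comment> \<open>Over a radial step \<open>t\<close> the spherical maximum rises by at least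
      \<open>\<sigma> * t\<close>, so \<open>D\<close> falls by at least \<open>t\<close> and
      \<open>\<eta>\<close> does not increase. The weight has dropped strictly below 2, and as
      \<open>\<eta>1 < 0\<close> the quotient is strictly smaller.\<close>
    moreover have "\<exists>z\<in>\<Omega>. h z < \<eta>1 / 2"
    proof -
      have sig: "0 < \<sigma>" using slope0(2) G_pos[of T] by (smt (verit) real_sqrt_ge_zero)
      have "((\<lambda>V. sqrt (2 * G V)) \<longlongrightarrow> sqrt (2 * G T)) (at T within {T..})"
        using G_cont by (intro tendsto_intros) (auto simp: continuous_on_def)
      hence "\<forall>\<^sub>F V in at T within {T..}. sqrt (2 * G V) < \<sigma>" by (rule order_tendstoD(2)[OF _ slope0(2)])
      then obtain d where d: "d > 0" "\<And>V. V \<in> {T..} \<Longrightarrow> V \<noteq> T \<Longrightarrow> dist V T < d \<Longrightarrow> sqrt (2 * G V) < \<sigma>"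
        unfolding eventually_at by auto
      define t where "t = min (d / \<sigma>) (1 - r1) / 2"
      have t: "0 < t" "t < 1 - r1" "\<sigma> * t < d" using d(1) sig r1(2)
        by (auto simp: t_def min_def field_simps)
      have lt: "sqrt (2 * G V) \<le> \<sigma>" if "V \<in> {T..T + \<sigma> * t}" for V
        using d(2)[of V] slope0(2) that t by (cases "V = T") (auto simp: dist_real_def)
      have st: "0 < \<sigma> * t" using sig t by simp
      have "integral {T..T + \<sigma> * t} (\<lambda>s. 1 / \<sigma>) \<le> integral {T..T + \<sigma> * t} (\<lambda>s. 1 / sqrt (2 * G s))"
      proof (rule integral_le)
        show "(\<lambda>s. 1 / sqrt (2 * G s)) integrable_on {T..T + \<sigma> * t}"
          by (intro integrable_continuous_real continuous_on_subset[OF integrand_cont]) auto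
        show "1 / \<sigma> \<le> 1 / sqrt (2 * G s)" if "s \<in> {T..T + \<sigma> * t}" for s
          using lt[OF that] G_pos[of s] that by (intro divide_left_mono) (auto intro!: mult_pos_pos sig)
      qed (rule integrable_const_ivl)
      hence "t \<le> integral {T..T + \<sigma> * t} (\<lambda>s. 1 / sqrt (2 * G s))" using st sig by simp
      hence D1: "D (T + \<sigma> * t) \<le> D T - t" using D_split[of T "T + \<sigma> * t"] st by simp
      obtain z where z: "norm z = r1 + t" "T + \<sigma> * t \<le> u z" using slope0(1)[of "r1 + t"] t by auto
      have zO: "z \<in> \<Omega>" using z t st by (auto simp: \<Omega>_def)
      have "D (u z) \<le> D (T + \<sigma> * t)" using z(2) st by (intro D_antimono) auto
      hence ez: "\<eta> z \<le> \<eta>1" using D1 z(1) by (simp add: \<eta>_def \<eta>1_def)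
      have "k (norm z) < 2" using z(1) t N by (simp add: k_def B_def)
      hence "\<eta>1 * 2 < \<eta>1 * k (norm z)" using e1 by (intro mult_strict_left_mono_neg)
      hence "2 * \<eta> z < \<eta>1 * k (norm z)" using ez by linarith
      hence "h z < \<eta>1 / 2" unfolding h_def using k1[OF zO] by (simp add: field_simps)
      thus ?thesis using zO by blast
    qed
    ultimately show False using ymin by force
  qed
  define r where "r = norm y"
  have r: "15/16 \<le> r" "r < 1" "r1 \<le> r" using wt(5)[of r] yb by (auto simp: r_def)
  have kr: "1 \<le> k r" "k r \<le> 2" "B * (r - r1) \<le> 1" "0 \<le> B * (r - r1)" using wt(1-4)[of r] r by auto
  have Dy: "D (u y) = 1 - r - m * k r" using kr(1) by (simp add: m_def h_def \<eta>_def r_def)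
  have "m * 1 \<le> m * k r" using m kr by (intro mult_left_mono) auto
  also have "\<dots> \<le> 1 - r" using Dy D_nonneg[of "u y"] uy by simp
  finally have m16: "m \<le> 1/16" using r by simp
  have "\<forall>\<^sub>F z in nhds y. z \<in> ball 0 1 \<and> T < u z"
  proof (rule eventually_conj)
    show "\<forall>\<^sub>F z in nhds y. z \<in> ball 0 1" using yb(4) by (intro eventually_nhds_in_open) auto
    have "(u \<longlongrightarrow> u y) (nhds y)" using u_isCont[OF yb(4)] by (simp add: continuous_at tendsto_at_iff_tendsto_nhds)
    thus "\<forall>\<^sub>F z in nhds y. T < u z" by (rule order_tendstoD(1)[OF _ uy])
  qed
  hence "\<forall>\<^sub>F z in nhds y. 0 \<le> sgn m * (D (u z) - (1 - norm z - m * (2 - B * (norm z - r1)\<^sup>2)))"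
  proof eventually_elim
    case (elim z)
    hence zO: "z \<in> \<Omega>" by (auto simp: \<Omega>_def)
    have "- m \<le> h z" using ymin[OF zO] by (simp add: m_def)
    hence "- m * k (norm z) \<le> \<eta> z" unfolding h_def using k1[OF zO] by (simp add: pos_le_divide_eq)
    thus ?case using m by (simp add: \<eta>_def k_def algebra_simps)
  qed
  thus False
    using no_weighted_contact[OF B_def[unfolded N_def] r1(1) yb(4) uy yb(1), of m] m m16 Dy by (simp add: r_def k_def)
qed

text \<open>A positive maximum \<open>m\<close> of \<open>\<eta> / k\<close> gives a contact with
  parameter \<open>- m\<close>. It cannot escape to the unit sphere, since
  \<open>h \<le> D (u z)\<close> and \<open>D\<close> tends to 0, nor sit on the inner sphere, where
  \<open>D (u x) \<le> D T \<le> 1 - r1\<close> makes \<open>\<eta>\<close> nonpositive.\<close>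

lemma lower_bound:
  assumes r1: "1 - 1 / (16 * real DIM('a)) \<le> r1" "r1 < 1"
    and lev: "\<And>x. x \<in> ball 0 1 \<Longrightarrow> r1 \<le> norm x \<Longrightarrow> T < u x"
    and DT: "D T \<le> 1 - r1"
    and x: "x \<in> ball 0 1" "r1 \<le> norm x"
  shows "D (u x) \<le> 1 - norm x"
proof (rule ccontr)
  assume neg: "\<not> ?thesis"
  define N where "N = real DIM('a)"
  have N: "N \<ge> 1" using DIM_ge_Suc0[where 'a='a] unfolding N_def by linarith
  define B where "B = 16 * N"
  define k where "k = (\<lambda>r. 2 - B * (r - r1)\<^sup>2)"
  have wt: "1 \<le> k r" "k r \<le> 2" "B * (r - r1) \<le> 1" "0 \<le> B * (r - r1)" "15/16 \<le> r" "r - r1 \<le> 1/16"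
    if "r1 \<le> r" "r \<le> 1" for r
    unfolding k_def using quadratic_weight[OF B_def[unfolded N_def] r1(1) that] by auto
  define \<eta> where "\<eta> = (\<lambda>x. norm x - 1 + D (u x))"
  define h where "h = (\<lambda>x. \<eta> x / k (norm x))"
  define \<Omega> where "\<Omega> = {x \<in> ball (0::'a) 1. r1 \<le> norm x}"
  have \<Omega>: "r1 \<le> norm x" "norm x < 1" "T < u x" "x \<in> ball 0 1" if "x \<in> \<Omega>" for x
    using that lev by (auto simp: \<Omega>_def)
  have k1: "1 \<le> k (norm x)" if "x \<in> \<Omega>" for x using wt(1)[of "norm x"] \<Omega>[OF that] by simp
  have x\<Omega>: "x \<in> \<Omega>" using x by (simp add: \<Omega>_def)
  have hx: "h x > 0" unfolding h_def using neg k1[OF x\<Omega>] by (simp add: \<eta>_def)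
  have hup: "h z \<le> D (u z)" if "z \<in> \<Omega>" for z
  proof -
    have "\<eta> z \<le> D (u z)" using \<Omega>[OF that] by (simp add: \<eta>_def)
    also have "\<dots> \<le> D (u z) * k (norm z)" using k1[OF that] D_nonneg[of "u z"] \<Omega>[OF that] by (simp add: mult_le_cancel_left1)
    finally show ?thesis unfolding h_def using k1[OF that] by (simp add: pos_divide_le_eq)
  qed
  have "\<forall>\<^sub>F V in at_top. D V < h x" by (rule order_tendstoD(2)[OF D_tendsto hx])
  then obtain M where M: "\<And>V. M \<le> V \<Longrightarrow> D V < h x" unfolding eventually_at_top_linorder by blast
  obtain \<rho>0 where \<rho>0: "\<rho>0 < 1" "\<forall>x\<in>ball 0 1. \<rho>0 < norm x \<longrightarrow> M < u x" using large by blast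
  define \<rho> where "\<rho> = max (norm x) \<rho>0"
  have \<rho>: "\<rho> < 1" "norm x \<le> \<rho>" "\<rho>0 \<le> \<rho>" using x(1) \<rho>0 by (auto simp: \<rho>_def)
  define K where "K = cball (0::'a) \<rho> - ball 0 r1"
  have K\<Omega>: "K \<subseteq> \<Omega>" using \<rho> by (auto simp: K_def \<Omega>_def)
  have "compact K" unfolding K_def by (intro compact_diff) auto
  moreover have "continuous_on K h"
  proof -
    have "continuous_on K (\<lambda>y. D (u y))"
      using K\<Omega> \<Omega>(3,4) by (intro continuous_on_compose2[OF D_cont u_cont]) (auto simp: less_imp_le)
    thus ?thesis unfolding h_def \<eta>_def k_def
      using k1 K\<Omega> unfolding k_def by (intro continuous_intros) force+
  qed
  moreover have xK: "x \<in> K" using x \<rho> by (simp add: K_def)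
  ultimately obtain y where y: "y \<in> K" "\<And>z. z \<in> K \<Longrightarrow> h z \<le> h y"
    using continuous_attains_sup[of K h] by blast
  have hy: "h x \<le> h y" by (rule y(2)[OF xK])
  have ymax: "h z \<le> h y" if "z \<in> \<Omega>" for z
  proof (cases "norm z \<le> \<rho>")
    case True
    thus ?thesis using that by (intro y(2)) (auto simp: K_def \<Omega>_def)
  next
    case False
    hence "M < u z" using \<rho>0(2) \<rho>(3) \<Omega>[OF that] by auto
    thus ?thesis using hup[OF that] M[of "u z"] hy by simp
  qed
  have y\<Omega>: "y \<in> \<Omega>" using y(1) K\<Omega> by blast
  note yb = \<Omega>[OF y\<Omega>]
  define m where "m = h y"
  have m: "m > 0" using hy hx by (simp add: m_def)
  define r where "r = norm y"
  have r: "15/16 \<le> r" "r < 1" "r1 \<le> r" using wt(5)[of r] yb by (auto simp: r_def)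
  have kr: "1 \<le> k r" "k r \<le> 2" "B * (r - r1) \<le> 1" "0 \<le> B * (r - r1)" using wt(1-4)[of r] r by auto
  have Dy: "D (u y) = 1 - r + m * k r" using kr(1) by (simp add: m_def h_def \<eta>_def r_def)
  have DyT: "D (u y) \<le> D T" using yb by (intro D_antimono) auto
  have "r1 \<noteq> r" using Dy DyT DT m kr(1) by (auto simp: algebra_simps dest: mult_pos_pos[of m "k r"])
  hence r1r: "r1 < r" using r by simp
  have "m \<le> D (u y)" using hup[OF y\<Omega>] by (simp add: m_def)
  hence m16: "m \<le> 1/16" using DyT DT wt(6)[of 1] r1 by linarith
  have "\<forall>\<^sub>F z in nhds y. z \<in> ball 0 1 - cball 0 r1"
    using yb r1r by (intro eventually_nhds_in_open) (auto simp: r_def)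
  hence "\<forall>\<^sub>F z in nhds y. 0 \<le> sgn (- m) * (D (u z) - (1 - norm z - (- m) * (2 - B * (norm z - r1)\<^sup>2)))"
  proof eventually_elim
    case (elim z)
    hence zO: "z \<in> \<Omega>" by (auto simp: \<Omega>_def)
    have "h z \<le> m" using ymax[OF zO] by (simp add: m_def)
    hence "\<eta> z \<le> m * k (norm z)" unfolding h_def using k1[OF zO] by (simp add: pos_divide_le_eq)
    thus ?case using m by (simp add: \<eta>_def k_def algebra_simps)
  qed
  thus False
    using no_weighted_contact[OF B_def[unfolded N_def] r1(1) yb(4) yb(3) yb(1), of "- m"] m m16 Dy
    by (simp add: r_def k_def)
qed

end

section \<open>The Keller--Osserman condition\<close>

locale keller_osserman =
  fixes f :: "real \<Rightarrow> real" and b :: real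
  assumes f_cont: "continuous_on UNIV f" and b: "b > 0" and f_nonneg: "b \<le> t \<Longrightarrow> 0 \<le> f t"
    and F_pos: "b \<le> s \<Longrightarrow> 0 < prim f s"
    and F_int: "(\<lambda>s. 1 / sqrt (prim f s)) integrable_on {b..}"
begin

abbreviation F where "F \<equiv> prim f"

definition d where "d V = integral {V..} (\<lambda>s. 1 / sqrt (F s))"

lemma F_deriv: "0 < V \<Longrightarrow> (F has_real_derivative f V) (at V)"
  unfolding prim_def[abs_def]
  by (rule indefinite_integral_deriv_ray) (auto intro: continuous_on_subset[OF f_cont])

lemma F_cont: "continuous_on {0..} F"
  unfolding prim_def[abs_def]
  by (rule continuous_on_indefinite_integral_ray) (auto intro: continuous_on_subset[OF f_cont])

lemma F_mono:
  assumes "b \<le> V" "V \<le> V'"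
  shows "F V \<le> F V'"
proof (rule DERIV_nonneg_imp_nondecreasing[OF assms(2)])
  fix x assume "V \<le> x"
  hence "b \<le> x" "0 < x" using assms b by auto
  thus "\<exists>y. (F has_real_derivative y) (at x) \<and> 0 \<le> y" using F_deriv f_nonneg by blast
qed

lemma inv_nonneg: "b \<le> s \<Longrightarrow> 0 \<le> 1 / sqrt (F s)" using F_pos[of s] by simp

lemma inv_cont: "continuous_on {b..} (\<lambda>s. 1 / sqrt (F s))"
  using F_pos b by (intro continuous_intros continuous_on_subset[OF F_cont]) force+

lemma d_nonneg: "b \<le> V \<Longrightarrow> 0 \<le> d V"
  unfolding d_def by (rule tail_integral_nonneg[OF F_int inv_nonneg])

lemma d_split: "b \<le> V \<Longrightarrow> V \<le> V' \<Longrightarrow> d V = integral {V..V'} (\<lambda>s. 1 / sqrt (F s)) + d V'"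
  unfolding d_def by (rule tail_integral_split[OF F_int inv_nonneg])

lemma d_tendsto: "(d \<longlongrightarrow> 0) at_top"
  unfolding d_def by (rule tail_integral_tendsto_0[OF F_int inv_nonneg])

lemma inv_interval: "b \<le> V \<Longrightarrow> (\<lambda>s. 1 / sqrt (F s)) integrable_on {V..V'}"
  by (intro integrable_continuous_real continuous_on_subset[OF inv_cont]) auto

lemma inv_integral_ge:
  assumes "b \<le> V" "V \<le> V'"
  shows "(V' - V) / sqrt (F V') \<le> integral {V..V'} (\<lambda>s. 1 / sqrt (F s))"
proof -
  have "integral {V..V'} (\<lambda>s. 1 / sqrt (F V')) \<le> integral {V..V'} (\<lambda>s. 1 / sqrt (F s))"
  proof (rule integral_le[OF _ inv_interval[OF assms(1)]])
    fix s assume "s \<in> {V..V'}"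
    hence "0 < F s" "F s \<le> F V'" using F_pos F_mono assms by auto
    thus "1 / sqrt (F V') \<le> 1 / sqrt (F s)" by (intro divide_left_mono) auto
  qed (rule integrable_const_ivl)
  thus ?thesis using assms by simp
qed

section \<open>Growth of the primitive and choice of the profiles\<close>

text \<open>On \<open>{V/2..V}\<close> the integrand is at least \<open>1 / sqrt (F V)\<close>, so
  \<open>V / (2 * sqrt (F V))\<close> is bounded by \<open>d (V / 2)\<close>, which tends to 0: the
  Keller-Osserman condition forces superlinear growth of \<open>sqrt F\<close>.\<close>

lemma growth:
  assumes "C > 0"
  shows "\<forall>\<^sub>F V in at_top. C * V \<le> sqrt (F V)"
proof -
  have "\<forall>\<^sub>F V in at_top. d V < 1 / (2 * C)" by (rule order_tendstoD(2)[OF d_tendsto]) (use assms in simp)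
  then obtain M where M: "\<And>V. M \<le> V \<Longrightarrow> d V < 1 / (2 * C)" unfolding eventually_at_top_linorder by blast
  have "C * V \<le> sqrt (F V)" if V: "V \<ge> 2 * max b M" for V
  proof -
    have v: "b \<le> V / 2" "M \<le> V / 2" "V / 2 \<le> V" using V b by auto
    have F: "0 < F V" using F_pos v by auto
    have "(V - V / 2) / sqrt (F V) \<le> integral {V/2..V} (\<lambda>s. 1 / sqrt (F s))" by (rule inv_integral_ge[OF v(1,3)])
    also have "\<dots> \<le> d (V / 2)" using d_split[OF v(1,3)] d_nonneg[of V] v by simp
    also have "\<dots> < 1 / (2 * C)" by (rule M[OF v(2)])
    finally show ?thesis using F assms by (simp add: field_simps)
  qed
  thus ?thesis unfolding eventually_at_top_linorder by blast
qed

lemma F_large: "\<forall>\<^sub>F V in at_top. M \<le> F V"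
proof -
  have "\<forall>\<^sub>F V in at_top. 1 * V \<le> sqrt (F V)" by (rule growth) simp
  thus ?thesis using eventually_ge_at_top[of "max b (max 1 M)"]
  proof eventually_elim
    case (elim V)
    have "M \<le> V * 1" using elim by simp
    also have "\<dots> \<le> V * V" using elim by (intro mult_left_mono) auto
    also have "\<dots> \<le> sqrt (F V) * sqrt (F V)" using elim F_pos[of V] by (intro mult_mono) auto
    also have "\<dots> = F V" using F_pos[of V] elim by simp
    finally show ?case .
  qed
qed

text \<open>Minimising \<open>F V - (C V)^2\<close> over \<open>{A0..}\<close> yields levels from which the primitive grows quadratically,
  even if \<open>f\<close> vanishes at arbitrarily large arguments.\<close>

lemma good_level:
  assumes C: "C > 0" and A0: "b \<le> A0"
  obtains T where "A0 \<le> T" "\<And>V. T \<le> V \<Longrightarrow> (C * (V - T))\<^sup>2 \<le> F V - F T"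
proof -
  define g where "g = (\<lambda>V. F V - (C * V)\<^sup>2)"
  have "\<forall>\<^sub>F V in at_top. A0 \<le> V \<and> g A0 \<le> g V"
  proof -
    have "\<forall>\<^sub>F V in at_top. (2 * C) * V \<le> sqrt (F V)" by (rule growth) (use C in simp)
    moreover have "\<forall>\<^sub>F V in at_top. 2 * F A0 \<le> F V" by (rule F_large)
    ultimately show ?thesis using eventually_ge_at_top[of A0]
    proof eventually_elim
      case (elim V)
      have "((2 * C) * V)\<^sup>2 \<le> (sqrt (F V))\<^sup>2" using elim C A0 b by (intro power_mono) auto
      hence "4 * (C * V)\<^sup>2 \<le> F V" using F_pos[of V] elim A0 by (simp add: power_mult_distrib)
      moreover have "0 \<le> (C * A0)\<^sup>2" "0 \<le> (C * V)\<^sup>2" by simp_all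
      ultimately have "g A0 \<le> g V" unfolding g_def using elim(2) by linarith
      thus ?case using elim by simp
    qed
  qed
  then obtain M where M: "\<And>V. M \<le> V \<Longrightarrow> A0 \<le> V \<and> g A0 \<le> g V" unfolding eventually_at_top_linorder by blast
  have "continuous_on {A0..max A0 M} g" unfolding g_def
    using A0 b by (intro continuous_intros continuous_on_subset[OF F_cont]) auto
  then obtain T where T: "T \<in> {A0..max A0 M}" "\<And>V. V \<in> {A0..max A0 M} \<Longrightarrow> g T \<le> g V"
    using continuous_attains_inf[of "{A0..max A0 M}" g] by auto
  show ?thesis
  proof (rule that[of T])
    show "A0 \<le> T" using T by simp
    fix V assume V: "T \<le> V"
    have "g T \<le> g V"
    proof (cases "V \<le> max A0 M")
      case True
      thus ?thesis using T V by auto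
    next
      case False
      hence "g A0 \<le> g V" using M[of V] by simp
      moreover have "g T \<le> g A0" by (rule T(2)) simp
      ultimately show ?thesis by simp
    qed
    hence "C\<^sup>2 * (V\<^sup>2 - T\<^sup>2) \<le> F V - F T" by (simp add: g_def power_mult_distrib algebra_simps)
    moreover have "C\<^sup>2 * (V - T)\<^sup>2 \<le> C\<^sup>2 * (V\<^sup>2 - T\<^sup>2)"
    proof (rule mult_left_mono)
      have "0 \<le> 2 * T * (V - T)" using V T A0 b by simp
      thus "(V - T)\<^sup>2 \<le> V\<^sup>2 - T\<^sup>2" by (simp add: power2_eq_square algebra_simps)
    qed simp
    ultimately show "(C * (V - T))\<^sup>2 \<le> F V - F T" by (simp add: power_mult_distrib)
  qed
qed

text \<open>The growth requirement on \<open>T\<close> does not involve \<open>A\<close>, so one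
  level carries profiles of arbitrarily small and arbitrarily large initial energy.\<close>

lemma profile_at_level:
  assumes T: "b \<le> T" "\<And>V. T \<le> V \<Longrightarrow> (16 * (n + 1) * (V - T))\<^sup>2 \<le> F V - F T"
    and A: "A > 0" and n: "n \<ge> 0"
  obtains G where "radial_profile f G T n" "G T = A" "\<And>V. T \<le> V \<Longrightarrow> (A + F V - F T) / 2 \<le> G V"
    "\<And>V. T \<le> V \<Longrightarrow> G V \<le> A + F V - F T"
proof -
  define E where "E = (\<lambda>V. A + F V - F T)"
  \<comment> \<open>For \<open>A < F T\<close> the function \<open>E\<close> lies below
    \<open>F\<close>; the factor gives \<open>\<kappa> * F V \<le> E V\<close>, enough for the
    integrability of \<open>1 / sqrt E\<close>.\<close>
  define \<kappa> where "\<kappa> = min 1 (A / F T)"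
  have FT: "F T > 0" using F_pos T by simp
  have \<kappa>: "0 < \<kappa>" "\<kappa> \<le> 1" "\<kappa> * F T \<le> A" using A FT by (auto simp: \<kappa>_def min_def field_simps)
  have EF: "\<kappa> * F V \<le> E V" if "T \<le> V" for V
  proof -
    have "0 \<le> (1 - \<kappa>) * (F V - F T)" using F_mono[of T V] T that \<kappa> by simp
    thus ?thesis using \<kappa>(3) by (simp add: E_def algebra_simps)
  qed
  have Epos: "E V \<ge> A" if "T \<le> V" for V using F_mono[of T V] T that by (simp add: E_def)
  have Econt: "continuous_on {T..} E"
    unfolding E_def using T b by (intro continuous_intros continuous_on_subset[OF F_cont]) auto
  interpret profile f E T n
  proof
    show "n \<ge> 0" by (rule n)
    show "(E has_real_derivative f V) (at V)" if "T < V" for V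
      unfolding E_def using F_deriv[of V] that T b by (auto intro!: derivative_eq_intros)
    show "continuous_on {T..} E" by (rule Econt)
    show "E T > 0" using A by (simp add: E_def)
    show "E V \<le> E V'" if "T \<le> V" "V \<le> V'" for V V' using F_mono[of V V'] T that by (simp add: E_def)
    show "16 * (n + 1) * (V - T) \<le> sqrt (E V)" if "T \<le> V" for V
      using T(2)[OF that] A by (intro real_le_rsqrt) (simp add: E_def)
    have i: "(\<lambda>s. 1 / sqrt (F s)) integrable_on {T..}"
      by (rule tail_integrable_subset[OF F_int inv_nonneg T(1)])
    show "(\<lambda>s. 1 / sqrt (E s)) integrable_on {T..}"
    proof (rule tail_integrable_bound[where h="\<lambda>s. 1 / sqrt \<kappa> * (1 / sqrt (F s))"])
      show "continuous_on {T..} (\<lambda>s. 1 / sqrt (E s))"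
        using Epos A by (intro continuous_intros Econt) force
      show "(\<lambda>s. 1 / sqrt \<kappa> * (1 / sqrt (F s))) integrable_on {T..}" using i by (intro integrable_on_mult_right)
      fix s assume s: "T \<le> s"
      have "0 < \<kappa> * F s" using \<kappa> F_pos[of s] T s by simp
      hence "1 / sqrt (E s) \<le> 1 / sqrt (\<kappa> * F s)" using EF[OF s] Epos[OF s] A by (intro divide_left_mono) auto
      thus "\<bar>1 / sqrt (E s)\<bar> \<le> 1 / sqrt \<kappa> * (1 / sqrt (F s))"
        using Epos[OF s] A by (simp add: real_sqrt_mult)
    qed
  qed
  obtain G where G: "continuous_on {T..} G" "\<And>V. T \<le> V \<Longrightarrow> E V / 2 \<le> G V" "\<And>V. T \<le> V \<Longrightarrow> G V \<le> E V"
    "G T = E T" "\<And>V. T < V \<Longrightarrow> (G has_real_derivative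
       f V - n * sqrt (2 * G V) / max (1/2) (1 - integral {V..} (\<lambda>s. 1 / sqrt (2 * G s)))) (at V)"
    using profile_exists by blast
  have Gpos: "0 < G V" if "T \<le> V" for V using G(2)[OF that] Epos[OF that] A by simp
  have "radial_profile f G T n"
  proof
    show "(\<lambda>s. 1 / sqrt (2 * G s)) integrable_on {T..}"
    proof (rule tail_integrable_bound[OF _ _ E_int])
      show "continuous_on {T..} (\<lambda>s. 1 / sqrt (2 * G s))"
        using Gpos by (intro continuous_intros G(1)) force
      fix s assume s: "T \<le> s"
      have "1 / sqrt (2 * G s) \<le> 1 / sqrt (E s)"
        using G(2)[OF s] Epos[OF s] A Gpos[OF s] by (intro divide_left_mono) auto
      thus "\<bar>1 / sqrt (2 * G s)\<bar> \<le> 1 / sqrt (E s)" using Gpos[OF s] by simp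
    qed
  qed (use G Gpos in auto)
  moreover have "G T = A" using G(4) by (simp add: E_def)
  ultimately show ?thesis using that[of G] G(2,3) by (simp add: E_def)
qed

text \<open>Up to \<open>S\<close> the integrand of the depth is at most \<open>1 / sqrt A\<close>,
  beyond \<open>S\<close> the Keller-Osserman tail takes over. \<open>A\<close> is fixed before
  \<open>G\<close>, because the profile is built from \<open>A\<close> afterwards.\<close>

lemma depth_small:
  assumes T: "b \<le> T" and \<epsilon>: "\<epsilon> > 0"
  obtains A where "A > 0" "\<And>G n. radial_profile f G T n \<Longrightarrow> (\<And>V. T \<le> V \<Longrightarrow> (A + F V - F T) / 2 \<le> G V) \<Longrightarrow>
    radial_profile.D G T \<le> \<epsilon>"
proof -
  have "\<forall>\<^sub>F V in at_top. d V < \<epsilon> / 2 \<and> T \<le> V"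
    by (intro eventually_conj order_tendstoD(2)[OF d_tendsto] eventually_ge_at_top) (use \<epsilon> in simp)
  then obtain S where S: "d S < \<epsilon> / 2" "T \<le> S" unfolding eventually_at_top_linorder by blast
  define A where "A = max (F T) ((2 * (S - T) / \<epsilon>)\<^sup>2)"
  have A: "A > 0" "F T \<le> A" using F_pos[OF T] by (auto simp: A_def)
  have sA: "2 * (S - T) / \<epsilon> \<le> sqrt A" by (intro real_le_rsqrt) (simp add: A_def)
  show ?thesis
  proof (rule that[of A])
    fix G n assume r: "radial_profile f G T n" and G: "\<And>V. T \<le> V \<Longrightarrow> (A + F V - F T) / 2 \<le> G V"
    interpret radial_profile f G T n by (rule r)
    have g: "A \<le> 2 * G V" "F V \<le> 2 * G V" if "T \<le> V" for V
      using G[OF that] A F_mono[OF T that] by auto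
    have "integral {T..S} (\<lambda>s. 1 / sqrt (2 * G s)) \<le> integral {T..S} (\<lambda>s. 1 / sqrt A)"
    proof (rule integral_le)
      show "(\<lambda>s. 1 / sqrt (2 * G s)) integrable_on {T..S}"
        by (intro integrable_continuous_real continuous_on_subset[OF integrand_cont]) auto
      show "1 / sqrt (2 * G s) \<le> 1 / sqrt A" if "s \<in> {T..S}" for s
        using g(1)[of s] that A by (intro divide_left_mono) auto
    qed (rule integrable_const_ivl)
    also have "\<dots> = (S - T) / sqrt A" using S by simp
    also have "\<dots> \<le> \<epsilon> / 2" using sA A \<epsilon> by (simp add: field_simps)
    finally have 1: "integral {T..S} (\<lambda>s. 1 / sqrt (2 * G s)) \<le> \<epsilon> / 2" .
    have "D S \<le> d S" unfolding D_def d_def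
    proof (rule tail_integral_mono[OF G_int _ S(2)])
      show "(\<lambda>s. 1 / sqrt (F s)) integrable_on {T..}" by (rule tail_integrable_subset[OF F_int inv_nonneg T])
      show "1 / sqrt (2 * G s) \<le> 1 / sqrt (F s)" if "T \<le> s" for s
        using g(2)[OF that] F_pos[of s] T that by (intro divide_left_mono) auto
    qed (rule integrand_nonneg)
    thus "D T \<le> \<epsilon>" using 1 S D_split[of T S] by simp
  qed (use A in auto)
qed

lemma inv_F_le:
  assumes "b \<le> V" "V \<le> s"
  shows "1 / F s \<le> 1 / sqrt (F V) * (1 / sqrt (F s))"
proof -
  have F: "0 < F V" "F V \<le> F s" using F_pos F_mono assms by auto
  have "1 / (sqrt (F s) * sqrt (F s)) \<le> 1 / (sqrt (F V) * sqrt (F s))"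
    using F by (intro divide_left_mono mult_right_mono) auto
  thus ?thesis using F by simp
qed

lemma inv_F_int:
  assumes "b \<le> V"
  shows "(\<lambda>s. 1 / F s) integrable_on {V..}"
proof (rule tail_integrable_bound)
  have "F s \<noteq> 0" if "V \<le> s" for s using F_pos[of s] assms that by simp
  thus "continuous_on {V..} (\<lambda>s. 1 / F s)"
    using assms b by (intro continuous_intros continuous_on_subset[OF F_cont]) auto
  show "\<bar>1 / F s\<bar> \<le> 1 / sqrt (F V) * (1 / sqrt (F s))" if "V \<le> s" for s
    using inv_F_le[OF assms that] F_pos[of s] assms that by simp
  show "(\<lambda>s. 1 / sqrt (F V) * (1 / sqrt (F s))) integrable_on {V..}"
    by (intro integrable_on_mult_right tail_integrable_subset[OF F_int inv_nonneg assms])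
qed

section \<open>Comparison of two profiles\<close>

text \<open>Once \<open>\<bar>G - H\<bar>\<close> is known to be bounded, the integrands of the two
  depths differ by at most a constant times \<open>F\<close> to the power \<open>-3/2\<close>.
  Monotonicity pulls out one factor \<open>1 / sqrt (F V)\<close>, and the remaining integral of
  \<open>1 / F\<close> is \<open>phi f V\<close>.\<close>

lemma profile_difference:
  assumes T: "b \<le> T" and n: "n \<ge> 0"
    and P: "radial_profile f G T n" "radial_profile f H T n"
    and AB: "A > 0" "B > 0"
    and G: "\<And>V. T \<le> V \<Longrightarrow> (A + F V - F T) / 2 \<le> G V" "\<And>V. T \<le> V \<Longrightarrow> G V \<le> A + F V - F T"
    and H: "\<And>V. T \<le> V \<Longrightarrow> (B + F V - F T) / 2 \<le> H V" "\<And>V. T \<le> V \<Longrightarrow> H V \<le> B + F V - F T"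
  obtains S C where "T < S" "C \<ge> 0" "\<And>V. S \<le> V \<Longrightarrow> 1 \<le> F V" "\<And>V. S \<le> V \<Longrightarrow> H V \<le> 2 * F V"
    "\<And>V. S \<le> V \<Longrightarrow> radial_profile.D G V \<le> radial_profile.D H V + C * (phi f V / sqrt (F V))"
proof -
  interpret g: radial_profile f G T n by (rule P(1))
  interpret h: radial_profile f H T n by (rule P(2))
  \<comment> \<open>27 is the constant in the bound for the difference of the curvature terms below;
    with \<open>54 = 2 * 27\<close> both integrated error terms receive the factor
    \<open>1/2\<close>.\<close>
  have "\<forall>\<^sub>F V in at_top. T < V \<and> A + B + 2 * F T + 1 \<le> F V \<and> d V < 1 \<and> d V < 1 / (54 * (n + 1)) \<and> 54 * (n + 1) * V \<le> sqrt (F V)"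
    by (intro eventually_conj F_large eventually_gt_at_top growth order_tendstoD(2)[OF d_tendsto]) (use n in auto)
  then obtain S where S0: "\<And>V. S \<le> V \<Longrightarrow> T < V \<and> A + B + 2 * F T + 1 \<le> F V \<and> d V < 1 \<and> d V < 1 / (54 * (n + 1)) \<and> 54 * (n + 1) * V \<le> sqrt (F V)"
    unfolding eventually_at_top_linorder by blast
  have ST: "T < S" "b \<le> S" using S0[of S] T by auto
  have FT: "0 < F T" by (rule F_pos[OF T])
  have F1: "1 \<le> F V" "F V > 0" "T \<le> V" "b \<le> V" if "S \<le> V" for V using S0[OF that] AB FT T by auto
  have d1: "d V \<le> 1" "0 \<le> d V" if "S \<le> V" for V using S0[OF that] d_nonneg F1[OF that] by auto
  have dS: "27 * n * d S \<le> 1/2"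
  proof -
    have "27 * n * d S \<le> 27 * (n + 1) * d S" using d1[of S] n by (intro mult_right_mono) auto
    also have "\<dots> \<le> 27 * (n + 1) * (1 / (54 * (n + 1)))" using S0[of S] n by (intro mult_left_mono) auto
    also have "\<dots> = 1/2" using n by simp
    finally show ?thesis .
  qed
  have gr: "27 * n * (V - S) \<le> 1/2 * sqrt (F V)" if "S \<le> V" for V
  proof -
    have "27 * n * (V - S) \<le> 27 * (n + 1) * V" using n that ST b by (intro mult_mono) auto
    also have "\<dots> = 1/2 * (54 * (n + 1) * V)" by simp
    also have "\<dots> \<le> 1/2 * sqrt (F V)" using S0[OF that] by (intro mult_left_mono) auto
    finally show ?thesis .
  qed
  have GF: "F V / 2 \<le> 2 * G V" "F V / 2 \<le> 2 * H V" "G V \<le> 2 * F V" "H V \<le> 2 * F V" if "S \<le> V" for V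
    using S0[OF that] G[OF F1(3)[OF that]] H[OF F1(3)[OF that]] AB FT by auto
  have sq: "2/3 * sqrt (F V) \<le> sqrt (2 * G V)" "2/3 * sqrt (F V) \<le> sqrt (2 * H V)" "sqrt (2 * H V) \<le> 2 * sqrt (F V)"
    if "S \<le> V" for V
  proof -
    have "(2/3 * sqrt (F V))\<^sup>2 \<le> F V / 2" using F1[OF that] by (simp add: power_mult_distrib power2_eq_square)
    hence "(2/3 * sqrt (F V))\<^sup>2 \<le> 2 * G V" "(2/3 * sqrt (F V))\<^sup>2 \<le> 2 * H V" using GF[OF that] by linarith+
    thus "2/3 * sqrt (F V) \<le> sqrt (2 * G V)" "2/3 * sqrt (F V) \<le> sqrt (2 * H V)" using real_le_rsqrt by blast+
    show "sqrt (2 * H V) \<le> 2 * sqrt (F V)"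
      using GF[OF that] F1[OF that] by (intro real_le_lsqrt) (auto simp: power_mult_distrib)
  qed
  define X where "X = (\<lambda>V. \<bar>G V - H V\<bar>)"
  \<comment> \<open>Twice the initial difference: one half covers \<open>X S\<close> itself, the
    other half the contribution of the constant part of the bound on \<open>X\<close>.\<close>
  define \<alpha> where "\<alpha> = 2 * X S"
  have \<alpha>: "0 \<le> \<alpha>" by (simp add: \<alpha>_def X_def)
  have sdiff: "\<bar>sqrt (2 * G V) - sqrt (2 * H V)\<bar> \<le> 3/2 * X V / sqrt (F V)" if V: "S \<le> V" for V
  proof -
    have pos: "0 < sqrt (F V)" using F1[OF V] by simp
    have "\<bar>sqrt (2 * G V) - sqrt (2 * H V)\<bar> * (4/3 * sqrt (F V)) \<le> \<bar>sqrt (2 * G V) - sqrt (2 * H V)\<bar> * (sqrt (2 * G V) + sqrt (2 * H V))"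
      using sq[OF V] by (intro mult_left_mono) auto
    also have "\<dots> = \<bar>(sqrt (2 * G V) - sqrt (2 * H V)) * (sqrt (2 * G V) + sqrt (2 * H V))\<bar>"
      using GF[OF V] F1[OF V] by (simp add: abs_mult)
    also have "(sqrt (2 * G V) - sqrt (2 * H V)) * (sqrt (2 * G V) + sqrt (2 * H V)) = 2 * (G V - H V)"
      using GF[OF V] F1[OF V] by (simp add: algebra_simps)
    also have "\<bar>2 * (G V - H V)\<bar> = 2 * X V" by (simp only: X_def abs_mult abs_numeral)
    finally show ?thesis using pos by (simp add: field_simps)
  qed
  have idiff: "\<bar>1 / sqrt (2 * G V) - 1 / sqrt (2 * H V)\<bar> \<le> 3 * X V / (F V * sqrt (F V))" if V: "S \<le> V" for V
  proof -
    have pos: "0 < sqrt (2 * G V)" "0 < sqrt (2 * H V)" "0 < sqrt (F V)" using GF[OF V] F1[OF V] by auto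
    have prod: "F V / 2 \<le> sqrt (2 * G V) * sqrt (2 * H V)"
    proof -
      have "(F V / 2) * (F V / 2) \<le> (2 * G V) * (2 * H V)" using GF[OF V] F1[OF V] by (intro mult_mono) auto
      hence "F V / 2 \<le> sqrt ((2 * G V) * (2 * H V))" by (intro real_le_rsqrt) (simp add: power2_eq_square)
      thus ?thesis by (simp only: real_sqrt_mult)
    qed
    have "\<bar>1 / sqrt (2 * G V) - 1 / sqrt (2 * H V)\<bar> = \<bar>sqrt (2 * G V) - sqrt (2 * H V)\<bar> / (sqrt (2 * G V) * sqrt (2 * H V))"
    proof -
      have "1 / sqrt (2 * G V) - 1 / sqrt (2 * H V) = (1 * sqrt (2 * H V) - 1 * sqrt (2 * G V)) / (sqrt (2 * G V) * sqrt (2 * H V))"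
        using pos by (intro diff_frac_eq) auto
      thus ?thesis using pos by (simp add: abs_minus_commute)
    qed
    also have "\<dots> \<le> (3/2 * X V / sqrt (F V)) / (F V / 2)"
      using sdiff[OF V] prod F1[OF V] pos by (intro frac_le) (auto simp: X_def)
    also have "\<dots> = 3 * X V / (F V * sqrt (F V))" using F1[OF V] pos by (simp add: field_simps)
    finally show ?thesis .
  qed
  have dint: "(\<lambda>s. 1 / sqrt (F s)) integrable_on {V..}" if "S \<le> V" for V
    by (rule tail_integrable_subset[OF F_int inv_nonneg F1(4)[OF that]])
  have gi: "(\<lambda>s. 1 / sqrt (2 * G s)) integrable_on {V..}" "(\<lambda>s. 1 / sqrt (2 * H s)) integrable_on {V..}" if "S \<le> V" for V
    using tail_integrable_subset[OF g.G_int g.integrand_nonneg F1(3)[OF that]]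
      tail_integrable_subset[OF h.G_int h.integrand_nonneg F1(3)[OF that]] by simp_all
  have Ddiff: "\<bar>g.D V - h.D V\<bar> \<le> 3 * (\<alpha> / F V + \<beta>) * d V"
    if V: "S \<le> V" and X: "\<And>V. S \<le> V \<Longrightarrow> X V \<le> \<alpha> + \<beta> * F V" and \<beta>: "0 \<le> \<beta>" for V \<beta>
  proof -
    have "norm (integral {V..} (\<lambda>s. 1 / sqrt (2 * G s) - 1 / sqrt (2 * H s))) \<le> integral {V..} (\<lambda>s. 3 * (\<alpha> / F V + \<beta>) * (1 / sqrt (F s)))"
    proof (rule integral_norm_bound_integral)
      show "(\<lambda>s. 1 / sqrt (2 * G s) - 1 / sqrt (2 * H s)) integrable_on {V..}" by (rule integrable_diff[OF gi[OF V]])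
      show "(\<lambda>s. 3 * (\<alpha> / F V + \<beta>) * (1 / sqrt (F s))) integrable_on {V..}" by (rule integrable_on_mult_right[OF dint[OF V]])
      fix s assume "s \<in> {V..}"
      hence s: "S \<le> s" "V \<le> s" using V by auto
      have pos: "0 < sqrt (F s)" "0 < F s" "0 < F V" using F1[OF s(1)] F1[OF V] by auto
      have "norm (1 / sqrt (2 * G s) - 1 / sqrt (2 * H s)) \<le> 3 * X s / (F s * sqrt (F s))" using idiff[OF s(1)] by simp
      also have "\<dots> \<le> 3 * (\<alpha> + \<beta> * F s) / (F s * sqrt (F s))" using X[OF s(1)] pos by (intro divide_right_mono) auto
      also have "\<dots> = 3 * (\<alpha> / F s + \<beta>) * (1 / sqrt (F s))" using pos by (simp add: field_simps)
      also have "\<dots> \<le> 3 * (\<alpha> / F V + \<beta>) * (1 / sqrt (F s))"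
        using F_mono[OF F1(4)[OF V] s(2)] pos \<alpha> by (intro mult_right_mono mult_left_mono add_right_mono divide_left_mono) auto
      finally show "norm (1 / sqrt (2 * G s) - 1 / sqrt (2 * H s)) \<le> 3 * (\<alpha> / F V + \<beta>) * (1 / sqrt (F s))" .
    qed
    thus ?thesis unfolding g.D_def h.D_def d_def integral_mult_right integral_diff[OF gi[OF V]] by simp
  qed
  \<comment> \<open>The a priori bound \<open>X \<le> 2 F\<close> improves to \<open>X \<le> \<alpha>\<close> because each pass through the integral equation halves the coefficient of \<open>F\<close>.\<close>
  have step: "X V \<le> \<alpha> + \<beta> / 2 * F V"
    if X: "\<And>V. S \<le> V \<Longrightarrow> X V \<le> \<alpha> + \<beta> * F V" and \<beta>: "0 \<le> \<beta>" and V: "S \<le> V" for V \<beta>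
  proof -
    define \<omega> where "\<omega> = (\<lambda>s. n * sqrt (2 * H s) / max (1/2) (1 - h.D s) - n * sqrt (2 * G s) / max (1/2) (1 - g.D s))"
    have FTC: "(\<omega> has_integral ((G V - H V) - (G S - H S))) {S..V}"
    proof (rule fundamental_theorem_of_calculus[OF V])
      fix s assume "s \<in> {S..V}"
      hence s: "T < s" using ST by simp
      have "((\<lambda>s. G s - H s) has_real_derivative g.slope s - h.slope s) (at s)"
        by (rule DERIV_diff[OF g.G_slope[OF s] h.G_slope[OF s]])
      moreover have "g.slope s - h.slope s = \<omega> s" by (simp add: g.slope_def h.slope_def \<omega>_def)
      ultimately show "((\<lambda>s. G s - H s) has_vector_derivative \<omega> s) (at s within {S..V})"
        by (metis has_field_derivative_at_within has_real_derivative_iff_has_vector_derivative)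
    qed
    have wb: "\<bar>\<omega> s\<bar> \<le> 27 * n * (\<alpha> * (1 / sqrt (F s)) + \<beta> * sqrt (F V))" if "s \<in> {S..V}" for s
    proof -
      have s: "S \<le> s" "s \<le> V" using that by auto
      have pos: "0 < sqrt (F s)" "0 < F s" using F1[OF s(1)] by auto
      define \<rho> where "\<rho> = max (1/2) (1 - g.D s)"
      define \<rho>' where "\<rho>' = max (1/2) (1 - h.D s)"
      have \<rho>: "1/2 \<le> \<rho>" "1/2 \<le> \<rho>'" by (auto simp: \<rho>_def \<rho>'_def)
      have "\<bar>\<rho> - \<rho>'\<bar> \<le> \<bar>g.D s - h.D s\<bar>" by (auto simp: \<rho>_def \<rho>'_def max_def)
      also have "\<dots> \<le> 3 * (\<alpha> / F s + \<beta>) * d s" by (rule Ddiff[OF s(1) X \<beta>])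
      also have "\<dots> \<le> 3 * (\<alpha> / F s + \<beta>) * 1" using d1[OF s(1)] \<alpha> \<beta> pos by (intro mult_left_mono) auto
      finally have r: "\<bar>\<rho> - \<rho>'\<bar> \<le> 3 * (\<alpha> / F s + \<beta>)" by simp
      have "\<omega> s = n * ((sqrt (2 * H s) - sqrt (2 * G s)) / \<rho> + sqrt (2 * H s) * (\<rho> - \<rho>') / (\<rho> * \<rho>'))"
        unfolding \<omega>_def \<rho>_def[symmetric] \<rho>'_def[symmetric] using \<rho> by (simp add: field_simps)
      hence "\<bar>\<omega> s\<bar> = n * \<bar>(sqrt (2 * H s) - sqrt (2 * G s)) / \<rho> + sqrt (2 * H s) * (\<rho> - \<rho>') / (\<rho> * \<rho>')\<bar>"
        using n by (simp add: abs_mult)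
      also have "\<dots> \<le> n * (\<bar>sqrt (2 * G s) - sqrt (2 * H s)\<bar> / \<rho> + sqrt (2 * H s) * \<bar>\<rho> - \<rho>'\<bar> / (\<rho> * \<rho>'))"
      proof (rule mult_left_mono[OF _ n])
        have "\<bar>(sqrt (2 * H s) - sqrt (2 * G s)) / \<rho> + sqrt (2 * H s) * (\<rho> - \<rho>') / (\<rho> * \<rho>')\<bar>
          \<le> \<bar>(sqrt (2 * H s) - sqrt (2 * G s)) / \<rho>\<bar> + \<bar>sqrt (2 * H s) * (\<rho> - \<rho>') / (\<rho> * \<rho>')\<bar>" by (rule abs_triangle_ineq)
        also have "\<dots> = \<bar>sqrt (2 * G s) - sqrt (2 * H s)\<bar> / \<rho> + sqrt (2 * H s) * \<bar>\<rho> - \<rho>'\<bar> / (\<rho> * \<rho>')"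
          using \<rho> h.G_pos[OF F1(3)[OF s(1)]] by (simp add: abs_mult abs_minus_commute)
        finally show "\<bar>(sqrt (2 * H s) - sqrt (2 * G s)) / \<rho> + sqrt (2 * H s) * (\<rho> - \<rho>') / (\<rho> * \<rho>')\<bar>
          \<le> \<bar>sqrt (2 * G s) - sqrt (2 * H s)\<bar> / \<rho> + sqrt (2 * H s) * \<bar>\<rho> - \<rho>'\<bar> / (\<rho> * \<rho>')" .
      qed
      also have "\<dots> \<le> n * ((3/2 * (\<alpha> + \<beta> * F s) / sqrt (F s)) / (1/2) + (2 * sqrt (F s)) * (3 * (\<alpha> / F s + \<beta>)) / ((1/2) * (1/2)))"
      proof (rule mult_left_mono[OF _ n], intro add_mono frac_le)
        have "3/2 * X s / sqrt (F s) \<le> 3/2 * (\<alpha> + \<beta> * F s) / sqrt (F s)"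
          using X[OF s(1)] pos by (intro divide_right_mono) auto
        thus "\<bar>sqrt (2 * G s) - sqrt (2 * H s)\<bar> \<le> 3/2 * (\<alpha> + \<beta> * F s) / sqrt (F s)" using sdiff[OF s(1)] by linarith
        show "sqrt (2 * H s) * \<bar>\<rho> - \<rho>'\<bar> \<le> 2 * sqrt (F s) * (3 * (\<alpha> / F s + \<beta>))"
          using sq(3)[OF s(1)] r pos by (intro mult_mono) auto
        show "1/2 * (1/2) \<le> \<rho> * \<rho>'" using \<rho> by (intro mult_mono) auto
        show "0 \<le> 3/2 * (\<alpha> + \<beta> * F s) / sqrt (F s)" using \<alpha> \<beta> pos by simp
        show "0 \<le> 2 * sqrt (F s) * (3 * (\<alpha> / F s + \<beta>))" using \<alpha> \<beta> pos by simp
      qed (use \<rho> in auto)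
      also have "\<dots> = 27 * n * (\<alpha> * (1 / sqrt (F s)) + \<beta> * sqrt (F s))"
      proof -
        have "n * ((3/2 * (\<alpha> + \<beta> * (x * x)) / x) / (1/2) + (2 * x) * (3 * (\<alpha> / (x * x) + \<beta>)) / ((1/2) * (1/2)))
            = 27 * n * (\<alpha> * (1 / x) + \<beta> * x)" if "x > 0" for x :: real
          using that by (simp add: field_simps)
        from this[OF pos(1)] show ?thesis using pos by simp
      qed
      also have "\<dots> \<le> 27 * n * (\<alpha> * (1 / sqrt (F s)) + \<beta> * sqrt (F V))"
        using F_mono[OF F1(4)[OF s(1)] s(2)] n \<beta> by (intro mult_left_mono add_left_mono) auto
      finally show ?thesis .
    qed
    have i1: "(\<lambda>s. 1 / sqrt (F s)) integrable_on {S..V}" by (rule inv_interval[OF ST(2)])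
    have i2: "((\<lambda>s. 27 * n * (\<alpha> * (1 / sqrt (F s)) + \<beta> * sqrt (F V))) has_integral
        27 * n * (\<alpha> * integral {S..V} (\<lambda>s. 1 / sqrt (F s)) + \<beta> * sqrt (F V) * (V - S))) {S..V}"
      using has_integral_const_real[of "\<beta> * sqrt (F V)" S V] V
      by (intro has_integral_mult_right has_integral_add integrable_integral i1) (simp add: mult.commute)
    have "norm (integral {S..V} \<omega>) \<le> integral {S..V} (\<lambda>s. 27 * n * (\<alpha> * (1 / sqrt (F s)) + \<beta> * sqrt (F V)))"
      by (rule integral_norm_bound_integral[OF has_integral_integrable[OF FTC] has_integral_integrable[OF i2]]) (use wb in auto)
    hence "\<bar>(G V - H V) - (G S - H S)\<bar> \<le> 27 * n * (\<alpha> * integral {S..V} (\<lambda>s. 1 / sqrt (F s)) + \<beta> * sqrt (F V) * (V - S))"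
      unfolding integral_unique[OF FTC] integral_unique[OF i2] by simp
    also have "\<dots> \<le> 27 * n * (\<alpha> * d S + \<beta> * sqrt (F V) * (V - S))"
      using d_split[OF ST(2) V] d1[OF V] \<alpha> n by (intro mult_left_mono add_right_mono) auto
    also have "\<dots> = \<alpha> * (27 * n * d S) + \<beta> * sqrt (F V) * (27 * n * (V - S))" by (simp add: algebra_simps)
    also have "\<dots> \<le> \<alpha> * (1/2) + \<beta> * sqrt (F V) * (1/2 * sqrt (F V))"
      using dS gr[OF V] \<alpha> \<beta> F1[OF V] by (intro add_mono mult_left_mono) auto
    also have "\<dots> = X S + \<beta> / 2 * F V" using F1[OF V] by (simp add: \<alpha>_def)
    finally have "\<bar>(G V - H V) - (G S - H S)\<bar> \<le> X S + \<beta> / 2 * F V" .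
    moreover have "X V \<le> \<bar>(G V - H V) - (G S - H S)\<bar> + X S"
      using abs_triangle_ineq[of "(G V - H V) - (G S - H S)" "G S - H S"] by (simp add: X_def)
    ultimately have "X V \<le> (X S + \<beta> / 2 * F V) + X S" by linarith
    thus ?thesis by (simp add: \<alpha>_def)
  qed
  have iter: "\<forall>V\<ge>S. X V \<le> \<alpha> + 2 / 2 ^ k * F V" for k :: nat
  proof (induction k)
    case 0
    have "X V \<le> 2 * F V" if "S \<le> V" for V using GF[OF that] F1[OF that] by (simp add: X_def abs_le_iff)
    thus ?case using \<alpha> by force
  next
    case (Suc k)
    show ?case using step[of "2 / 2 ^ k"] Suc by simp
  qed
  have Xle: "X V \<le> \<alpha> + 0 * F V" if V: "S \<le> V" for V
  proof -
    have "(\<lambda>k::nat. \<alpha> + 2 / 2 ^ k * F V) \<longlonglongrightarrow> \<alpha> + 0 * F V"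
    proof (intro tendsto_intros)
      have "(\<lambda>k::nat. 2 * (1/2) ^ k) \<longlonglongrightarrow> (2::real) * 0" by (intro tendsto_intros LIMSEQ_power_zero) simp
      thus "(\<lambda>k::nat. 2 / 2 ^ k) \<longlonglongrightarrow> (0::real)" by (simp add: power_divide)
    qed
    thus ?thesis by (rule LIMSEQ_le_const) (use iter V in auto)
  qed
  show ?thesis
  proof (rule that[of S "3 * \<alpha>"])
    show "T < S" by (rule ST)
    show "0 \<le> 3 * \<alpha>" using \<alpha> by simp
    show "1 \<le> F V" "H V \<le> 2 * F V" if "S \<le> V" for V using F1[OF that] GF[OF that] by auto
    fix V assume V: "S \<le> V"
    have Fi: "(\<lambda>s. 1 / F s) integrable_on {V..}" by (rule inv_F_int[OF F1(4)[OF V]])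
    have "norm (integral {V..} (\<lambda>s. 1 / sqrt (2 * G s) - 1 / sqrt (2 * H s))) \<le> integral {V..} (\<lambda>s. 3 * \<alpha> / sqrt (F V) * (1 / F s))"
    proof (rule integral_norm_bound_integral)
      show "(\<lambda>s. 1 / sqrt (2 * G s) - 1 / sqrt (2 * H s)) integrable_on {V..}" by (rule integrable_diff[OF gi[OF V]])
      show "(\<lambda>s. 3 * \<alpha> / sqrt (F V) * (1 / F s)) integrable_on {V..}" by (rule integrable_on_mult_right[OF Fi])
      fix s assume "s \<in> {V..}"
      hence s: "S \<le> s" "V \<le> s" using V by auto
      have pos: "0 < sqrt (F s)" "0 < F s" "0 < F V" using F1[OF s(1)] F1[OF V] by auto
      have "norm (1 / sqrt (2 * G s) - 1 / sqrt (2 * H s)) \<le> 3 * X s / (F s * sqrt (F s))" using idiff[OF s(1)] by simp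
      also have "\<dots> \<le> 3 * \<alpha> / (F s * sqrt (F V))"
        using Xle[OF s(1)] pos F_mono[OF F1(4)[OF V] s(2)] \<alpha> by (intro frac_le mult_left_mono mult_pos_pos) (auto simp: X_def)
      also have "\<dots> = 3 * \<alpha> / sqrt (F V) * (1 / F s)" by (simp add: mult.commute)
      finally show "norm (1 / sqrt (2 * G s) - 1 / sqrt (2 * H s)) \<le> 3 * \<alpha> / sqrt (F V) * (1 / F s)" .
    qed
    also have "\<dots> = 3 * \<alpha> * (phi f V / sqrt (F V))" unfolding integral_mult_right phi_def by simp
    finally show "g.D V \<le> h.D V + 3 * \<alpha> * (phi f V / sqrt (F V))"
      unfolding g.D_def h.D_def integral_diff[OF gi[OF V]] by (simp add: abs_le_iff)
  qed
qed

section \<open>The error term \<open>theta\<close>\<close>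

lemma inv_F_nonneg: "b \<le> s \<Longrightarrow> 0 \<le> 1 / F s" using F_pos[of s] by simp

lemma phi_nonneg: "b \<le> V \<Longrightarrow> 0 \<le> phi f V"
  unfolding phi_def by (rule tail_integral_nonneg[OF inv_F_int[OF order_refl] inv_F_nonneg])

lemma phi_antimono: "b \<le> V \<Longrightarrow> V \<le> V' \<Longrightarrow> phi f V' \<le> phi f V"
  unfolding phi_def by (rule tail_integral_antimono[OF inv_F_int[OF order_refl] inv_F_nonneg])

lemma phi_split: "b \<le> V \<Longrightarrow> V \<le> V' \<Longrightarrow> phi f V = integral {V..V'} (\<lambda>s. 1 / F s) + phi f V'"
  unfolding phi_def by (rule tail_integral_split[OF inv_F_int[OF order_refl] inv_F_nonneg])

lemma phi_tendsto: "(phi f \<longlongrightarrow> 0) at_top"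
  unfolding phi_def[abs_def] by (rule tail_integral_tendsto_0[OF inv_F_int[OF order_refl] inv_F_nonneg])

lemma phi_le_d:
  assumes "b \<le> V"
  shows "phi f V \<le> d V / sqrt (F V)"
proof -
  have "phi f V \<le> integral {V..} (\<lambda>s. 1 / sqrt (F V) * (1 / sqrt (F s)))"
    unfolding phi_def using inv_F_le[OF assms]
    by (intro integral_le inv_F_int[OF assms] integrable_on_mult_right tail_integrable_subset[OF F_int inv_nonneg assms]) auto
  also have "\<dots> = 1 / sqrt (F V) * d V" unfolding d_def by (rule integral_mult_right)
  finally show ?thesis by simp
qed

text \<open>The error of the boundary estimate; condition (iv) says that
  \<open>t powr ((p - 1) / 2) * theta t\<close> tends to 0.\<close>

definition theta where "theta V = phi f V / sqrt (F V)"

lemma theta_antimono: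
  assumes "b \<le> V" "V \<le> V'"
  shows "theta V' \<le> theta V"
  unfolding theta_def
  using phi_antimono[OF assms] phi_nonneg[of V'] F_mono[OF assms] F_pos[OF assms(1)] assms by (intro frac_le) auto

text \<open>The part of \<open>phi\<close> between \<open>t\<close> and \<open>2 * t\<close> is at
  most the integral divided by \<open>sqrt (F t)\<close>; the rest is at most
  \<open>d (2 * t) / sqrt (F (2 * t))\<close>, again a small multiple of the integral because the
  interval has length at least 1. This later prevents \<open>u\<close> from doubling within a
  distance comparable with \<open>theta t\<close>.\<close>

lemma theta_small:
  assumes \<kappa>: "\<kappa> > 0"
  shows "\<forall>\<^sub>F t in at_top. theta t \<le> \<kappa> * integral {t..2 * t} (\<lambda>s. 1 / sqrt (F s))"
proof -
  have "\<forall>\<^sub>F t in at_top. d t < \<kappa> / 2" by (rule order_tendstoD(2)[OF d_tendsto]) (use \<kappa> in simp)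
  then obtain M where M: "\<And>t. M \<le> t \<Longrightarrow> d t < \<kappa> / 2" unfolding eventually_at_top_linorder by blast
  have "\<forall>\<^sub>F t in at_top. max 1 (2 / \<kappa>) \<le> F t" by (rule F_large)
  thus ?thesis using eventually_ge_at_top[of "max (max b 1) M"]
  proof eventually_elim
    case (elim t)
    define I where "I = integral {t..2 * t} (\<lambda>s. 1 / sqrt (F s))"
    have t: "b \<le> t" "1 \<le> t" "t \<le> 2 * t" "b \<le> 2 * t" "M \<le> 2 * t" using elim by auto
    have Ft: "1 \<le> F t" "2 / \<kappa> \<le> F t" "1 \<le> sqrt (F t)" using elim by auto
    have "integral {t..2 * t} (\<lambda>s. 1 / F s) \<le> integral {t..2 * t} (\<lambda>s. 1 / sqrt (F t) * (1 / sqrt (F s)))"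
    proof (rule integral_le)
      show "(\<lambda>s. 1 / F s) integrable_on {t..2 * t}"
        by (rule integrable_on_subinterval[OF inv_F_int[OF t(1)]]) auto
      show "(\<lambda>s. 1 / sqrt (F t) * (1 / sqrt (F s))) integrable_on {t..2 * t}"
        by (intro integrable_on_mult_right inv_interval t)
    qed (use inv_F_le[OF t(1)] in auto)
    also have "\<dots> = 1 / sqrt (F t) * I" unfolding I_def by (rule integral_mult_right)
    finally have 1: "integral {t..2 * t} (\<lambda>s. 1 / F s) \<le> 1 / sqrt (F t) * I" .
    have "1 / sqrt (F (2 * t)) \<le> (2 * t - t) / sqrt (F (2 * t))"
      using t F_pos[OF t(4)] by (intro divide_right_mono) auto
    also have "\<dots> \<le> I" unfolding I_def by (rule inv_integral_ge[OF t(1,3)])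
    finally have I: "1 / sqrt (F (2 * t)) \<le> I" .
    have I0: "0 \<le> I" using I F_pos[OF t(4)] by (meson divide_nonneg_pos order_trans real_sqrt_gt_zero zero_le_one)
    have "phi f (2 * t) \<le> d (2 * t) * (1 / sqrt (F (2 * t)))" using phi_le_d[OF t(4)] by simp
    also have "\<dots> \<le> (\<kappa> / 2) * I"
      using M[OF t(5)] I \<kappa> d_nonneg[OF t(4)] F_pos[OF t(4)] by (intro mult_mono) auto
    finally have 2: "phi f (2 * t) \<le> (\<kappa> / 2) * I" .
    have "phi f t \<le> 1 / sqrt (F t) * I + \<kappa> / 2 * I" using phi_split[OF t(1,3)] 1 2 by linarith
    hence "theta t \<le> (1 / sqrt (F t) * I + \<kappa> / 2 * I) / sqrt (F t)"
      unfolding theta_def using Ft by (intro divide_right_mono) auto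
    also have "\<dots> = 1 / F t * I + (\<kappa> / 2 * I) / sqrt (F t)" using Ft by (simp add: add_divide_distrib)
    also have "\<dots> \<le> \<kappa> / 2 * I + \<kappa> / 2 * I"
    proof (intro add_mono mult_right_mono I0)
      show "1 / F t \<le> \<kappa> / 2" using Ft \<kappa> by (simp add: field_simps)
      have "(\<kappa> / 2 * I) / sqrt (F t) \<le> (\<kappa> / 2 * I) / 1" using Ft \<kappa> I0 by (intro divide_left_mono) auto
      thus "(\<kappa> / 2 * I) / sqrt (F t) \<le> \<kappa> / 2 * I" by simp
    qed
    finally show ?case unfolding I_def by simp
  qed
qed

end

section \<open>Boundary asymptotics\<close>

lemma powr_diff_le:
  fixes a c p :: real
  assumes "0 < a" "a \<le> c" "1 < p"
  shows "c powr p - a powr p \<le> p * c powr (p - 1) * (c - a)"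
proof (cases "a = c")
  case False
  hence "a < c" using assms by simp
  moreover have "((\<lambda>x. x powr p) has_real_derivative p * x powr (p - 1)) (at x)" if "a \<le> x" for x
    using assms that by (intro has_real_derivative_powr) auto
  ultimately obtain z where z: "a < z" "z < c" "c powr p - a powr p = (c - a) * (p * z powr (p - 1))"
    using MVT2[of a c "\<lambda>x. x powr p" "\<lambda>x. p * x powr (p - 1)"] by blast
  have "(c - a) * (p * z powr (p - 1)) \<le> (c - a) * (p * c powr (p - 1))"
    using z assms by (intro mult_left_mono powr_mono2) auto
  thus ?thesis using z(3) by (simp add: mult_ac)
qed simp

locale asymptotics = large_solution f u + keller_osserman f b
  for f :: "real \<Rightarrow> real" and u :: "'a::euclidean_space \<Rightarrow> real" and b :: real
begin

lemma u_bounded_inside: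
  assumes "r < 1"
  obtains M where "\<And>x. norm x \<le> r \<Longrightarrow> u x \<le> M"
proof -
  have "continuous_on (cball 0 r) u" using assms by (intro u_cont) auto
  hence "bounded (u ` cball 0 r)" using compact_continuous_image compact_imp_bounded compact_cball by blast
  then obtain M where "\<forall>x\<in>cball 0 r. \<bar>u x\<bar> \<le> M" unfolding bounded_iff by auto
  thus ?thesis by (intro that[of M]) force
qed

text \<open>The point closest to the origin where the level \<open>T\<close> is reached. On its
  sphere \<open>u\<close> cannot exceed \<open>T\<close>, since otherwise a point slightly further
  in on the same ray would reach \<open>T\<close>. The alternative \<open>u 0 \<ge> T\<close> is
  discarded later by taking \<open>T\<close> above the inner values.\<close>

lemma first_contact:
  obtains x1 where "x1 \<in> ball 0 1" "u x1 = T" "\<And>x. x \<in> ball 0 1 \<Longrightarrow> T \<le> u x \<Longrightarrow> norm x1 \<le> norm x"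
    "\<And>x. norm x = norm x1 \<Longrightarrow> u x \<le> T" | "u 0 \<ge> T"
proof (cases "u 0 \<ge> T")
  case False
  obtain r where r: "r < 1" "\<forall>x\<in>ball 0 1. r < norm x \<longrightarrow> T < u x" using large by blast
  obtain e :: 'a where e: "e \<in> Basis" using nonempty_Basis by blast
  define z where "z = ((max r 0 + 1) / 2) *\<^sub>R e"
  have nz: "norm z = (max r 0 + 1) / 2" using e by (simp add: z_def)
  have z: "z \<in> ball 0 1" "r < norm z" using r nz by auto
  have uz: "T < u z" using r(2) z by blast
  define K where "K = {y \<in> cball 0 (norm z). T \<le> u y}"
  have "compact K"
  proof -
    have "continuous_on (cball 0 (norm z)) u" using z by (intro u_cont) auto
    hence "closed (cball 0 (norm z) \<inter> u -` {T..})" by (intro continuous_closed_preimage) auto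
    moreover have "K = cball 0 (norm z) \<inter> (cball 0 (norm z) \<inter> u -` {T..})" by (auto simp: K_def)
    ultimately show ?thesis by (metis compact_Int_closed compact_cball)
  qed
  moreover have zK: "z \<in> K" using uz by (simp add: K_def)
  ultimately obtain x1 where x1: "x1 \<in> K" "\<And>y. y \<in> K \<Longrightarrow> norm x1 \<le> norm y"
    using continuous_attains_inf[of K norm] continuous_on_norm_id by blast
  have x1b: "x1 \<in> ball 0 1" "T \<le> u x1" using x1(1) z by (auto simp: K_def)
  have min: "norm x1 \<le> norm x" if "x \<in> ball 0 1" "T \<le> u x" for x
    using x1(2)[of x] x1(2)[OF zK] that by (cases "norm x \<le> norm z") (auto simp: K_def)
  have le: "u x \<le> T" if x: "norm x = norm x1" for x
  proof (rule ccontr)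
    assume "\<not> u x \<le> T"
    have xb: "x \<in> ball 0 1" using x x1b by simp
    have "((\<lambda>t::real. t *\<^sub>R x) \<longlongrightarrow> 1 *\<^sub>R x) (at_left 1)" by (intro tendsto_intros)
    hence "((\<lambda>t. u (t *\<^sub>R x)) \<longlongrightarrow> u x) (at_left 1)"
      using isCont_tendsto_compose[OF u_isCont[OF xb], of "\<lambda>t. t *\<^sub>R x" "at_left 1"] by simp
    hence "\<forall>\<^sub>F t in at_left 1. T < u (t *\<^sub>R x)" by (rule order_tendstoD) (use \<open>\<not> u x \<le> T\<close> in simp)
    moreover have "\<forall>\<^sub>F t in at_left 1. t \<in> {0<..<1::real}" by (rule eventually_at_left_real) simp
    ultimately have "\<forall>\<^sub>F t in at_left (1::real). False"
    proof eventually_elim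
      case (elim t)
      have x0: "0 < norm x" using False x1b(2) x by auto
      have nt: "norm (t *\<^sub>R x) < norm x" using elim x0 by simp
      hence "norm x1 \<le> norm (t *\<^sub>R x)" using elim xb by (intro min) auto
      thus False using nt x by simp
    qed
    thus False by simp
  qed
  hence "u x1 = T" using x1b(2) by (simp add: antisym)
  thus ?thesis using that(1)[OF x1b(1) _ min le] by blast
qed (use that in blast)

text \<open>\<open>D\<close> belongs to the profile of large energy; the upper bound comes from the
  profile of small energy, whose depth is replaced by \<open>D\<close> at the cost of
  \<open>C * theta\<close>. The last clause, a consequence of \<open>H \<le> 2 * F\<close>, lets
  differences of \<open>D\<close> be read as Keller-Osserman integrals.\<close>

lemma two_sided:
  "\<exists>S D C. b \<le> S \<and> (\<forall>V\<ge>S. 1 \<le> F V) \<and> 0 \<le> C \<and>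
    (\<forall>x\<in>ball 0 1. S \<le> u x \<longrightarrow> D (u x) \<le> 1 - norm x \<and> 1 - norm x \<le> D (u x) + C * theta (u x)) \<and>
    (\<forall>V V'. S \<le> V \<longrightarrow> V \<le> V' \<longrightarrow> integral {V..V'} (\<lambda>s. 1 / sqrt (F s)) \<le> 2 * (D V - D V'))"
proof -
  define N where "N = real DIM('a)"
  have N: "N \<ge> 1" using DIM_ge_Suc0[where 'a='a] unfolding N_def by linarith
  define r0 where "r0 = 1 - 1 / (16 * real DIM('a))"
  have "1 / (16 * N) \<le> 1/16" "0 < 1 / (16 * N)" using N by (simp_all add: field_simps)
  hence r0: "r0 < 1" "0 < r0" unfolding N_def r0_def by linarith+
  obtain U0 where U0: "\<And>x. norm x \<le> r0 \<Longrightarrow> u x \<le> U0" using u_bounded_inside[OF r0(1)] by blast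
  \<comment> \<open>\<open>b + 1\<close> makes \<open>b < T\<close> strict, as
    \<open>boundary_slope\<close> requires, and \<open>U0 + 1\<close> moves the first contact beyond
    the radius \<open>r0\<close>.\<close>
  define A0 where "A0 = max (b + 1) (U0 + 1)"
  have "16 * N > 0" "b \<le> A0" using N by (auto simp: A0_def)
  from good_level[OF this] obtain T where T: "A0 \<le> T" "\<And>V. T \<le> V \<Longrightarrow> (16 * N * (V - T))\<^sup>2 \<le> F V - F T" by blast
  have Tb: "b < T" "b \<le> T" "U0 < T" using T(1) by (auto simp: A0_def)
  have T': "\<And>V. T \<le> V \<Longrightarrow> (16 * ((real DIM('a) - 1) + 1) * (V - T))\<^sup>2 \<le> F V - F T" using T(2) by (simp add: N_def)
  have n: "0 \<le> real DIM('a) - 1" using N by (simp add: N_def)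
  have "\<not> u 0 \<ge> T" using U0[of 0] r0 Tb by auto
  then obtain x1 where x1: "x1 \<in> ball 0 1" "u x1 = T" "\<And>x. x \<in> ball 0 1 \<Longrightarrow> T \<le> u x \<Longrightarrow> norm x1 \<le> norm x"
    "\<And>x. norm x = norm x1 \<Longrightarrow> u x \<le> T" using first_contact by metis
  define r1 where "r1 = norm x1"
  have r1: "r1 < 1" "r0 < r1" using x1(1,2) U0[of x1] Tb by (auto simp: r1_def not_le[symmetric])
  obtain \<sigma> where \<sigma>: "\<sigma> > 0" "\<And>r. r1 < r \<Longrightarrow> r < 1 \<Longrightarrow> \<exists>x. norm x = r \<and> T + \<sigma> * (r - r1) \<le> u x"
    by (rule boundary_slope[of b T r0 U0 x1 r1]) (use f_nonneg Tb U0 x1 r1 in \<open>auto simp: r0_def r1_def\<close>)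
  \<comment> \<open>The initial speed becomes \<open>sqrt (2 * A) = \<sigma> / sqrt 2\<close>,
    strictly below the growth rate \<open>\<sigma>\<close> of the spherical maximum.\<close>
  define A where "A = \<sigma>\<^sup>2 / 4"
  have A: "A > 0" using \<sigma> by (simp add: A_def)
  obtain G where G: "radial_profile f G T (real DIM('a) - 1)" "G T = A" "\<And>V. T \<le> V \<Longrightarrow> (A + F V - F T) / 2 \<le> G V"
    "\<And>V. T \<le> V \<Longrightarrow> G V \<le> A + F V - F T"
    using profile_at_level[OF Tb(2) T' A n] by blast
  have f0: "\<And>t. T \<le> t \<Longrightarrow> 0 \<le> f t" using f_nonneg Tb by simp
  interpret g: comparison f u G T
    by (intro comparison.intro comparison_axioms.intro large_solution_axioms G(1) f0)
  have "2 * A < \<sigma>\<^sup>2" using \<sigma> by (simp add: A_def)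
  hence "sqrt (2 * G T) < \<sigma>" unfolding G(2) using \<sigma>(1) by (simp add: real_less_lsqrt)
  hence upper: "1 - norm x \<le> g.D (u x)" if "x \<in> ball 0 1" "T \<le> u x" for x
    using g.upper_bound[of r1 \<sigma> x] r1 x1(3,4) \<sigma>(2) that by (auto simp: r0_def r1_def)
  obtain r' where r': "r' < 1" "\<forall>x\<in>ball 0 1. r' < norm x \<longrightarrow> T < u x" using large by blast
  define r2 where "r2 = max r0 ((r' + 1) / 2)"
  have r2: "r0 \<le> r2" "r2 < 1" "r' < r2" using r' r0 by (auto simp: r2_def less_max_iff_disj)
  obtain B where B: "B > 0" "\<And>G n. radial_profile f G T n \<Longrightarrow> (\<And>V. T \<le> V \<Longrightarrow> (B + F V - F T) / 2 \<le> G V) \<Longrightarrow>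
    radial_profile.D G T \<le> 1 - r2"
    using depth_small[OF Tb(2), of "1 - r2"] r2 by auto
  obtain H where H: "radial_profile f H T (real DIM('a) - 1)" "H T = B" "\<And>V. T \<le> V \<Longrightarrow> (B + F V - F T) / 2 \<le> H V"
    "\<And>V. T \<le> V \<Longrightarrow> H V \<le> B + F V - F T"
    using profile_at_level[OF Tb(2) T' B(1) n] by blast
  interpret h: comparison f u H T
    by (intro comparison.intro comparison_axioms.intro large_solution_axioms H(1) f0)
  have "h.D T \<le> 1 - r2" by (rule B(2)[OF H(1,3)])
  hence lower: "h.D (u x) \<le> 1 - norm x" if "x \<in> ball 0 1" "r2 \<le> norm x" for x
    using h.lower_bound[of r2 x] r2 r'(2) that by (auto simp: r0_def)
  obtain S C where SC: "T < S" "C \<ge> 0" "\<And>V. S \<le> V \<Longrightarrow> 1 \<le> F V" "\<And>V. S \<le> V \<Longrightarrow> H V \<le> 2 * F V"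
    "\<And>V. S \<le> V \<Longrightarrow> g.D V \<le> h.D V + C * (phi f V / sqrt (F V))"
    using profile_difference[OF Tb(2) n G(1) H(1) A B(1) G(3,4) H(3,4)] by blast
  obtain M where M: "\<And>x. norm x \<le> r2 \<Longrightarrow> u x \<le> M" using u_bounded_inside[OF r2(2)] by blast
  \<comment> \<open>Above all values of \<open>u\<close> on the ball of radius \<open>r2\<close>, so
    that \<open>S' \<le> u x\<close> places \<open>x\<close> in the shell where the lower bound
    holds.\<close>
  define S' where "S' = max S (M + 1)"
  have S': "S \<le> S'" "M < S'" by (auto simp: S'_def)
  show ?thesis
  proof (rule exI[of _ S'], rule exI[of _ h.D], rule exI[of _ C], intro conjI allI ballI impI)
    show "b \<le> S'" using S' SC Tb by simp
    show "1 \<le> F V" if "S' \<le> V" for V using SC(3) S' that by simp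
    show "0 \<le> C" by (rule SC)
    show "h.D (u x) \<le> 1 - norm x" if "x \<in> ball 0 1" "S' \<le> u x" for x
      using M[of x] S' that by (intro lower) force+
    show "1 - norm x \<le> h.D (u x) + C * theta (u x)" if "x \<in> ball 0 1" "S' \<le> u x" for x
      using upper[OF that(1)] SC(5)[of "u x"] SC(1) S' that unfolding theta_def by simp
    fix V V' assume V: "S' \<le> V" "V \<le> V'"
    have vb: "T \<le> V" "b \<le> V" using V S' SC Tb by auto
    have "integral {V..V'} (\<lambda>s. 1 / sqrt (F s)) \<le> integral {V..V'} (\<lambda>s. 2 * (1 / sqrt (2 * H s)))"
    proof (rule integral_le[OF inv_interval[OF vb(2)]])
      show "(\<lambda>s. 2 * (1 / sqrt (2 * H s))) integrable_on {V..V'}"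
        using vb by (intro integrable_on_mult_right integrable_continuous_real continuous_on_subset[OF h.integrand_cont]) auto
      fix s assume "s \<in> {V..V'}"
      hence s: "S \<le> s" "T \<le> s" using V S' vb by auto
      have F: "0 < F s" using SC(3)[OF s(1)] by simp
      have "sqrt (2 * H s) \<le> sqrt (4 * F s)" using SC(4)[OF s(1)] by simp
      also have "\<dots> = 2 * sqrt (F s)" by (simp add: real_sqrt_mult)
      finally have "1 / (2 * sqrt (F s)) \<le> 1 / sqrt (2 * H s)"
        using h.G_pos[OF s(2)] F by (intro divide_left_mono) auto
      thus "1 / sqrt (F s) \<le> 2 * (1 / sqrt (2 * H s))" by simp
    qed
    also have "\<dots> = 2 * (h.D V - h.D V')" unfolding integral_mult_right using h.D_split[OF vb(1) V(2)] by simp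
    finally show "integral {V..V'} (\<lambda>s. 1 / sqrt (F s)) \<le> 2 * (h.D V - h.D V')" .
  qed
qed

section \<open>Estimates for reversed pairs\<close>

text \<open>Supplies the two inputs of \<open>moving_plane\<close>. For the first, the drop of
  \<open>D\<close> is turned into a difference of values. For the second, the radial gain bounds
  \<open>s\<close> by a multiple of \<open>theta\<close>, and (iii) with the mean value theorem
  bounds the coefficient, so that \<open>Q * s\<^sup>2\<close> is at most a constant times the
  square of the quotient in (iv).\<close>

lemma reversal_estimates:
  assumes p: "1 < p" "0 < K" "mono_on {Tm..} (\<lambda>t. f t + K * t powr p)"
    and lim: "((\<lambda>t. t powr ((p - 1) / 2) * phi f t / sqrt (F t)) \<longlongrightarrow> 0) at_top"
  shows "\<epsilon> > 0 \<Longrightarrow> \<exists>t. \<forall>x\<in>ball 0 1. \<forall>y\<in>ball 0 1.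
          norm y \<le> norm x \<and> t \<le> u x \<and> u x < u y \<longrightarrow> u y - u x < \<epsilon>" (is "_ \<Longrightarrow> ?defect \<epsilon>")
    and "c > 0 \<Longrightarrow> \<epsilon> > 0 \<Longrightarrow> \<exists>t. \<forall>x0\<in>ball 0 1. \<forall>y0\<in>ball 0 1. \<forall>s>0.
          c * s \<le> norm x0 - norm y0 \<and> t \<le> u x0 \<and> u x0 < u y0 \<longrightarrow>
          (\<exists>Q\<ge>0. Q * s\<^sup>2 \<le> \<epsilon> \<and> (\<forall>x\<in>ball 0 1. \<forall>y\<in>ball 0 1.
             norm (x - x0) \<le> 4 * real DIM('a) * s \<and> norm (y - y0) \<le> 4 * real DIM('a) * s \<and> u x < u y \<longrightarrow>
             - Q * (u y - u x) \<le> f (u y) - f (u x)))" (is "_ \<Longrightarrow> _ \<Longrightarrow> ?narrow c \<epsilon>")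
proof -
  obtain S D C where SDC: "b \<le> S" "\<forall>V\<ge>S. 1 \<le> F V" "0 \<le> C"
    "\<forall>x\<in>ball 0 1. S \<le> u x \<longrightarrow> D (u x) \<le> 1 - norm x \<and> 1 - norm x \<le> D (u x) + C * theta (u x)"
    "\<forall>V V'. S \<le> V \<longrightarrow> V \<le> V' \<longrightarrow> integral {V..V'} (\<lambda>s. 1 / sqrt (F s)) \<le> 2 * (D V - D V')"
    using two_sided by (elim exE conjE) (rule that)
  have S: "b \<le> S" "\<And>V. S \<le> V \<Longrightarrow> 1 \<le> F V" "0 \<le> C" using SDC(1-3) by auto
  have lo: "D (u x) \<le> 1 - norm x" and up: "1 - norm x \<le> D (u x) + C * theta (u x)"
    if "x \<in> ball 0 1" "S \<le> u x" for x using SDC(4) that by auto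
  have I: "integral {V..V'} (\<lambda>s. 1 / sqrt (F s)) \<le> 2 * (D V - D V')" if "S \<le> V" "V \<le> V'" for V V'
    using SDC(5) that by blast
  have Ipos: "(V' - V) / sqrt (F V') \<le> 2 * (D V - D V')" if "S \<le> V" "V \<le> V'" for V V'
    using inv_integral_ge[of V V'] I[OF that] S(1) that by linarith
  have Dmono: "D V' \<le> D V" if "S \<le> V" "V \<le> V'" for V V'
  proof -
    have "0 \<le> (V' - V) / sqrt (F V')" using that S(2)[of V'] by (intro divide_nonneg_nonneg) auto
    hence "0 \<le> 2 * (D V - D V')" using Ipos[OF that] by (rule order_trans)
    thus ?thesis by simp
  qed
  \<comment> \<open>The lower bound at \<open>x\<close> and the upper bound at \<open>y\<close> are
    subtracted. For a reversal both the radial gain and the drop of \<open>D\<close> are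
    nonnegative, so each alone is controlled by the error at the larger value.\<close>
  have rev: "norm x - norm y + (D (u x) - D (u y)) \<le> C * theta (u y)"
    if "x \<in> ball 0 1" "y \<in> ball 0 1" "S \<le> u x" "u x \<le> u y" for x y
    using lo[of x] up[of y] that by simp
  show "?defect \<epsilon>" if \<epsilon>: "\<epsilon> > 0"
  proof -
    have "((\<lambda>t. 2 * C * phi f t) \<longlongrightarrow> 2 * C * 0) at_top" by (intro tendsto_intros phi_tendsto)
    hence "\<forall>\<^sub>F t in at_top. 2 * C * phi f t < \<epsilon>" by (rule order_tendstoD) (use \<epsilon> in simp)
    then obtain M where M: "\<And>t. M \<le> t \<Longrightarrow> 2 * C * phi f t < \<epsilon>" unfolding eventually_at_top_linorder by blast
    show ?thesis
    proof (intro exI[of _ "max M S"] ballI impI, elim conjE)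
      fix x y :: 'a assume xy: "x \<in> ball 0 1" "y \<in> ball 0 1" "norm y \<le> norm x" "max M S \<le> u x" "u x < u y"
      have F: "0 < sqrt (F (u y))" using S(2)[of "u y"] xy by simp
      have "(u y - u x) / sqrt (F (u y)) \<le> 2 * (D (u x) - D (u y))" using xy by (intro Ipos) auto
      also have "\<dots> \<le> 2 * (C * theta (u y))" using rev[of x y] xy by simp
      also have "\<dots> = (2 * C * phi f (u y)) / sqrt (F (u y))" by (simp add: theta_def)
      finally have "u y - u x \<le> 2 * C * phi f (u y)" using F by (simp add: divide_le_cancel)
      also have "\<dots> < \<epsilon>" using xy by (intro M) auto
      finally show "u y - u x < \<epsilon>" .
    qed
  qed
  show "?narrow c \<epsilon>" if c: "c > 0" and \<epsilon>: "\<epsilon> > 0"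
  proof -
    define N where "N = real DIM('a)"
    have N: "N \<ge> 1" using DIM_ge_Suc0[where 'a='a] unfolding N_def by linarith
    define C1 where "C1 = C / c"
    have C1: "0 \<le> C1" using S(3) c by (simp add: C1_def)
    \<comment> \<open>Collects the error of the upper bound and the radial displacement between
      \<open>y0\<close> and a nearby \<open>y\<close>.\<close>
    define C2 where "C2 = C + 4 * N * C1"
    have C2: "0 \<le> C2" using S(3) C1 N by (simp add: C2_def)
    obtain r' where r': "r' < 1" "\<forall>x\<in>ball 0 1. r' < norm x \<longrightarrow> max Tm 1 < u x" using large by blast
    \<comment> \<open>\<open>x0\<close> will lie within \<open>\<delta>\<close> of the sphere and
      \<open>4 * N * s\<close> will be below \<open>\<delta>\<close>, so each nearby
      \<open>x\<close> has norm above \<open>r'\<close>, where \<open>u x\<close> is positive and in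
      the range of (iii).\<close>
    define \<delta> where "\<delta> = (1 - r') / 2"
    have \<delta>: "\<delta> > 0" using r' by (simp add: \<delta>_def)
    obtain M where M: "\<And>x. norm x \<le> 1 - \<delta> \<Longrightarrow> u x \<le> M" using u_bounded_inside[of "1 - \<delta>"] \<delta> by auto
    define q where "q = K * p * 2 powr (p - 1) * C1\<^sup>2"
    have "\<forall>\<^sub>F t in at_top. q * (t powr ((p - 1) / 2) * phi f t / sqrt (F t))\<^sup>2 < \<epsilon>"
    proof -
      have "((\<lambda>t. q * (t powr ((p - 1) / 2) * phi f t / sqrt (F t))\<^sup>2) \<longlongrightarrow> q * 0\<^sup>2) at_top"
        by (intro tendsto_intros lim)
      thus ?thesis by (rule order_tendstoD) (use \<epsilon> in simp)
    qed
    moreover have "\<forall>\<^sub>F t in at_top. theta t \<le> 1 / (2 * (C2 + 1)) * integral {t..2 * t} (\<lambda>s. 1 / sqrt (F s))"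
      by (rule theta_small) (use C2 in simp)
    moreover have "\<forall>\<^sub>F t in at_top. 4 * N * C1 * phi f t < \<delta>"
    proof -
      have "((\<lambda>t. 4 * N * C1 * phi f t) \<longlongrightarrow> 4 * N * C1 * 0) at_top" by (intro tendsto_intros phi_tendsto)
      thus ?thesis by (rule order_tendstoD) (use \<delta> in simp)
    qed
    ultimately have "\<forall>\<^sub>F t in at_top. q * (t powr ((p - 1) / 2) * phi f t / sqrt (F t))\<^sup>2 < \<epsilon> \<and>
       theta t \<le> 1 / (2 * (C2 + 1)) * integral {t..2 * t} (\<lambda>s. 1 / sqrt (F s)) \<and> 4 * N * C1 * phi f t < \<delta>"
      by eventually_elim auto
    then obtain t1 where t1: "\<And>t. t1 \<le> t \<Longrightarrow> q * (t powr ((p - 1) / 2) * phi f t / sqrt (F t))\<^sup>2 < \<epsilon> \<and>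
       theta t \<le> 1 / (2 * (C2 + 1)) * integral {t..2 * t} (\<lambda>s. 1 / sqrt (F s)) \<and> 4 * N * C1 * phi f t < \<delta>"
      unfolding eventually_at_top_linorder by blast
    define t where "t = max (max S 1) (max t1 (M + 1))"
    have t: "S \<le> t" "1 \<le> t" "t1 \<le> t" "M < t" by (auto simp: t_def)
    show ?thesis
    proof (rule exI[of _ t], intro ballI allI impI, elim conjE)
      fix x0 y0 :: 'a and s :: real
      assume x0: "x0 \<in> ball 0 1" and y0: "y0 \<in> ball 0 1" and s: "s > 0"
        and cs: "c * s \<le> norm x0 - norm y0" and u0: "t \<le> u x0" "u x0 < u y0"
      define t0 where "t0 = u y0"
      have t0: "S \<le> t0" "1 \<le> t0" "t1 \<le> t0" "b \<le> t0" using t u0 S(1) by (auto simp: t0_def)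
      have F0: "1 \<le> F t0" "1 \<le> sqrt (F t0)" using S(2)[OF t0(1)] by auto
      have "c * s \<le> C * theta t0"
        using rev[OF x0 y0] Dmono[of "u x0" "u y0"] cs u0 t unfolding t0_def by simp
      hence sC: "s \<le> C1 * theta t0" using c by (simp add: C1_def field_simps)
      have th1: "theta t0 \<le> phi f t0"
        unfolding theta_def using F0 phi_nonneg[OF t0(4)] divide_left_mono[of 1 "sqrt (F t0)" "phi f t0"] by simp
      have Ns: "4 * N * s \<le> 4 * N * C1 * theta t0" using sC N by simp
      also have "\<dots> \<le> 4 * N * C1 * phi f t0" using th1 N C1 by (intro mult_left_mono) auto
      also have "\<dots> < \<delta>" using t1[OF t0(3)] by simp
      finally have Nd: "4 * N * s < \<delta>" .
      \<comment> \<open>Bounds the derivative of \<open>K * t powr p\<close> on positive arguments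
        up to \<open>2 * t0\<close>, which limits the values of \<open>u\<close> near
        \<open>y0\<close>.\<close>
      define Q where "Q = K * p * (2 * t0) powr (p - 1)"
      have Q: "Q \<ge> 0" using p by (simp add: Q_def)
      show "\<exists>Q\<ge>0. Q * s\<^sup>2 \<le> \<epsilon> \<and> (\<forall>x\<in>ball 0 1. \<forall>y\<in>ball 0 1.
             norm (x - x0) \<le> 4 * real DIM('a) * s \<and> norm (y - y0) \<le> 4 * real DIM('a) * s \<and> u x < u y \<longrightarrow>
             - Q * (u y - u x) \<le> f (u y) - f (u x))"
      proof (intro exI[of _ Q] conjI ballI impI)
        show "0 \<le> Q" by (rule Q)
        have "Q * s\<^sup>2 \<le> Q * (C1 * theta t0)\<^sup>2" using sC s Q by (intro mult_left_mono power_mono) auto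
        also have "\<dots> = q * (t0 powr ((p - 1) / 2) * phi f t0 / sqrt (F t0))\<^sup>2"
        proof -
          have "(t0 powr ((p - 1) / 2))\<^sup>2 = t0 powr (p - 1)"
            using t0 by (simp add: power2_eq_square powr_add[symmetric])
          moreover have "(2 * t0) powr (p - 1) = 2 powr (p - 1) * t0 powr (p - 1)" using t0 by (simp add: powr_mult)
          ultimately show ?thesis
            unfolding Q_def q_def theta_def by (simp add: power_mult_distrib power_divide)
        qed
        also have "\<dots> \<le> \<epsilon>" using t1[OF t0(3)] by simp
        finally show "Q * s\<^sup>2 \<le> \<epsilon>" .
        fix x y :: 'a
        assume xb: "x \<in> ball 0 1" and yb: "y \<in> ball 0 1"
          and near: "norm (x - x0) \<le> 4 * real DIM('a) * s \<and> norm (y - y0) \<le> 4 * real DIM('a) * s \<and> u x < u y"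
        hence x: "x \<in> ball 0 1" "norm (x - x0) \<le> 4 * real DIM('a) * s"
          and y: "y \<in> ball 0 1" "norm (y - y0) \<le> 4 * real DIM('a) * s" and uxy: "u x < u y" by auto
        have "1 - \<delta> < norm x0" using M[of x0] u0 t by force
        moreover have "norm x0 \<le> norm x + norm (x - x0)" by (metis norm_minus_commute norm_triangle_sub)
        ultimately have "r' < norm x" using x(2) Nd unfolding \<delta>_def N_def by argo
        hence ux: "Tm < u x" "1 < u x" using r'(2) x(1) by auto
        \<comment> \<open>Otherwise the drop of \<open>D\<close> from \<open>t0\<close> to
          \<open>2 * t0\<close> would be squeezed into \<open>C2 * theta t0\<close>; the factor
          \<open>1 / (2 * (C2 + 1))\<close> built into \<open>t1\<close> makes
          \<open>theta t0\<close> too small for that.\<close>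
        have uy: "u y \<le> 2 * t0"
        proof (rule ccontr)
          assume "\<not> u y \<le> 2 * t0"
          hence uy: "2 * t0 \<le> u y" "t0 \<le> u y" "S \<le> u y" using t0 by auto
          have "1 - norm y \<le> D (u y) + C * theta (u y)" by (rule up[OF y(1) uy(3)])
          also have "\<dots> \<le> D (2 * t0) + C * theta t0"
            using Dmono[OF _ uy(1)] theta_antimono[OF t0(4) uy(2)] t0 S(3) by (intro add_mono mult_left_mono) auto
          finally have 1: "1 - norm y \<le> D (2 * t0) + C * theta t0" .
          have 2: "D t0 \<le> 1 - norm y0" using lo[OF y0] t0(1) by (simp add: t0_def)
          have "norm y \<le> norm y0 + norm (y - y0)" by (rule norm_triangle_sub)
          hence 3: "norm y \<le> norm y0 + 4 * N * C1 * theta t0" using y(2) Ns unfolding N_def by argo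
          have "D t0 - D (2 * t0) \<le> C * theta t0 + 4 * N * C1 * theta t0" using 1 2 3 by argo
          hence "D t0 - D (2 * t0) \<le> C2 * theta t0" by (simp add: C2_def distrib_right)
          hence 4: "integral {t0..2 * t0} (\<lambda>s. 1 / sqrt (F s)) \<le> 2 * C2 * theta t0" (is "?I \<le> _")
            using I[of t0 "2 * t0"] t0 by simp
          have Ip: "0 < ?I"
          proof -
            have "0 < (2 * t0 - t0) / sqrt (F (2 * t0))" using t0 S(2)[of "2 * t0"] by simp
            also have "\<dots> \<le> ?I" using t0 by (intro inv_integral_ge) auto
            finally show ?thesis .
          qed
          have "theta t0 \<le> 1 / (2 * (C2 + 1)) * ?I" using t1[OF t0(3)] by blast
          hence "2 * C2 * theta t0 \<le> 2 * C2 * (1 / (2 * (C2 + 1)) * ?I)" using C2 by (intro mult_left_mono) auto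
          also have "\<dots> = C2 / (C2 + 1) * ?I" using C2 by (simp add: field_simps)
          also have "\<dots> < 1 * ?I" using C2 Ip by (intro mult_strict_right_mono) auto
          finally show False using 4 by simp
        qed
        have "f (u x) + K * u x powr p \<le> f (u y) + K * u y powr p"
          by (rule mono_onD[OF p(3)]) (use ux uxy in auto)
        hence "f (u y) - f (u x) \<ge> - K * (u y powr p - u x powr p)" by (simp add: algebra_simps)
        moreover have "K * (u y powr p - u x powr p) \<le> K * (p * u y powr (p - 1) * (u y - u x))"
          using powr_diff_le[of "u x" "u y" p] ux uxy p by (intro mult_left_mono) auto
        moreover have "K * (p * u y powr (p - 1) * (u y - u x)) \<le> K * (p * (2 * t0) powr (p - 1) * (u y - u x))"
          using uy ux uxy p by (intro mult_left_mono mult_right_mono powr_mono2) auto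
        ultimately show "- Q * (u y - u x) \<le> f (u y) - f (u x)" unfolding Q_def by (simp add: mult.assoc)
      qed
    qed
  qed
qed

end

section \<open>Uniform blow-up and conclusion\<close>

text \<open>Otherwise points with values at most \<open>M\<close> and norms tending to 1 would
  accumulate at a point of the sphere, contrary to the blow-up there.\<close>

lemma blowup_uniform:
  fixes u :: "'a::euclidean_space \<Rightarrow> real"
  assumes "\<forall>y. norm y = 1 \<longrightarrow> filterlim u at_top (at y within ball 0 1)"
  shows "\<exists>r<1. \<forall>x\<in>ball 0 1. r < norm x \<longrightarrow> M < u x"
proof (rule ccontr)
  assume no: "\<not> ?thesis"
  have "\<exists>x\<in>ball 0 1. 1 - 1 / real (Suc n) < norm x \<and> u x \<le> M" for n
  proof (rule ccontr)
    assume "\<not> ?thesis"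
    hence "\<forall>x\<in>ball 0 1. 1 - 1 / real (Suc n) < norm x \<longrightarrow> M < u x" by force
    moreover have "1 - 1 / real (Suc n) < 1" by simp
    ultimately show False using no by blast
  qed
  then obtain x where x: "\<And>n::nat. x n \<in> ball 0 1" "\<And>n. 1 - 1 / real (Suc n) < norm (x n)" "\<And>n. u (x n) \<le> M"
    by metis
  have "seq_compact (cball (0::'a) 1)" by (simp add: compact_imp_seq_compact)
  moreover have "\<forall>n. x n \<in> cball 0 1" using x(1) by (auto intro: less_imp_le)
  ultimately obtain a \<sigma> where a: "a \<in> cball 0 1" "strict_mono \<sigma>" "(x \<circ> \<sigma>) \<longlonglongrightarrow> a"
    unfolding seq_compact_def by blast
  have "(\<lambda>n. norm (x n)) \<longlonglongrightarrow> 1"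
  proof (rule tendsto_sandwich)
    have "(\<lambda>n. 1 - 1 / real (Suc n)) \<longlonglongrightarrow> 1 - 0"
      by (intro tendsto_intros LIMSEQ_inverse_real_of_nat[unfolded inverse_eq_divide])
    thus "(\<lambda>n. 1 - 1 / real (Suc n)) \<longlonglongrightarrow> 1" by simp
  qed (use x in \<open>auto intro!: always_eventually less_imp_le\<close>)
  hence "(\<lambda>n. norm ((x \<circ> \<sigma>) n)) \<longlonglongrightarrow> 1"
    using LIMSEQ_subseq_LIMSEQ[OF _ a(2), of "\<lambda>n. norm (x n)"] by (simp add: comp_def)
  moreover have "(\<lambda>n. norm ((x \<circ> \<sigma>) n)) \<longlonglongrightarrow> norm a" by (rule tendsto_norm[OF a(3)])
  ultimately have na: "norm a = 1" using LIMSEQ_unique by blast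
  hence "filterlim u at_top (at a within ball 0 1)" using assms by blast
  hence "\<forall>\<^sub>F z in at a within ball 0 1. M < u z" by (simp add: filterlim_at_top_dense)
  moreover have "filterlim (x \<circ> \<sigma>) (at a within ball 0 1) sequentially"
  proof -
    have "x (\<sigma> n) \<noteq> a" for n using x(1)[of "\<sigma> n"] na by auto
    thus ?thesis unfolding filterlim_at using a(3) x(1) by (auto intro!: always_eventually)
  qed
  ultimately have "\<forall>\<^sub>F n in sequentially. M < u ((x \<circ> \<sigma>) n)" unfolding filterlim_iff by blast
  then obtain n where "M < u ((x \<circ> \<sigma>) n)" using eventually_happens' sequentially_bot by blast
  thus False using x(3)[of "\<sigma> n"] by simp
qed

lemma locally_lipschitz_continuous:
  assumes "locally_lipschitz f"
  shows "continuous_on UNIV f"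
proof (rule continuous_at_imp_continuous_on, rule ballI)
  fix x
  obtain e L where e: "e > 0" "L-lipschitz_on (cball x e) f" using assms unfolding locally_lipschitz_def by blast
  have "continuous_on (ball x e) f"
    by (rule continuous_on_subset[OF lipschitz_on_continuous_on[OF e(2)]]) auto
  thus "isCont f x" using e(1) by (simp add: continuous_on_eq_continuous_at)
qed

theorem theorem1p1:
  fixes f :: "real \<Rightarrow> real" and u :: "'a::euclidean_space \<Rightarrow> real"
  assumes lip: "locally_lipschitz f"
    and i: "\<exists>a>0. f a > 0 \<and> (\<forall>t>a. f t \<ge> 0)"
    and ii: "\<exists>t0. (\<forall>s\<ge>t0. prim f s > 0) \<and> (\<lambda>s. 1 / sqrt (prim f s)) integrable_on {t0..}"
    and iii_iv: "\<exists>p>1. \<exists>K>0. (\<exists>T. mono_on {T..} (\<lambda>t. f t + K * t powr p)) \<and>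
        ((\<lambda>t. t powr ((p - 1) / 2) * phi f t / sqrt (prim f t)) \<longlongrightarrow> 0) at_top"
    and C2: "C2_on (ball 0 1) u"
    and eq: "\<forall>x\<in>ball 0 1. laplacian u x = f (u x)"
    and blowup: "\<forall>y. norm y = 1 \<longrightarrow> filterlim u at_top (at y within ball 0 1)"
  shows "(\<exists>v. \<forall>x\<in>ball 0 1. u x = v (norm x)) \<and>
         (\<forall>x\<in>ball 0 1 - {0}. \<exists>d>0.
            ((\<lambda>t. u (x + t *\<^sub>R (x /\<^sub>R norm x))) has_real_derivative d) (at 0))"
proof -
  obtain a where a: "a > 0" "f a > 0" "\<forall>t>a. f t \<ge> 0" using i by blast
  obtain t0 where t0: "\<forall>s\<ge>t0. prim f s > 0" "(\<lambda>s. 1 / sqrt (prim f s)) integrable_on {t0..}" using ii by blast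
  obtain p K Tm where p: "1 < p" "0 < K" "mono_on {Tm..} (\<lambda>t. f t + K * t powr p)"
    "((\<lambda>t. t powr ((p - 1) / 2) * phi f t / sqrt (prim f t)) \<longlongrightarrow> 0) at_top"
    using iii_iv by blast
  define b where "b = max a t0"
  interpret asymptotics f u b
  proof
    show "C2_on (ball 0 1) u" by (rule C2)
    show "laplacian u x = f (u x)" if "x \<in> ball 0 1" for x using eq that by blast
    show "\<exists>r<1. \<forall>x\<in>ball 0 1. r < norm x \<longrightarrow> M < u x" for M by (rule blowup_uniform[OF blowup])
    show "continuous_on UNIV f" by (rule locally_lipschitz_continuous[OF lip])
    show "b > 0" using a by (simp add: b_def)
    \<comment> \<open>Nonnegativity is assumed for \<open>t > a\<close> only; the endpoint
      \<open>t = a\<close>, which occurs when \<open>b = a\<close>, is covered by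
      \<open>f a > 0\<close>.\<close>
    show "0 \<le> f t" if "b \<le> t" for t using a that by (cases "t = a") (auto simp: b_def)
    show "0 < prim f s" if "b \<le> s" for s using t0 that by (simp add: b_def)
    show "(\<lambda>s. 1 / sqrt (prim f s)) integrable_on {b..}"
      by (rule tail_integrable_subset[OF t0(2)]) (use t0(1) in \<open>auto simp: b_def less_imp_le\<close>)
  qed
  interpret moving_plane f u
    by (intro moving_plane.intro large_solution_axioms moving_plane_axioms.intro lip reversal_estimates[OF p])
  \<comment> \<open>The radial function is read off along the ray spanned by one unit
    vector.\<close>
  obtain e :: 'a where e: "e \<in> Basis" using nonempty_Basis by blast
  have "u x = u (norm x *\<^sub>R e)" if "x \<in> ball 0 1" for x
    by (rule radially_symmetric[OF that]) (use e in simp)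
  thus ?thesis using radially_increasing by (auto intro!: exI[of _ "\<lambda>r. u (r *\<^sub>R e)"])
qed

end
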